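(* Let $n\ge 4$. Up to isomorphism there are eight (parametrized families of) solvable indecomposable right Leibniz algebras over $\mathbb{C}$ of dimension $n+1$ whose nilradical is $\mathcal{L}^4$ (a nilradical of codimension one). That is, each algebra listed below is such an algebra, and every such algebra is isomorphic to one of those listed, for some admissible complex values of the parameters. In each item the brackets are those of $\mathcal{L}^4$ on $e_1,\dots,e_n$ together with the ones displayed. For every $n\geq 4$: (i) $\mathfrak{g}_{n+1,1}$: $[e_1,e_{n+1}]=e_1+(a-1)e_3$, $[e_2,e_{n+1}]=2ae_2$, $[e_3,e_{n+1}]=ae_3$, $[e_4,e_{n+1}]=(a-1)e_2+(a+1)e_4$, $[e_i,e_{n+1}]=(a+i-3)e_i$, $[e_{n+1},e_1]=-e_1-(a-1)e_3$, $[e_{n+1},e_3]=-ae_3$, $[e_{n+1},e_4]=(a+1)(e_2-e_4)$, $[e_{n+1},e_i]=(3-i-a)e_i$, $(5\le i\le n)$. (ii) $\mathfrak{g}_{n+1,2}$: $[e_1,e_{n+1}]=e_1+(2-n)e_3$, $[e_2,e_{n+1}]=2(3-n)e_2$, $[e_3,e_{n+1}]=(3-n)e_3$, $[e_4,e_{n+1}]=(2-n)e_2+(4-n)e_4$, $[e_i,e_{n+1}]=(i-n)e_i$, $[e_{n+1},e_{n+1}]=e_n$, $[e_{n+1},e_1]=-e_1+(n-2)e_3$, $[e_{n+1},e_3]=(n-3)e_3$, $[e_{n+1},e_4]=(4-n)(e_2-e_4)$, $[e_{n+1},e_i]=(n-i)e_i$, $(5\le i\le n)$. (iii) $\mathfrak{g}_{n+1,3}$: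 $[e_1,e_{n+1}]=e_3$, $[e_2,e_{n+1}]=2e_2$, $[e_{n+1},e_1]=-e_3$, and for $3\le i\le n$: $[e_i,e_{n+1}]=\delta_{i,4}e_2+e_i+\epsilon e_{i+2}+\sum_{k=i+3}^n b_{k-i-2}e_k$, $[e_{n+1},e_i]=\delta_{i,4}e_2-e_i-\epsilon e_{i+2}-\sum_{k=i+3}^n b_{k-i-2}e_k$, where $\epsilon\in\{0,1\}$, $\delta_{i,4}$ is the Kronecker delta, and $e_k:=0$ for $n<k$ in these formulas (so that $\epsilon=0$ when $n=4$). (iv) $\mathfrak{g}_{n+1,4}$: $[e_1,e_{n+1}]=e_1-e_3$, $[e_3,e_{n+1}]=de_2$, $[e_4,e_{n+1}]=e_4-e_2$, $[e_i,e_{n+1}]=(i-3)e_i$, $[e_{n+1},e_{n+1}]=\epsilon e_2$, $[e_{n+1},e_1]=-e_1+(d+f)e_2+e_3$, $[e_{n+1},e_3]=fe_2$, $[e_{n+1},e_4]=e_2-e_4$, $[e_{n+1},e_i]=(3-i)e_i$, $(5\le i\le n)$, where $\epsilon\in\{0,1\}$ and, if $\epsilon=0$, then $(d,f)\ne(0,0)$. For $n=4$ only: (v) $\mathfrak{g}_{5,5}$: $[e_1,e_5]=ae_1+(b-a+1)e_3$, $[e_2,e_5]=2(b+1)e_2$, $[e_3,e_5]=e_1+be_3$, $[e_4,e_5]=(b-a+2)e_2+(a+b)e_4$, $[e_5,e_1]=-ae_1+(a-b-1)e_3$, $[e_5,e_3]=-e_1-be_3$, $[e_5,e_4]=(a+b)(e_2-e_4)$,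 where $a\neq1$ if $b=-1$. (vi) $\mathfrak{g}_{5,6}$: $[e_1,e_5]=ae_1+(1-2a)e_3$, $[e_2,e_5]=2(1-a)e_2$, $[e_3,e_5]=e_1-ae_3$, $[e_4,e_5]=2(1-a)e_2$, $[e_5,e_5]=e_4$, $[e_5,e_1]=-ae_1+(2a-1)e_3$, $[e_5,e_3]=ae_3-e_1$, where $a\ne1$. (vii) $\mathfrak{g}_{5,7}$: $[e_1,e_5]=a(e_1-e_3)$, $[e_3,e_5]=e_1+fe_2-e_3$, $[e_4,e_5]=(1-a)(e_2-e_4)$, $[e_5,e_5]=\epsilon e_2$, $[e_5,e_1]=-ae_1+(d+f)e_2+ae_3$, $[e_5,e_3]=-e_1+de_2+e_3$, $[e_5,e_4]=(a-1)(e_2-e_4)$, where $\epsilon\in\{0,1\}$, $a\ne1$ and, if $\epsilon=0$, then $(d,f)\neq(0,0)$. (viii) $\mathfrak{g}_{5,8}$: $[e_1,e_5]=ce_2$, $[e_3,e_5]=e_1-e_3$, $[e_4,e_5]=e_2-e_4$, $[e_5,e_5]=\epsilon e_2$, $[e_5,e_1]=(c+d)e_2$, $[e_5,e_3]=-e_1+(d+2c)e_2+e_3$, $[e_5,e_4]=e_4-e_2$, where $c\ne0$ and $\epsilon\in\{0,1\}$.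
   Context: All algebras are finite dimensional over $\mathbb{C}$. A right Leibniz algebra is a vector space $L$ with a bilinear bracket satisfying $[[x,y],z]=[[x,z],y]+[x,[y,z]]$ for all $x,y,z\in L$. $L$ is nilpotent (solvable) if the series $L^0=L$, $L^{k+1}=[L^k,L]$ (resp. $L^{(0)}=L$, $L^{(k+1)}=[L^{(k)},L^{(k)}]$) reaches $0$. The nilradical of a solvable Leibniz algebra is its unique maximal nilpotent (two-sided) ideal. An algebra is indecomposable if it is not a direct sum of two nonzero ideals. For $n\ge4$, $\mathcal{L}^4$ is the $n$-dimensional nilpotent Leibniz algebra with basis $e_1,\dots,e_n$ and only nonzero brackets $[e_1,e_1]=e_2$, $[e_i,e_1]=e_{i+1}$ $(3\le i\le n-1)$, $[e_1,e_3]=2e_2-e_4$, $[e_3,e_3]=e_2$, $[e_1,e_j]=-e_{j+1}$ $(4\le j\le n-1)$. The extended algebra has basis $e_1,\dots,e_n,e_{n+1}$. Brackets of basis elements that are neither displayed nor among those of $\mathcal{L}^4$ are zero. All unspecified parameters are arbitrary complex numbers. *)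

theory Defs
  imports Complex_Main "HOL-Library.Function_Algebras"
begin

text \<open>
  A finite-dimensional complex algebra is a subspace \<open>V\<close> of some complex vector space together with
  a bracket that is bilinear on \<open>V\<close>; values of the bracket outside \<open>V\<close> are irrelevant. Using a
  carrier set (instead of a whole type) allows the dimension to be a term variable and lets ideals be
  regarded as algebras with the same bracket.
\<close>

locale fd_complex_algebra = vector_space scale
  for scale :: "complex \<Rightarrow> 'a::ab_group_add \<Rightarrow> 'a" +
  fixes V :: "'a set" and br :: "'a \<Rightarrow> 'a \<Rightarrow> 'a"
  assumes subspace_V: "subspace V"
    and finite_dim: "\<exists>B. finite B \<and> span B = V"
    and br_closed: "\<lbrakk>x \<in> V; y \<in> V\<rbrakk> \<Longrightarrow> br x y \<in> V"
    and br_add_left: "\<lbrakk>x \<in> V; y \<in> V; z \<in> V\<rbrakk> \<Longrightarrow> br (x + y) z = br x z + br y z"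
    and br_add_right: "\<lbrakk>x \<in> V; y \<in> V; z \<in> V\<rbrakk> \<Longrightarrow> br x (y + z) = br x y + br x z"
    and br_scale_left: "\<lbrakk>x \<in> V; y \<in> V\<rbrakk> \<Longrightarrow> br (scale c x) y = scale c (br x y)"
    and br_scale_right: "\<lbrakk>x \<in> V; y \<in> V\<rbrakk> \<Longrightarrow> br x (scale c y) = scale c (br x y)"
begin

definition product :: "'a set \<Rightarrow> 'a set \<Rightarrow> 'a set" where
  "product A B = span {br x y |x y. x \<in> A \<and> y \<in> B}"

primrec lower_central :: "'a set \<Rightarrow> nat \<Rightarrow> 'a set" where
  "lower_central A 0 = A"
| "lower_central A (Suc k) = product (lower_central A k) A"

primrec derived_series :: "'a set \<Rightarrow> nat \<Rightarrow> 'a set" where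
  "derived_series A 0 = A"
| "derived_series A (Suc k) = product (derived_series A k) (derived_series A k)"

definition nilpotent :: "'a set \<Rightarrow> bool" where
  "nilpotent A \<longleftrightarrow> (\<exists>k. lower_central A k = {0})"

definition solvable :: "'a set \<Rightarrow> bool" where
  "solvable A \<longleftrightarrow> (\<exists>k. derived_series A k = {0})"

definition two_sided_ideal :: "'a set \<Rightarrow> bool" where
  "two_sided_ideal I \<longleftrightarrow>
     subspace I \<and> I \<subseteq> V \<and> (\<forall>x\<in>I. \<forall>y\<in>V. br x y \<in> I \<and> br y x \<in> I)"

definition maximal_nilpotent_ideal :: "'a set \<Rightarrow> bool" where
  "maximal_nilpotent_ideal N \<longleftrightarrow>
     two_sided_ideal N \<and> nilpotent N \<and>
     (\<forall>M. two_sided_ideal M \<and> nilpotent M \<and> N \<subseteq> M \<longrightarrow> M = N)"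

definition is_nilradical :: "'a set \<Rightarrow> bool" where
  "is_nilradical N \<longleftrightarrow>
     maximal_nilpotent_ideal N \<and> (\<forall>M. maximal_nilpotent_ideal M \<longrightarrow> M = N)"

definition indecomposable :: bool where
  "indecomposable \<longleftrightarrow>
     \<not> (\<exists>I J. two_sided_ideal I \<and> two_sided_ideal J \<and> I \<noteq> {0} \<and> J \<noteq> {0} \<and>
            I \<inter> J = {0} \<and> {x + y |x y. x \<in> I \<and> y \<in> J} = V)"

end

locale right_leibniz_algebra = fd_complex_algebra +
  assumes leibniz:
    "\<lbrakk>x \<in> V; y \<in> V; z \<in> V\<rbrakk> \<Longrightarrow> br (br x y) z = br (br x z) y + br x (br y z)"

definition algebra_isomorphic ::
  "(complex \<Rightarrow> 'a::ab_group_add \<Rightarrow> 'a) \<Rightarrow> 'a set \<Rightarrow> ('a \<Rightarrow> 'a \<Rightarrow> 'a) \<Rightarrow>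
   (complex \<Rightarrow> 'b::ab_group_add \<Rightarrow> 'b) \<Rightarrow> 'b set \<Rightarrow> ('b \<Rightarrow> 'b \<Rightarrow> 'b) \<Rightarrow> bool" where
  "algebra_isomorphic s1 V1 br1 s2 V2 br2 \<longleftrightarrow>
     (\<exists>f. bij_betw f V1 V2 \<and>
          (\<forall>x\<in>V1. \<forall>y\<in>V1. f (x + y) = f x + f y) \<and>
          (\<forall>c. \<forall>x\<in>V1. f (s1 c x) = s2 c (f x)) \<and>
          (\<forall>x\<in>V1. \<forall>y\<in>V1. f (br1 x y) = br2 (f x) (f y)))"


text \<open>
  Algebras given by a multiplication table live on the space of functions \<open>nat \<Rightarrow> complex\<close> supported
  on \<open>{1..m}\<close>, with standard basis \<open>E 1, \<dots>, E m\<close>; a table \<open>t\<close> prescribes \<open>[E i, E j] = t i j\<close> for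
  \<open>i, j \<in> {1..m}\<close> (entries with indices outside this range are never used).
\<close>

type_synonym vec = "nat \<Rightarrow> complex"
type_synonym table = "nat \<Rightarrow> nat \<Rightarrow> vec"

definition vscale :: "complex \<Rightarrow> vec \<Rightarrow> vec"  (infixr \<open>*c\<close> 75) where
  "c *c x = (\<lambda>i. c * x i)"

definition E :: "nat \<Rightarrow> vec" where
  "E k = (\<lambda>i. if i = k then 1 else 0)"

definition coord_space :: "nat \<Rightarrow> vec set" where
  "coord_space m = {x. \<forall>i. i \<notin> {1..m} \<longrightarrow> x i = 0}"

definition table_bracket :: "nat \<Rightarrow> table \<Rightarrow> vec \<Rightarrow> vec \<Rightarrow> vec" where
  "table_bracket m t x y = (\<Sum>i=1..m. \<Sum>j=1..m. (x i * y j) *c t i j)"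

definition L4 :: "nat \<Rightarrow> table" where
  "L4 n i j =
     (if i = 1 \<and> j = 1 then E 2
      else if 3 \<le> i \<and> i \<le> n - 1 \<and> j = 1 then E (i + 1)
      else if i = 1 \<and> j = 3 then 2 *c E 2 - E 4
      else if i = 3 \<and> j = 3 then E 2
      else if i = 1 \<and> 4 \<le> j \<and> j \<le> n - 1 then - E (j + 1)
      else 0)"

text \<open>
  \<open>extend_L4 n R S s\<close> is the table on \<open>E 1, \<dots>, E (n + 1)\<close> extending \<open>L4 n\<close> by
  \<open>[E i, E (n + 1)] = R i\<close>, \<open>[E (n + 1), E i] = S i\<close> for \<open>1 \<le> i \<le> n\<close>, and
  \<open>[E (n + 1), E (n + 1)] = s\<close>.
\<close>

definition extend_L4 :: "nat \<Rightarrow> (nat \<Rightarrow> vec) \<Rightarrow> (nat \<Rightarrow> vec) \<Rightarrow> vec \<Rightarrow> table" where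
  "extend_L4 n R S s i j =
     (if i = n + 1 \<and> j = n + 1 then s
      else if j = n + 1 then R i
      else if i = n + 1 then S j
      else L4 n i j)"

definition g1 :: "nat \<Rightarrow> complex \<Rightarrow> table" where
  "g1 n a = extend_L4 n
     (\<lambda>i. if i = 1 then E 1 + (a - 1) *c E 3
          else if i = 2 then (2 * a) *c E 2
          else if i = 3 then a *c E 3
          else if i = 4 then (a - 1) *c E 2 + (a + 1) *c E 4
          else if 5 \<le> i \<and> i \<le> n then (a + of_nat i - 3) *c E i
          else 0)
     (\<lambda>i. if i = 1 then - E 1 - (a - 1) *c E 3
          else if i = 3 then - (a *c E 3)
          else if i = 4 then (a + 1) *c (E 2 - E 4)
          else if 5 \<le> i \<and> i \<le> n then (3 - of_nat i - a) *c E i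
          else 0)
     0"

definition g2 :: "nat \<Rightarrow> table" where
  "g2 n = extend_L4 n
     (\<lambda>i. if i = 1 then E 1 + (2 - of_nat n) *c E 3
          else if i = 2 then (2 * (3 - of_nat n)) *c E 2
          else if i = 3 then (3 - of_nat n) *c E 3
          else if i = 4 then (2 - of_nat n) *c E 2 + (4 - of_nat n) *c E 4
          else if 5 \<le> i \<and> i \<le> n then (of_nat i - of_nat n) *c E i
          else 0)
     (\<lambda>i. if i = 1 then - E 1 + (of_nat n - 2) *c E 3
          else if i = 3 then (of_nat n - 3) *c E 3
          else if i = 4 then (4 - of_nat n) *c (E 2 - E 4)
          else if 5 \<le> i \<and> i \<le> n then (of_nat n - of_nat i) *c E i
          else 0)
     (E n)"

definition g3 :: "nat \<Rightarrow> complex \<Rightarrow> (nat \<Rightarrow> complex) \<Rightarrow> table" where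
  "g3 n \<epsilon> b = extend_L4 n
     (\<lambda>i. if i = 1 then E 3
          else if i = 2 then 2 *c E 2
          else if 3 \<le> i \<and> i \<le> n then
            (if i = 4 then E 2 else 0) + E i + (if i + 2 \<le> n then \<epsilon> *c E (i + 2) else 0)
            + (\<Sum>k=i+3..n. b (k - i - 2) *c E k)
          else 0)
     (\<lambda>i. if i = 1 then - E 3
          else if 3 \<le> i \<and> i \<le> n then
            (if i = 4 then E 2 else 0) - E i - (if i + 2 \<le> n then \<epsilon> *c E (i + 2) else 0)
            - (\<Sum>k=i+3..n. b (k - i - 2) *c E k)
          else 0)
     0"

definition g4 :: "nat \<Rightarrow> complex \<Rightarrow> complex \<Rightarrow> complex \<Rightarrow> table" where
  "g4 n \<epsilon> d f = extend_L4 n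
     (\<lambda>i. if i = 1 then E 1 - E 3
          else if i = 3 then d *c E 2
          else if i = 4 then E 4 - E 2
          else if 5 \<le> i \<and> i \<le> n then (of_nat i - 3) *c E i
          else 0)
     (\<lambda>i. if i = 1 then - E 1 + (d + f) *c E 2 + E 3
          else if i = 3 then f *c E 2
          else if i = 4 then E 2 - E 4
          else if 5 \<le> i \<and> i \<le> n then (3 - of_nat i) *c E i
          else 0)
     (\<epsilon> *c E 2)"

definition g5 :: "complex \<Rightarrow> complex \<Rightarrow> table" where
  "g5 a b = extend_L4 4
     (\<lambda>i. if i = 1 then a *c E 1 + (b - a + 1) *c E 3
          else if i = 2 then (2 * (b + 1)) *c E 2
          else if i = 3 then E 1 + b *c E 3
          else if i = 4 then (b - a + 2) *c E 2 + (a + b) *c E 4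
          else 0)
     (\<lambda>i. if i = 1 then - (a *c E 1) + (a - b - 1) *c E 3
          else if i = 3 then - E 1 - b *c E 3
          else if i = 4 then (a + b) *c (E 2 - E 4)
          else 0)
     0"

definition g6 :: "complex \<Rightarrow> table" where
  "g6 a = extend_L4 4
     (\<lambda>i. if i = 1 then a *c E 1 + (1 - 2 * a) *c E 3
          else if i = 2 then (2 * (1 - a)) *c E 2
          else if i = 3 then E 1 - a *c E 3
          else if i = 4 then (2 * (1 - a)) *c E 2
          else 0)
     (\<lambda>i. if i = 1 then - (a *c E 1) + (2 * a - 1) *c E 3
          else if i = 3 then a *c E 3 - E 1
          else 0)
     (E 4)"

definition g7 :: "complex \<Rightarrow> complex \<Rightarrow> complex \<Rightarrow> complex \<Rightarrow> table" where
  "g7 a \<epsilon> d f = extend_L4 4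
     (\<lambda>i. if i = 1 then a *c (E 1 - E 3)
          else if i = 3 then E 1 + f *c E 2 - E 3
          else if i = 4 then (1 - a) *c (E 2 - E 4)
          else 0)
     (\<lambda>i. if i = 1 then - (a *c E 1) + (d + f) *c E 2 + a *c E 3
          else if i = 3 then - E 1 + d *c E 2 + E 3
          else if i = 4 then (a - 1) *c (E 2 - E 4)
          else 0)
     (\<epsilon> *c E 2)"

definition g8 :: "complex \<Rightarrow> complex \<Rightarrow> complex \<Rightarrow> table" where
  "g8 c \<epsilon> d = extend_L4 4
     (\<lambda>i. if i = 1 then c *c E 2
          else if i = 3 then E 1 - E 3
          else if i = 4 then E 2 - E 4
          else 0)
     (\<lambda>i. if i = 1 then (c + d) *c E 2
          else if i = 3 then - E 1 + (d + 2 * c) *c E 2 + E 3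
          else if i = 4 then E 4 - E 2
          else 0)
     (\<epsilon> *c E 2)"

inductive listed :: "nat \<Rightarrow> table \<Rightarrow> bool" for n :: nat where
  i: "listed n (g1 n a)"
| ii: "listed n (g2 n)"
| iii: "\<epsilon> \<in> {0, 1} \<Longrightarrow> listed n (g3 n \<epsilon> b)"
| iv: "\<epsilon> \<in> {0, 1} \<Longrightarrow> (\<epsilon> = 0 \<Longrightarrow> (d, f) \<noteq> (0, 0)) \<Longrightarrow> listed n (g4 n \<epsilon> d f)"
| v: "n = 4 \<Longrightarrow> (b = -1 \<Longrightarrow> a \<noteq> 1) \<Longrightarrow> listed n (g5 a b)"
| vi: "n = 4 \<Longrightarrow> a \<noteq> 1 \<Longrightarrow> listed n (g6 a)"
| vii: "n = 4 \<Longrightarrow> \<epsilon> \<in> {0, 1} \<Longrightarrow> a \<noteq> 1 \<Longrightarrow> (\<epsilon> = 0 \<Longrightarrow> (d, f) \<noteq> (0, 0)) \<Longrightarrow>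
    listed n (g7 a \<epsilon> d f)"
| viii: "n = 4 \<Longrightarrow> c \<noteq> 0 \<Longrightarrow> \<epsilon> \<in> {0, 1} \<Longrightarrow> listed n (g8 c \<epsilon> d)"

definition solvable_indecomposable_with_nilradical_L4 ::
  "nat \<Rightarrow> (complex \<Rightarrow> 'a::ab_group_add \<Rightarrow> 'a) \<Rightarrow> 'a set \<Rightarrow> ('a \<Rightarrow> 'a \<Rightarrow> 'a) \<Rightarrow> bool" where
  "solvable_indecomposable_with_nilradical_L4 n scale V br \<longleftrightarrow>
     right_leibniz_algebra scale V br \<and>
     vector_space.dim scale V = n + 1 \<and>
     fd_complex_algebra.solvable scale br V \<and>
     fd_complex_algebra.indecomposable scale V br \<and>
     (\<exists>N. fd_complex_algebra.is_nilradical scale V br N \<and>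
          algebra_isomorphic scale N br vscale (coord_space n) (table_bracket n (L4 n)))"

end

theory Submission
  imports Defs
begin

text \<open>
  Write \<open>w\<^sub>4 = e\<^sub>4 - e\<^sub>2\<close> and \<open>l x = x\<^sub>1 + x\<^sub>3\<close>. In the basis with \<open>e\<^sub>4\<close> replaced by \<open>w\<^sub>4\<close>, the bracket of
  \<open>L4\<close> is that of a filiform Lie algebra plus the central term \<open>l x * l y\<close> times \<open>e\<^sub>2\<close>. Right
  multiplication \<open>D\<close> by the extra basis vector is a derivation, hence determined by its values on the
  generators \<open>e\<^sub>1, e\<^sub>3\<close>. Modulo the derived algebra it preserves \<open>l\<close> up to a factor \<open>a\<close> and the
  line spanned by \<open>e\<^sub>3 - e\<^sub>1\<close>, on which it acts by a factor \<open>m\<close>. Left multiplication \<open>L\<close> differs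
  from \<open>- D\<close> by a map into the right annihilator, the span of \<open>e\<^sub>2\<close> and \<open>e\<^sub>n\<close>, and the Leibniz
  identity leaves only the parameters of the tables \<open>model\<close>. All listed algebras are such models.
  Conversely, as the nilradical is proper, \<open>(a, m) \<noteq> (0, 0)\<close>. If \<open>m \<noteq> 0\<close> then \<open>e\<^sub>3\<close> can be made an
  eigenvector of \<open>D\<close> modulo \<open>e\<^sub>2\<close> and rescaling leads to (i), (ii) and (iv); if \<open>m = 0\<close> one arrives at
  (iii). The only exception is \<open>n = 4\<close> with \<open>a = m\<close> and a nontrivial Jordan block, which is (v) with
  \<open>a = 2, b = 0\<close>.
\<close>

section \<open>Algebras and isomorphisms in coordinates\<close>

text \<open>The form \<open>l\<close> controls everything because e_1 and e_3 have the same square: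
  a derivation must change \<open>l\<close> on both generators by the same factor, and another pair
  of generators can satisfy the same table only if \<open>l\<close> agrees on them. In the code the
  eigenvalue called \<open>m\<close> above is \<mu> - \<kappa>. The eigenvector for \<open>a\<close>
  lifts from the quotient because the diagonal entry of \<open>D\<close> at e_k, once \<kappa> = 0,
  is a + (k - 3) \<mu>, which differs from \<open>a\<close> in characteristic 0 when \<mu> is
  nonzero; e_2 has the entry 2 a instead, so a component along e_2 may stay behind. Lower entries of
  \<open>D\<close> on e_1 are removed by inner derivations, that is, by adding an element of the
  nilradical to the last basis vector; those on e_3 from index 5 on survive only when \<mu> = 0.
  Rescaling uses the grading with e_1, e_3 in degree 1, e_2 in degree 2 and e_k in degree k - 2;
  complex roots turn a surviving constant into 1. Maximality of the nilradical is used in the form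
  that the whole algebra is not nilpotent, an isomorphism invariant that survives every change of
  basis.\<close>

declare One_nat_def [simp del]

context fd_complex_algebra
begin

lemma zero_in_V: "0 \<in> V" and add_in_V: "x \<in> V \<Longrightarrow> y \<in> V \<Longrightarrow> x + y \<in> V"
  and scale_in_V: "x \<in> V \<Longrightarrow> scale c x \<in> V"
  using subspace_V subspace_0 subspace_add subspace_scale by auto

lemma sum_in_V: "(\<And>i. i \<in> A \<Longrightarrow> f i \<in> V) \<Longrightarrow> (\<Sum>i\<in>A. f i) \<in> V"
  using subspace_V subspace_sum by auto

lemma br_zero_left: "y \<in> V \<Longrightarrow> br 0 y = 0" and br_zero_right: "y \<in> V \<Longrightarrow> br y 0 = 0"
  using br_scale_left[of 0 y 0] br_scale_right[of y 0 0] zero_in_V by auto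

lemma br_sum_left:
  assumes "finite A" "\<And>i. i \<in> A \<Longrightarrow> f i \<in> V" "y \<in> V"
  shows "br (\<Sum>i\<in>A. f i) y = (\<Sum>i\<in>A. br (f i) y)"
  using assms by (induction A) (auto simp: br_zero_left br_add_left sum_in_V)

lemma br_sum_right:
  assumes "finite A" "\<And>i. i \<in> A \<Longrightarrow> f i \<in> V" "y \<in> V"
  shows "br y (\<Sum>i\<in>A. f i) = (\<Sum>i\<in>A. br y (f i))"
  using assms by (induction A) (auto simp: br_zero_right br_add_right sum_in_V)

lemma product_subset:
  assumes "subspace F" "\<And>x y. x \<in> A \<Longrightarrow> y \<in> B \<Longrightarrow> br x y \<in> F"
  shows "product A B \<subseteq> F"
  unfolding product_def using assms by (intro span_minimal) auto

lemma br_in_product: "x \<in> A \<Longrightarrow> y \<in> B \<Longrightarrow> br x y \<in> product A B"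
  unfolding product_def by (rule span_base) blast

text \<open>Only the inclusion of the lower central series in \<open>F\<close> has to be checked, so
  chains given by vanishing coordinates suffice and no span is computed. Where \<open>F\<close> is
  zero the inclusion becomes an equality, as every term contains 0.\<close>

lemma nilpotent_if_filtration:
  assumes "subspace A" "A \<subseteq> F 0" "\<And>k. subspace (F k)" "F m = {0}"
    and "\<And>k x y. x \<in> F k \<Longrightarrow> y \<in> A \<Longrightarrow> br x y \<in> F (Suc k)"
  shows "nilpotent A"
proof -
  have "lower_central A k \<subseteq> F k" for k
  proof (induction k)
    case (Suc k)
    then show ?case using assms(3,5) by simp (intro product_subset; blast)
  qed (use assms in auto)
  moreover have "0 \<in> lower_central A k" for k
    using assms(1) subspace_0 by (cases k) (auto simp: product_def span_zero)
  ultimately show ?thesis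
    unfolding nilpotent_def using assms(4) by (metis subset_antisym empty_subsetI insert_subset)
qed

lemma solvable_if_filtration:
  assumes "subspace A" "A \<subseteq> F 0" "\<And>k. subspace (F k)" "F m = {0}"
    and "\<And>k x y. x \<in> F k \<Longrightarrow> y \<in> F k \<Longrightarrow> br x y \<in> F (Suc k)"
  shows "solvable A"
proof -
  have "derived_series A k \<subseteq> F k" for k
  proof (induction k)
    case (Suc k)
    then show ?case using assms(3,5) by simp (intro product_subset; blast)
  qed (use assms in auto)
  moreover have "0 \<in> derived_series A k" for k
    using assms(1) subspace_0 by (cases k) (auto simp: product_def span_zero)
  ultimately show ?thesis
    unfolding solvable_def using assms(4) by (metis subset_antisym empty_subsetI insert_subset)
qed

end

section \<open>Isomorphism as an equivalence relation\<close>

lemma algebra_isomorphic_trans: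
  assumes "algebra_isomorphic s1 V1 br1 s2 V2 br2" "algebra_isomorphic s2 V2 br2 s3 V3 br3"
  shows "algebra_isomorphic s1 V1 br1 s3 V3 br3"
proof -
  obtain f where f: "bij_betw f V1 V2" "\<And>x y. x\<in>V1 \<Longrightarrow> y\<in>V1 \<Longrightarrow> f (x + y) = f x + f y"
      "\<And>c x. x\<in>V1 \<Longrightarrow> f (s1 c x) = s2 c (f x)"
      "\<And>x y. x\<in>V1 \<Longrightarrow> y\<in>V1 \<Longrightarrow> f (br1 x y) = br2 (f x) (f y)"
    using assms(1) unfolding algebra_isomorphic_def by blast
  obtain g where g: "bij_betw g V2 V3" "\<And>x y. x\<in>V2 \<Longrightarrow> y\<in>V2 \<Longrightarrow> g (x + y) = g x + g y"
      "\<And>c x. x\<in>V2 \<Longrightarrow> g (s2 c x) = s3 c (g x)"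
      "\<And>x y. x\<in>V2 \<Longrightarrow> y\<in>V2 \<Longrightarrow> g (br2 x y) = br3 (g x) (g y)"
    using assms(2) unfolding algebra_isomorphic_def by blast
  have "f x \<in> V2" if "x \<in> V1" for x using f(1) that bij_betwE by blast
  then show ?thesis
    unfolding algebra_isomorphic_def
    by (intro exI[of _ "g \<circ> f"]) (auto simp: bij_betw_trans[OF f(1) g(1)] f g)
qed

lemma algebra_isomorphic_sym:
  assumes iso: "algebra_isomorphic s1 V1 br1 s2 V2 br2"
    and closed: "\<And>x y. x\<in>V1 \<Longrightarrow> y\<in>V1 \<Longrightarrow> x + y \<in> V1" "\<And>c x. x\<in>V1 \<Longrightarrow> s1 c x \<in> V1"
      "\<And>x y. x\<in>V1 \<Longrightarrow> y\<in>V1 \<Longrightarrow> br1 x y \<in> V1"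
  shows "algebra_isomorphic s2 V2 br2 s1 V1 br1"
proof -
  obtain f where f: "bij_betw f V1 V2" "\<And>x y. x\<in>V1 \<Longrightarrow> y\<in>V1 \<Longrightarrow> f (x + y) = f x + f y"
      "\<And>c x. x\<in>V1 \<Longrightarrow> f (s1 c x) = s2 c (f x)"
      "\<And>x y. x\<in>V1 \<Longrightarrow> y\<in>V1 \<Longrightarrow> f (br1 x y) = br2 (f x) (f y)"
    using iso unfolding algebra_isomorphic_def by blast
  define g where "g = inv_into V1 f"
  have g: "bij_betw g V2 V1" using bij_betw_inv_into[OF f(1)] by (simp add: g_def)
  have gV: "g x \<in> V1" if "x \<in> V2" for x using g that bij_betwE by blast
  have fg: "f (g x) = x" if "x \<in> V2" for x
    using f(1) that by (simp add: g_def bij_betw_inv_into_right)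
  have gf: "g (f x) = x" if "x \<in> V1" for x
    using f(1) that by (simp add: g_def bij_betw_inv_into_left)
  have "g (x + y) = g x + g y" if "x \<in> V2" "y \<in> V2" for x y
    using gf[of "g x + g y"] that by (simp add: f closed gV fg)
  moreover have "g (s2 c x) = s1 c (g x)" if "x \<in> V2" for x c
    using gf[of "s1 c (g x)"] that by (simp add: f closed gV fg)
  moreover have "g (br2 x y) = br1 (g x) (g y)" if "x \<in> V2" "y \<in> V2" for x y
    using gf[of "br1 (g x) (g y)"] that by (simp add: f closed gV fg)
  ultimately show ?thesis unfolding algebra_isomorphic_def using g by blast
qed

section \<open>Coordinate spaces and brackets given by tables\<close>

lemma vector_space_vscale: "vector_space vscale"
  by standard (auto simp: vscale_def fun_eq_iff algebra_simps)

interpretation cvec: vector_space vscale by (rule vector_space_vscale)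

lemma vscale_apply [simp]: "(c *c x) i = c * x i"
  by (simp add: vscale_def)

lemma sum_fun_apply [simp]: "(\<Sum>i\<in>A. f i) k = (\<Sum>i\<in>A. f i k)" for f :: "'i \<Rightarrow> 'k \<Rightarrow> complex"
  by (induction A rule: infinite_finite_induct) auto

lemma E_apply: "E k i = (if i = k then 1 else 0)"
  by (simp add: E_def)

lemma subspace_coord_space: "cvec.subspace (coord_space m)"
  by (auto simp: cvec.subspace_def coord_space_def)

lemma E_in_coord_space: "1 \<le> k \<Longrightarrow> k \<le> m \<Longrightarrow> E k \<in> coord_space m"
  by (auto simp: coord_space_def E_apply)

lemma sum_coord_E: "x \<in> coord_space m \<Longrightarrow> (\<Sum>i=1..m. x i *c E i) = x"
proof
  fix k assume "x \<in> coord_space m"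
  moreover have "(\<Sum>i=1..m. x i *c E i) k = (\<Sum>i=1..m. if i = k then x i else 0)"
    unfolding sum_fun_apply by (intro sum.cong refl) (simp add: E_apply)
  ultimately show "(\<Sum>i=1..m. x i *c E i) k = x k"
    by (auto simp: coord_space_def)
qed

lemma E_eq_iff: "E i = E j \<longleftrightarrow> i = j"
  by (metis E_apply zero_neq_one)

lemma span_E: "cvec.span (E ` {1..m}) = coord_space m"
proof
  show "cvec.span (E ` {1..m}) \<subseteq> coord_space m"
    by (intro cvec.span_minimal subspace_coord_space) (auto intro: E_in_coord_space)
  show "coord_space m \<subseteq> cvec.span (E ` {1..m})"
  proof
    fix x assume "x \<in> coord_space m"
    then have "x = (\<Sum>i=1..m. x i *c E i)" by (rule sum_coord_E[symmetric])
    also have "\<dots> \<in> cvec.span (E ` {1..m})"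
      by (intro cvec.span_sum cvec.span_scale cvec.span_base) auto
    finally show "x \<in> cvec.span (E ` {1..m})" .
  qed
qed

lemma independent_E: "cvec.independent (E ` {1..m})"
proof (rule cvec.independent_if_scalars_zero)
  fix f :: "vec \<Rightarrow> complex" and x
  assume z: "(\<Sum>x\<in>E ` {1..m}. f x *c x) = 0" and "x \<in> E ` {1..m}"
  then obtain k where k: "k \<in> {1..m}" "x = E k" by auto
  have "(\<Sum>x\<in>E ` {1..m}. f x *c x) = (\<Sum>i=1..m. f (E i) *c E i)"
    by (subst sum.reindex) (auto simp: inj_on_def E_eq_iff)
  then have "0 = (\<Sum>i=1..m. f (E i) *c E i) k" using z by simp
  also have "\<dots> = (\<Sum>i=1..m. if i = k then f (E i) else 0)"
    unfolding sum_fun_apply by (intro sum.cong refl) (simp add: E_apply)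
  finally show "f x = 0" using k by simp
qed auto

lemma dim_coord_space: "cvec.dim (coord_space m) = m"
proof -
  have "cvec.dim (coord_space m) = card (E ` {1..m})"
    using cvec.dim_span_eq_card_independent[OF independent_E[of m]] unfolding span_E .
  then show ?thesis by (simp add: card_image inj_on_def E_eq_iff)
qed

lemma table_bracket_in_coord_space:
  assumes "\<And>i j. i \<in> {1..m} \<Longrightarrow> j \<in> {1..m} \<Longrightarrow> t i j \<in> coord_space m"
  shows "table_bracket m t x y \<in> coord_space m"
  unfolding table_bracket_def
  using assms by (intro cvec.subspace_sum[OF subspace_coord_space] cvec.subspace_scale[OF subspace_coord_space])

lemma fd_complex_algebra_table:
  assumes "\<And>i j. i \<in> {1..m} \<Longrightarrow> j \<in> {1..m} \<Longrightarrow> t i j \<in> coord_space m"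
  shows "fd_complex_algebra vscale (coord_space m) (table_bracket m t)"
proof
  show "cvec.subspace (coord_space m)" by (rule subspace_coord_space)
  show "\<exists>B. finite B \<and> cvec.span B = coord_space m"
    using span_E by (intro exI[of _ "E ` {1..m}"]) auto
  fix x y z :: vec and c :: complex
  show "table_bracket m t x y \<in> coord_space m" by (rule table_bracket_in_coord_space[OF assms])
  show "table_bracket m t (x + y) z = table_bracket m t x z + table_bracket m t y z"
    by (simp add: table_bracket_def fun_eq_iff distrib_right sum.distrib)
  show "table_bracket m t x (y + z) = table_bracket m t x y + table_bracket m t x z"
    by (simp add: table_bracket_def fun_eq_iff distrib_left distrib_right sum.distrib)
  show "table_bracket m t (c *c x) y = c *c table_bracket m t x y"
    by (simp add: table_bracket_def fun_eq_iff sum_distrib_left mult.assoc)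
  show "table_bracket m t x (c *c y) = c *c table_bracket m t x y"
    by (simp add: table_bracket_def fun_eq_iff sum_distrib_left mult.left_commute mult.assoc)
qed

lemma table_bracket_E:
  assumes "i \<in> {1..m}" "j \<in> {1..m}"
  shows "table_bracket m t (E i) (E j) = t i j"
proof
  fix k
  have "table_bracket m t (E i) (E j) k = (\<Sum>i'=1..m. \<Sum>j'=1..m. if j' = j then (if i' = i then t i' j' k else 0) else 0)"
    unfolding table_bracket_def sum_fun_apply by (intro sum.cong refl) (simp add: E_apply)
  also have "\<dots> = (\<Sum>i'=1..m. if i' = i then t i' j k else 0)"
    using assms(2) by (intro sum.cong refl) (simp add: sum.delta)
  also have "\<dots> = t i j k" using assms(1) by (simp add: sum.delta)
  finally show "table_bracket m t (E i) (E j) k = t i j k" .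
qed

section \<open>From a basis of an algebra to its multiplication table\<close>

context fd_complex_algebra
begin

lemma br_sum_sum:
  fixes m :: nat
  assumes "\<And>i. i \<in> {1..m} \<Longrightarrow> b i \<in> V"
  shows "br (\<Sum>i=1..m. scale (x i) (b i)) (\<Sum>j=1..m. scale (y j) (b j))
       = (\<Sum>i=1..m. \<Sum>j=1..m. scale (x i * y j) (br (b i) (b j)))"
proof -
  have "br (\<Sum>i=1..m. scale (x i) (b i)) (\<Sum>j=1..m. scale (y j) (b j))
      = (\<Sum>i=1..m. br (scale (x i) (b i)) (\<Sum>j=1..m. scale (y j) (b j)))"
    by (intro br_sum_left scale_in_V sum_in_V assms) auto
  also have "\<dots> = (\<Sum>i=1..m. \<Sum>j=1..m. br (scale (x i) (b i)) (scale (y j) (b j)))"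
    by (intro sum.cong[OF refl] br_sum_right scale_in_V assms) auto
  also have "\<dots> = (\<Sum>i=1..m. \<Sum>j=1..m. scale (x i * y j) (br (b i) (b j)))"
    using assms by (intro sum.cong refl) (auto simp: br_scale_left br_scale_right scale_in_V)
  finally show ?thesis .
qed

text \<open>Independent vectors, as many as the dimension, span: their set extends to a basis inside
  \<open>V\<close>, and counting shows that nothing was added. Independence is stated for indexed
  families, so distinctness of the \<open>b i\<close> is derived from injectivity of the coordinate
  map.\<close>

lemma bij_betw_coordinates:
  fixes m :: nat
  assumes bV: "\<And>i. i \<in> {1..m} \<Longrightarrow> b i \<in> V"
    and indep: "\<And>c. (\<Sum>i=1..m. scale (c i) (b i)) = 0 \<Longrightarrow> \<forall>i\<in>{1..m}. c i = 0"
    and dimV: "dim V = m"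
  shows "bij_betw (\<lambda>x. \<Sum>i=1..m. scale (x i) (b i)) (coord_space m) V"
proof -
  define g :: "vec \<Rightarrow> 'a" where "g x = (\<Sum>i=1..m. scale (x i) (b i))" for x
  have gadd: "g (x + y) = g x + g y" for x y
    by (simp add: g_def scale_left_distrib sum.distrib)
  have gscale: "g (c *c x) = scale c (g x)" for c x
    by (simp add: g_def scale_sum_right)
  have g0: "g 0 = 0" by (simp add: g_def)
  have ker: "x = 0" if "x \<in> coord_space m" "g x = 0" for x
    using indep[of x] that unfolding g_def coord_space_def by (auto simp: fun_eq_iff)
  have inj: "inj_on g (coord_space m)"
  proof (rule inj_onI)
    fix x y assume xy: "x \<in> coord_space m" "y \<in> coord_space m" "g x = g y"
    have "g (x - y) = 0" using gadd[of "x - y" y] xy(3) by simp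
    then have "x - y = 0" using ker xy cvec.subspace_diff[OF subspace_coord_space] by blast
    then show "x = y" by simp
  qed
  have gE: "g (E i) = b i" if "i \<in> {1..m}" for i
    using that by (simp add: g_def E_apply if_distrib if_distribR cong: if_cong)
  have inj_b: "inj_on b {1..m}"
  proof (rule inj_onI)
    fix i j assume ij: "i \<in> {1..m}" "j \<in> {1..m}" "b i = b j"
    then have "g (E i) = g (E j)" using gE by simp
    then have "E i = E j" using inj_onD[OF inj] ij E_in_coord_space by simp
    then show "i = j" by (simp add: E_eq_iff)
  qed
  have gV: "g x \<in> V" for x
    unfolding g_def using bV by (intro sum_in_V scale_in_V)
  have "independent (b ` {1..m})"
  proof (rule independent_if_scalars_zero)
    fix f x assume z: "(\<Sum>x\<in>b ` {1..m}. scale (f x) x) = 0" and x: "x \<in> b ` {1..m}"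
    have "(\<Sum>i=1..m. scale (f (b i)) (b i)) = 0"
      using z by (subst (asm) sum.reindex) (auto simp: inj_b)
    then show "f x = 0" using indep[of "\<lambda>i. f (b i)"] x by auto
  qed auto
  then obtain B where B: "b ` {1..m} \<subseteq> B" "B \<subseteq> V" "independent B" "V \<subseteq> span B"
    using maximal_independent_subset_extend[of "b ` {1..m}" V] bV by blast
  have "card B = m" using basis_card_eq_dim[OF B(2) B(4) B(3)] dimV by simp
  moreover obtain B0 where "finite B0" "span B0 = V" using finite_dim by blast
  then have "finite B" using independent_span_bound[of B0 B] B by auto
  moreover have "card (b ` {1..m}) = m" using inj_b by (simp add: card_image)
  ultimately have "b ` {1..m} = B" using B(1) by (intro card_subset_eq) auto
  then have V: "V \<subseteq> span (b ` {1..m})" using B(4) by simp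
  have "V \<subseteq> g ` coord_space m"
  proof -
    have "subspace (g ` coord_space m)"
      unfolding subspace_def
    proof (intro conjI ballI allI)
      show "0 \<in> g ` coord_space m"
        using g0 cvec.subspace_0[OF subspace_coord_space] by (metis image_eqI)
      show "x + y \<in> g ` coord_space m" if "x \<in> g ` coord_space m" "y \<in> g ` coord_space m" for x y
        using that cvec.subspace_add[OF subspace_coord_space] by (auto simp: gadd[symmetric])
      show "scale c x \<in> g ` coord_space m" if "x \<in> g ` coord_space m" for c x
        using that cvec.subspace_scale[OF subspace_coord_space] by (auto simp: gscale[symmetric])
    qed
    then have "span (b ` {1..m}) \<subseteq> g ` coord_space m"
      by (intro span_minimal) (auto simp: gE[symmetric] E_in_coord_space)
    then show ?thesis using V by blast
  qed
  then show ?thesis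
    using inj gV unfolding bij_betw_def g_def[symmetric] by blast
qed

text \<open>By bilinearity it is enough to compare brackets of basis vectors. The map is built on
  the coordinate space, where linearity is immediate, and then inverted.\<close>

lemma basis_isomorphism:
  fixes m :: nat
  assumes bV: "\<And>i. i \<in> {1..m} \<Longrightarrow> b i \<in> V"
    and indep: "\<And>c. (\<Sum>i=1..m. scale (c i) (b i)) = 0 \<Longrightarrow> \<forall>i\<in>{1..m}. c i = 0"
    and dimV: "dim V = m"
    and t: "\<And>i j. i \<in> {1..m} \<Longrightarrow> j \<in> {1..m} \<Longrightarrow> t i j \<in> coord_space m"
    and br_b: "\<And>i j. i \<in> {1..m} \<Longrightarrow> j \<in> {1..m} \<Longrightarrow> br (b i) (b j) = (\<Sum>k=1..m. scale (t i j k) (b k))"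
  shows "algebra_isomorphic scale V br vscale (coord_space m) (table_bracket m t)"
proof -
  define g :: "vec \<Rightarrow> 'a" where "g x = (\<Sum>i=1..m. scale (x i) (b i))" for x
  have bij: "bij_betw g (coord_space m) V"
    unfolding g_def by (rule bij_betw_coordinates[OF bV indep dimV])
  have gadd: "g (x + y) = g x + g y" for x y
    by (simp add: g_def scale_left_distrib sum.distrib)
  have gscale: "g (c *c x) = scale c (g x)" for c x
    by (simp add: g_def scale_sum_right)
  have g0: "g 0 = 0" by (simp add: g_def)
  have gsum: "g (\<Sum>i\<in>A. f i) = (\<Sum>i\<in>A. g (f i))" if "finite A" for A :: "nat set" and f
    using that by (induction A) (simp_all only: sum.empty sum.insert g0 gadd not_False_eq_True)
  have gbr: "g (table_bracket m t x y) = br (g x) (g y)" for x y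
  proof -
    have "g (table_bracket m t x y) = (\<Sum>i=1..m. \<Sum>j=1..m. scale (x i * y j) (g (t i j)))"
      by (simp add: table_bracket_def gsum gscale)
    also have "\<dots> = (\<Sum>i=1..m. \<Sum>j=1..m. scale (x i * y j) (br (b i) (b j)))"
      using br_b by (intro sum.cong refl) (simp add: g_def)
    also have "\<dots> = br (g x) (g y)"
      unfolding g_def using br_sum_sum[of m b x y] bV by simp
    finally show ?thesis .
  qed
  have iso: "algebra_isomorphic vscale (coord_space m) (table_bracket m t) scale V br"
    unfolding algebra_isomorphic_def using bij gadd gscale gbr by blast
  show "algebra_isomorphic scale V br vscale (coord_space m) (table_bracket m t)"
    by (rule algebra_isomorphic_sym[OF iso])
      (use t in \<open>auto intro: cvec.subspace_add cvec.subspace_scale subspace_coord_space table_bracket_in_coord_space\<close>)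
qed

end

section \<open>One-dimensional extensions of the nilpotent algebra\<close>

text \<open>The sum stops at \<open>n\<close>: on the extended algebra the component along
  \<open>E (n + 1)\<close> is ignored, so the bracket can be written without projections.\<close>

definition lin :: "nat \<Rightarrow> (nat \<Rightarrow> vec) \<Rightarrow> vec \<Rightarrow> vec" where
  "lin n R x = (\<Sum>i=1..n. x i *c R i)"

text \<open>The bracket of \<open>L4 n\<close> in closed form. With f the fourth coordinate, an
  alternating form, the second coordinate is l x * l y - f; this is the decomposition into a
  filiform Lie bracket and a symmetric central term.\<close>

definition nu :: "nat \<Rightarrow> vec \<Rightarrow> vec \<Rightarrow> vec" where
  "nu n x y = (\<lambda>k. if k = 2 then x 1 * y 1 + 2 * (x 1 * y 3) + x 3 * y 3
     else if k = 4 then x 3 * y 1 - x 1 * y 3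
     else if 5 \<le> k \<and> k \<le> n then x (k - 1) * y 1 - x 1 * y (k - 1) else 0)"

lemma table_bracket_L4:
  assumes n: "n \<ge> 4"
  shows "table_bracket n (L4 n) x y = nu n x y"
proof
  fix k
  \<comment> \<open>The table is split into the column of e_1 (\<open>A\<close>), the rest of the
    row of e_1 (\<open>B\<close>) and the single entry at (3, 3), so that each double sum collapses
    to a single one.\<close>
  define A where "A i = (if i = 1 then E 2 else if 3 \<le> i \<and> i \<le> n - 1 then E (i + 1) else 0)" for i
  define B where "B j = (if j = 3 then 2 *c E 2 - E 4 else if 4 \<le> j \<and> j \<le> n - 1 then - E (j + 1) else 0)" for j
  have L4: "L4 n i j k = (if j = 1 then A i k else 0) + (if i = 1 then B j k else 0)
      + (if i = 3 then if j = 3 then E 2 k else 0 else 0)" for i j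
    by (auto simp: L4_def A_def B_def)
  have "table_bracket n (L4 n) x y k = (\<Sum>i=1..n. \<Sum>j=1..n. x i * y j * L4 n i j k)"
    by (simp add: table_bracket_def)
  also have "\<dots> = (\<Sum>i=1..n. \<Sum>j=1..n. (if j = 1 then x i * y j * A i k else 0))
      + (\<Sum>i=1..n. \<Sum>j=1..n. (if i = 1 then x i * y j * B j k else 0))
      + (\<Sum>i=1..n. \<Sum>j=1..n. (if i = 3 then if j = 3 then x i * y j * E 2 k else 0 else 0))"
    unfolding sum.distrib[symmetric] L4 by (intro sum.cong refl) (auto simp: algebra_simps)
  also have "(\<Sum>i=1..n. \<Sum>j=1..n. (if j = 1 then x i * y j * A i k else 0)) = (\<Sum>i=1..n. x i * A i k) * y 1"
    using n by (simp add: sum.delta sum_distrib_left sum_distrib_right mult_ac)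
  also have "(\<Sum>i=1..n. \<Sum>j=1..n. (if i = 1 then x i * y j * B j k else 0)) = x 1 * (\<Sum>j=1..n. y j * B j k)"
    by (subst sum.swap) (use n in \<open>simp add: sum.delta sum_distrib_left mult_ac\<close>)
  also have "(\<Sum>i=1..n. \<Sum>j=1..n. (if i = 3 then if j = 3 then x i * y j * E 2 k else 0 else 0)) = x 3 * y 3 * E 2 k"
    by (subst sum.swap) (use n in \<open>simp add: sum.delta\<close>)
  also have "(\<Sum>i=1..n. x i * A i k) = (\<Sum>i=1..n. (if i = 1 then if k = 2 then x i else 0 else 0)
      + (if i = k - 1 then if 4 \<le> k \<and> k \<le> n then x i else 0 else 0))"
    by (intro sum.cong refl) (auto simp: A_def E_apply)
  also have "\<dots> = (if k = 2 then x 1 else 0) + (if 4 \<le> k \<and> k \<le> n then x (k - 1) else 0)"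
    unfolding sum.distrib using n by (auto simp: sum.delta)
  also have "(\<Sum>j=1..n. y j * B j k) = (\<Sum>i=1..n. (if i = 3 then if k = 2 then 2 * y i else 0 else 0)
      - (if i = k - 1 then if 4 \<le> k \<and> k \<le> n then y i else 0 else 0))"
    using n by (intro sum.cong refl) (auto simp: B_def E_apply)
  also have "\<dots> = (if k = 2 then 2 * y 3 else 0) - (if 4 \<le> k \<and> k \<le> n then y (k - 1) else 0)"
    unfolding sum_subtractf using n by (auto simp: sum.delta)
  finally show "table_bracket n (L4 n) x y k = nu n x y k"
    using n by (auto simp: nu_def E_apply algebra_simps)
qed

lemma table_bracket_extend_L4:
  assumes n: "n \<ge> 4"
  shows "table_bracket (n + 1) (extend_L4 n R S s) x y =
    nu n x y + y (n + 1) *c lin n R x + x (n + 1) *c lin n S y + (x (n + 1) * y (n + 1)) *c s"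
proof
  fix k
  let ?t = "extend_L4 n R S s"
  have split: "(\<Sum>i=1..n + 1. f i) = (\<Sum>i=1..n. f i) + f (n + 1)" for f :: "nat \<Rightarrow> complex"
    unfolding Suc_eq_plus1[symmetric] by simp
  have "table_bracket (n + 1) ?t x y k
     = (\<Sum>i=1..n. \<Sum>j=1..n. x i * y j * ?t i j k) + (\<Sum>i=1..n. x i * y (n + 1) * ?t i (n + 1) k)
       + (\<Sum>j=1..n. x (n + 1) * y j * ?t (n + 1) j k) + x (n + 1) * y (n + 1) * ?t (n + 1) (n + 1) k"
    unfolding table_bracket_def sum_fun_apply vscale_apply split sum.distrib by simp
  also have "(\<Sum>i=1..n. \<Sum>j=1..n. x i * y j * ?t i j k) = (\<Sum>i=1..n. \<Sum>j=1..n. x i * y j * L4 n i j k)"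
    by (intro sum.cong refl) (simp add: extend_L4_def)
  also have "\<dots> = nu n x y k"
    unfolding table_bracket_L4[OF n, symmetric] by (simp add: table_bracket_def)
  also have "(\<Sum>i=1..n. x i * y (n + 1) * ?t i (n + 1) k) = y (n + 1) * lin n R x k"
    unfolding lin_def sum_fun_apply sum_distrib_left
    by (intro sum.cong refl) (simp add: extend_L4_def mult_ac)
  also have "(\<Sum>j=1..n. x (n + 1) * y j * ?t (n + 1) j k) = x (n + 1) * lin n S y k"
    unfolding lin_def sum_fun_apply sum_distrib_left
    by (intro sum.cong refl) (simp add: extend_L4_def mult_ac)
  also have "?t (n + 1) (n + 1) k = s k"
    by (simp add: extend_L4_def)
  finally show "table_bracket (n + 1) ?t x y k = (nu n x y + y (n + 1) *c lin n R x
      + x (n + 1) *c lin n S y + (x (n + 1) * y (n + 1)) *c s) k"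
    by simp
qed

lemma nu_add_left: "nu n (x + y) z = nu n x z + nu n y z"
  and nu_add_right: "nu n z (x + y) = nu n z x + nu n z y"
  and nu_scale_left: "nu n (c *c x) z = c *c nu n x z"
  and nu_scale_right: "nu n z (c *c x) = c *c nu n z x"
  by (auto simp: nu_def fun_eq_iff algebra_simps)

lemma lin_add: "lin n R (x + y) = lin n R x + lin n R y"
  by (simp add: lin_def fun_eq_iff algebra_simps sum.distrib)

lemma lin_scale: "lin n R (c *c x) = c *c lin n R x"
  by (simp add: lin_def fun_eq_iff mult.assoc sum_distrib_left)

lemma lin_E: "1 \<le> i \<Longrightarrow> i \<le> n \<Longrightarrow> lin n R (E i) = R i"
proof
  fix k assume i: "1 \<le> i" "i \<le> n"
  have "lin n R (E i) k = (\<Sum>j=1..n. if j = i then R j k else 0)"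
    unfolding lin_def sum_fun_apply by (intro sum.cong refl) (simp add: E_apply)
  then show "lin n R (E i) k = R i k" using i by simp
qed

lemma lin_in_coord_space:
  "(\<And>i. 1 \<le> i \<Longrightarrow> i \<le> n \<Longrightarrow> R i \<in> coord_space n) \<Longrightarrow> lin n R x \<in> coord_space n"
  unfolding lin_def
  by (intro cvec.subspace_sum[OF subspace_coord_space] cvec.subspace_scale[OF subspace_coord_space]) auto

lemma nu_in_coord_space: "n \<ge> 4 \<Longrightarrow> nu n x y \<in> coord_space n"
  by (auto simp: nu_def coord_space_def)

lemma coord_space_mono: "m \<le> n \<Longrightarrow> coord_space m \<subseteq> coord_space n"
  by (auto simp: coord_space_def)

lemma L4_in_coord_space: "n \<ge> 4 \<Longrightarrow> i \<in> {1..n} \<Longrightarrow> j \<in> {1..n} \<Longrightarrow> L4 n i j \<in> coord_space n"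
  by (auto simp: L4_def coord_space_def E_apply)

lemma extend_L4_in_coord_space:
  assumes "n \<ge> 4" "\<And>i. 1 \<le> i \<Longrightarrow> i \<le> n \<Longrightarrow> R i \<in> coord_space n"
    "\<And>i. 1 \<le> i \<Longrightarrow> i \<le> n \<Longrightarrow> S i \<in> coord_space n" "s \<in> coord_space n"
    "i \<in> {1..n+1}" "j \<in> {1..n+1}"
  shows "extend_L4 n R S s i j \<in> coord_space n"
  using assms L4_in_coord_space[of n i j]
  by (cases "i = n + 1"; cases "j = n + 1") (auto simp: extend_L4_def)

lemma nu_leibniz: "n \<ge> 4 \<Longrightarrow> nu n (nu n x y) z = nu n (nu n x z) y + nu n x (nu n y z)"
  by (auto simp: nu_def fun_eq_iff algebra_simps)

text \<open>The hypotheses are the Leibniz identity sorted by the argument positions occupied by the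
  last basis vector: third gives \<open>der\<close>, second (after \<open>der\<close>)
  \<open>nS\<close>, first \<open>Sn\<close>; two positions give \<open>SR\<close>,
  \<open>SS\<close> and \<open>nu n x s = 0\<close>, and three positions give
  \<open>lin n S s = 0\<close>.\<close>

lemma right_leibniz_algebra_extend_L4:
  assumes n: "n \<ge> 4" and R: "\<And>i. 1 \<le> i \<Longrightarrow> i \<le> n \<Longrightarrow> R i \<in> coord_space n"
    and S: "\<And>i. 1 \<le> i \<Longrightarrow> i \<le> n \<Longrightarrow> S i \<in> coord_space n" and s: "s \<in> coord_space n"
    and der: "\<And>x y. lin n R (nu n x y) = nu n (lin n R x) y + nu n x (lin n R y)"
    and nS: "\<And>x y. nu n x (lin n S y) = - nu n x (lin n R y)"
    and Sn: "\<And>x y. lin n S (nu n x y) = nu n (lin n S x) y - nu n (lin n S y) x"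
    and SR: "\<And>x. lin n S (lin n R x) = lin n R (lin n S x)"
    and SS: "\<And>x. lin n S (lin n S x) = - lin n R (lin n S x)"
    and s0: "\<And>x. nu n s x = 0" "\<And>x. nu n x s = 0" "lin n S s = 0"
  shows "right_leibniz_algebra vscale (coord_space (n + 1)) (table_bracket (n + 1) (extend_L4 n R S s))"
proof -
  let ?br = "table_bracket (n + 1) (extend_L4 n R S s)"
  interpret fd_complex_algebra vscale "coord_space (n + 1)" ?br
    using extend_L4_in_coord_space[OF n R S s] coord_space_mono[of n "n + 1"]
    by (intro fd_complex_algebra_table) auto
  have coord0: "v (n + 1) = 0" if "v \<in> coord_space n" for v using that by (auto simp: coord_space_def)
  have T0: "nu n x y (n + 1) = 0" "lin n R x (n + 1) = 0" "lin n S x (n + 1) = 0" "s (n + 1) = 0" for x y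
    using s lin_in_coord_space[OF R] lin_in_coord_space[OF S] nu_in_coord_space[OF n]
    by (auto intro: coord0)
  show ?thesis
  proof
    fix x y z
    \<comment> \<open>Oriented so that right-nested brackets are rewritten away and both sides
      become sums of left-nested ones.\<close>
    have nn: "nu n x (nu n y z) = nu n (nu n x y) z - nu n (nu n x z) y"
      by (simp add: nu_leibniz[OF n, of x y z])
    show "?br (?br x y) z = ?br (?br x z) y + ?br x (?br y z)"
      unfolding table_bracket_extend_L4[OF n]
      by (simp add: nu_add_left nu_add_right nu_scale_left nu_scale_right lin_add lin_scale T0 der nS Sn SR SS s0 nn
          fun_eq_iff) (simp add: algebra_simps)
  qed
qed

section \<open>The model algebras\<close>

text \<open>
  \<open>\<kappa>\<close> can be nonzero only for \<open>n = 4\<close>: for larger \<open>n\<close> the line of \<open>e\<^sub>3\<close> modulo the derived algebra is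
  invariant, since \<open>e\<^sub>3\<close> centralizes the latter. The map \<open>model_Q\<close> is the sum of left and right multiplication by
  \<open>e\<^sub>n\<^sub>+\<^sub>1\<close>; only its values \<open>q\<close>, \<open>r\<close> on the generators are not forced by \<open>a\<close>.
\<close>

definition model_R :: "nat \<Rightarrow> complex \<Rightarrow> complex \<Rightarrow> complex \<Rightarrow> (nat \<Rightarrow> complex) \<Rightarrow> complex \<Rightarrow> complex \<Rightarrow> nat \<Rightarrow> vec" where
  "model_R n a \<mu> \<kappa> c \<beta> \<eta> i =
    (if i = 1 then \<mu> *c E 1 + (a - \<mu>) *c E 3 + \<beta> *c E 2
     else if i = 2 then (2 * a) *c E 2
     else if i = 3 then \<kappa> *c E 1 + (a - \<kappa>) *c E 3 + \<eta> *c E 2 + (\<Sum>k=5..n. c (k - 3) *c E k)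
     else (if i = 4 then (a + \<kappa> - \<mu>) *c E 2 else 0) + (a - \<kappa> + (of_nat i - 3) * \<mu>) *c E i
       + (\<Sum>k=i+2..n. c (k - i) *c E k))"

definition model_Q :: "complex \<Rightarrow> complex \<Rightarrow> complex \<Rightarrow> nat \<Rightarrow> vec" where
  "model_Q a q r i = (if i = 1 then q *c E 2 else if i = 3 then r *c E 2
     else if i = 2 \<or> i = 4 then (2 * a) *c E 2 else 0)"

definition model :: "nat \<Rightarrow> complex \<Rightarrow> complex \<Rightarrow> complex \<Rightarrow> (nat \<Rightarrow> complex) \<Rightarrow> complex \<Rightarrow> complex \<Rightarrow>
    complex \<Rightarrow> complex \<Rightarrow> complex \<Rightarrow> complex \<Rightarrow> table" where
  "model n a \<mu> \<kappa> c \<beta> \<eta> q r s1 s2 = extend_L4 n (model_R n a \<mu> \<kappa> c \<beta> \<eta>)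
     (\<lambda>i. model_Q a q r i - model_R n a \<mu> \<kappa> c \<beta> \<eta> i) (s1 *c E 2 + s2 *c E n)"

text \<open>The two linear equations say that \<open>model_Q\<close> after \<open>model_R\<close>
  equals 2 a times \<open>model_Q\<close> on e_1 and e_3. The last one says that left multiplication
  by the last basis vector kills s2 e_n, the factor being the diagonal entry of
  \<open>model_R\<close> at e_n.\<close>

definition model_admissible :: "nat \<Rightarrow> complex \<Rightarrow> complex \<Rightarrow> complex \<Rightarrow> complex \<Rightarrow> complex \<Rightarrow>
    complex \<Rightarrow> complex \<Rightarrow> complex \<Rightarrow> bool" where
  "model_admissible n a \<mu> \<kappa> \<beta> \<eta> q r s2 \<longleftrightarrow> (\<kappa> = 0 \<or> n = 4)
     \<and> \<mu> * q + (a - \<mu>) * r + 2 * a * \<beta> = 2 * a * q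
     \<and> \<kappa> * q + (a - \<kappa>) * r + 2 * a * \<eta> = 2 * a * r
     \<and> s2 * (a - \<kappa> + (of_nat n - 3) * \<mu>) = 0"

text \<open>The strictly triangular part of the model derivation: a polynomial in right
  multiplication by e_1 whose terms have degree at least 2. There is no linear term, so the range is
  empty at \<open>k = 4\<close>.\<close>

definition conv :: "(nat \<Rightarrow> complex) \<Rightarrow> vec \<Rightarrow> nat \<Rightarrow> complex" where
  "conv c x k = (\<Sum>i=3..k - 2. c (k - i) * x i)"

lemma model_R_apply:
  assumes "n \<ge> 4"
  shows "model_R n a \<mu> \<kappa> c \<beta> \<eta> i k =
    (if i = 1 then (if k = 1 then \<mu> else 0) + (if k = 3 then a - \<mu> else 0) + (if k = 2 then \<beta> else 0)
     else if i = 2 then (if k = 2 then 2 * a else 0)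
     else if i = 3 then (if k = 1 then \<kappa> else 0) + (if k = 3 then a - \<kappa> else 0) + (if k = 2 then \<eta> else 0)
       + (if 5 \<le> k \<and> k \<le> n then c (k - 3) else 0)
     else (if i = 4 \<and> k = 2 then a + \<kappa> - \<mu> else 0) + (if k = i then a - \<kappa> + (of_nat i - 3) * \<mu> else 0)
       + (if i + 2 \<le> k \<and> k \<le> n then c (k - i) else 0))"
proof -
  have "(\<Sum>k'=m..n. f k' *c E k') k = (if m \<le> k \<and> k \<le> n then f k else 0)" for f m k
  proof -
    have "(\<Sum>k'=m..n. f k' *c E k') k = (\<Sum>k'=m..n. if k' = k then f k' else 0)"
      unfolding sum_fun_apply by (intro sum.cong refl) (simp add: E_apply)
    then show ?thesis by simp
  qed
  note * = this
  show ?thesis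
    unfolding model_R_def by (auto simp: E_apply simp del: sum_fun_apply simp add: *)
qed

lemma model_R_in_coord_space: "n \<ge> 4 \<Longrightarrow> 1 \<le> i \<Longrightarrow> i \<le> n \<Longrightarrow> model_R n a \<mu> \<kappa> c \<beta> \<eta> i \<in> coord_space n"
  by (auto simp: coord_space_def model_R_apply)

lemma model_Q_in_coord_space: "n \<ge> 4 \<Longrightarrow> model_Q a q r i \<in> coord_space n"
  by (auto simp: coord_space_def model_Q_def E_apply)

lemma lin_diff: "lin n (\<lambda>i. Q i - R i) x = lin n Q x - lin n R x"
  by (simp add: lin_def fun_eq_iff algebra_simps sum_subtractf)

lemma lin_model_Q:
  assumes n: "n \<ge> 4"
  shows "lin n (model_Q a q r) x = (q * x 1 + 2 * a * x 2 + r * x 3 + 2 * a * x 4) *c E 2"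
proof
  fix k
  have "lin n (model_Q a q r) x k = (\<Sum>i=1..n. (if i = 1 then x i * (q * E 2 k) else 0)
    + (if i = 2 then x i * (2 * a * E 2 k) else 0) + (if i = 3 then x i * (r * E 2 k) else 0)
    + (if i = 4 then x i * (2 * a * E 2 k) else 0))"
    unfolding lin_def sum_fun_apply by (intro sum.cong refl) (simp add: model_Q_def)
  then show "lin n (model_Q a q r) x k = ((q * x 1 + 2 * a * x 2 + r * x 3 + 2 * a * x 4) *c E 2) k"
    using n by (simp add: sum.distrib algebra_simps)
qed

lemma lin_model_R:
  assumes n: "n \<ge> 4"
  shows "lin n (model_R n a \<mu> \<kappa> c \<beta> \<eta>) x k =
    (if k = 1 then \<mu> * x 1 + \<kappa> * x 3
     else if k = 2 then \<beta> * x 1 + 2 * a * x 2 + \<eta> * x 3 + (a + \<kappa> - \<mu>) * x 4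
     else if k = 3 then (a - \<mu>) * x 1 + (a - \<kappa>) * x 3
     else if 4 \<le> k \<and> k \<le> n then (a - \<kappa> + (of_nat k - 3) * \<mu>) * x k + conv c x k
     else 0)"
proof -
  let ?f = "\<lambda>i. x i * model_R n a \<mu> \<kappa> c \<beta> \<eta> i k"
  have lin: "lin n (model_R n a \<mu> \<kappa> c \<beta> \<eta>) x k = (\<Sum>i=1..n. ?f i)"
    by (simp add: lin_def)
  show ?thesis
  proof (cases "4 \<le> k \<and> k \<le> n")
    case True
    have "(\<Sum>i=1..n. ?f i) = (\<Sum>i=1..n. (if i = k then (a - \<kappa> + (of_nat k - 3) * \<mu>) * x k else 0)
        + (if i \<in> {3..k - 2} then c (k - i) * x i else 0))"
      using True by (intro sum.cong refl) (auto simp: model_R_apply[OF n])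
    also have "\<dots> = (a - \<kappa> + (of_nat k - 3) * \<mu>) * x k + (\<Sum>i\<in>{1..n} \<inter> {3..k-2}. c (k - i) * x i)"
      unfolding sum.distrib using True by (simp add: sum.inter_restrict del: Int_atLeastAtMost)
    also have "{1..n} \<inter> {3..k-2} = {3..k-2}" using True by auto
    finally show ?thesis using True by (simp add: lin conv_def)
  next
    case False
    have "(\<Sum>i=1..n. ?f i) = (\<Sum>i\<in>{1,2,3,4}. ?f i)"
      using n False by (intro sum.mono_neutral_right) (auto simp: model_R_apply[OF n])
    also have "\<dots> = ?f 1 + ?f 2 + ?f 3 + ?f 4" by simp
    finally show ?thesis using n False by (auto simp: lin model_R_apply[OF n] mult.commute)
  qed
qed

text \<open>A polynomial in right multiplication by e_1 commutes with that multiplication, which is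
  a shift of indices. Coordinate 3 of a bracket is zero, so the sum starts at 4 and shifts back to
  3.\<close>

lemma conv_nu:
  assumes "5 \<le> k" "k \<le> n"
  shows "conv c (nu n x y) k = conv c x (k - 1) * y 1 - x 1 * conv c y (k - 1)"
proof -
  have k: "k - 2 = Suc (k - 3)" using assms by simp
  have "conv c (nu n x y) k = (\<Sum>i=3..k - 2. c (k - i) * nu n x y i)"
    by (simp add: conv_def)
  also have "\<dots> = (\<Sum>i=Suc 3..k - 2. c (k - i) * nu n x y i)"
    using assms by (subst sum.atLeast_Suc_atMost) (auto simp: nu_def)
  also have "\<dots> = (\<Sum>i=3..k - 3. c (k - Suc i) * nu n x y (Suc i))"
    unfolding k by (rule sum.shift_bounds_cl_Suc_ivl)
  also have "\<dots> = (\<Sum>i=3..k - 3. c (k - 1 - i) * (x i * y 1 - x 1 * y i))"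
  proof (intro sum.cong refl)
    fix i assume i: "i \<in> {3..k - 3}"
    show "c (k - Suc i) * nu n x y (Suc i) = c (k - 1 - i) * (x i * y 1 - x 1 * y i)"
    proof (cases "i = 3")
      case True
      then have "Suc i = 4" by simp
      then show ?thesis by (simp add: nu_def True)
    next
      case False
      have "k - Suc i = k - 1 - i" by simp
      then show ?thesis using i assms False by (auto simp: nu_def)
    qed
  qed
  also have "\<dots> = conv c x (k - 1) * y 1 - x 1 * conv c y (k - 1)"
  proof -
    have "k - 1 - 2 = k - 3" by simp
    then show ?thesis
      unfolding conv_def sum_distrib_left sum_distrib_right sum_subtractf[symmetric]
      by (intro sum.cong) (simp_all add: right_diff_distrib mult_ac)
  qed
  finally show ?thesis .
qed

text \<open>The alternating form in coordinate 4 is multiplied by the trace a - \<kappa> + \<mu> of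
  the action on e_1, e_3, and the symmetric term by 2 a because \<open>l\<close> is multiplied by
  \<open>a\<close>. Their difference a + \<kappa> - \<mu> is the entry of \<open>model_R\<close>
  from e_4 to e_2. From index 5 on, commutation with the shift does the rest.\<close>

lemma model_derivation:
  fixes a \<mu> \<kappa> \<beta> \<eta> c
  assumes n: "n \<ge> 4" and \<kappa>: "\<kappa> = 0 \<or> n = 4"
  defines "D \<equiv> lin n (model_R n a \<mu> \<kappa> c \<beta> \<eta>)"
  shows "D (nu n x y) = nu n (D x) y + nu n x (D y)"
proof
  fix k
  have nu3: "nu n x y 1 = 0" "nu n x y 3 = 0" by (auto simp: nu_def)
  have conv4: "conv c z 4 = 0" for z by (simp add: conv_def)
  consider "k = 1 \<or> k = 3 \<or> k = 0 \<or> k > n" | "k = 2" | "k = 4" | "5 \<le> k \<and> k \<le> n" using n by linarith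
  then show "D (nu n x y) k = (nu n (D x) y + nu n x (D y)) k"
  proof cases
    case 1
    then have "nu n u v k = 0" for u v using n by (auto simp: nu_def)
    moreover have "D (nu n x y) k = 0"
      using 1 n nu3 unfolding D_def lin_model_R[OF n] by (elim disjE) simp_all
    ultimately show ?thesis by simp
  next
    case 2
    then show ?thesis using n by (simp add: D_def lin_model_R nu_def) (simp add: algebra_simps)
  next
    case 3
    then show ?thesis using n by (simp add: D_def lin_model_R nu_def conv4) (simp add: algebra_simps)
  next
    case 4
    then have "\<kappa> = 0" using \<kappa> by auto
    have D: "D z k = (a + (of_nat k - 3) * \<mu>) * z k + conv c z k" "D z 1 = \<mu> * z 1"
      "D z (k - 1) = (a + (of_nat k - 4) * \<mu>) * z (k - 1) + conv c z (k - 1)" for z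
      using 4 n by (auto simp: D_def lin_model_R \<open>\<kappa> = 0\<close>)
    have nuk: "nu n u v k = u (k - 1) * v 1 - u 1 * v (k - 1)" for u v
      using 4 by (simp add: nu_def)
    show ?thesis
      using 4 by (simp add: D conv_nu nuk) (simp add: algebra_simps)
  qed
qed

lemma nu_E2: "nu n x (t *c E 2) = 0" "nu n (t *c E 2) x = 0"
  by (auto simp: nu_def E_apply fun_eq_iff)

lemma nu_En: "n \<ge> 4 \<Longrightarrow> nu n x (t *c E n) = 0" "n \<ge> 4 \<Longrightarrow> nu n (t *c E n) x = 0"
  by (auto simp: nu_def E_apply fun_eq_iff)

lemma nu_minus_left: "nu n (x - y) z = nu n x z - nu n y z"
  and nu_minus_right: "nu n z (x - y) = nu n z x - nu n z y"
  by (auto simp: nu_def fun_eq_iff algebra_simps)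

lemma lin_minus: "lin n R (x - y) = lin n R x - lin n R y"
  by (simp add: lin_def fun_eq_iff algebra_simps sum_subtractf)

text \<open>With the left action written as ?Q - ?D, everything reduces to ?Q ?D = ?D ?Q = ?Q ?Q = 2
  a ?Q and to \<open>Qnu\<close>. The values of ?Q are multiples of e_2, on which both maps are
  multiplication by 2 a; \<open>Qnu\<close> holds because symmetrizing the bracket leaves twice the
  product of the values of \<open>l\<close>.\<close>

lemma model_right_leibniz:
  assumes n: "n \<ge> 4" and adm: "model_admissible n a \<mu> \<kappa> \<beta> \<eta> q r s2"
  shows "right_leibniz_algebra vscale (coord_space (n + 1))
    (table_bracket (n + 1) (model n a \<mu> \<kappa> c \<beta> \<eta> q r s1 s2))"
proof -
  let ?R = "model_R n a \<mu> \<kappa> c \<beta> \<eta>"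
  let ?D = "lin n ?R" let ?Q = "lin n (model_Q a q r)"
  let ?s = "s1 *c E 2 + s2 *c E n"
  have \<kappa>: "\<kappa> = 0 \<or> n = 4" using adm by (simp add: model_admissible_def)
  have c1: "q * \<mu> + (a - \<mu>) * r + 2 * a * \<beta> = 2 * a * q"
   and c2: "q * \<kappa> + (a - \<kappa>) * r + 2 * a * \<eta> = 2 * a * r"
   and c3: "s2 * (a - \<kappa> + (of_nat n - 3) * \<mu>) = 0"
    using adm by (auto simp: model_admissible_def mult.commute)
  have conv4: "conv c z 4 = 0" for z by (simp add: conv_def)
  have QD: "?Q (?D x) = (2 * a) *c ?Q x" for x
  proof -
    have "q * ?D x 1 + 2 * a * ?D x 2 + r * ?D x 3 + 2 * a * ?D x 4
      = (q * \<mu> + (a - \<mu>) * r + 2 * a * \<beta>) * x 1 + (2 * a) * (2 * a) * x 2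
        + (q * \<kappa> + (a - \<kappa>) * r + 2 * a * \<eta>) * x 3 + (2 * a) * (2 * a) * x 4"
      using n by (simp add: lin_model_R conv4) (simp add: algebra_simps)
    also have "\<dots> = 2 * a * (q * x 1 + 2 * a * x 2 + r * x 3 + 2 * a * x 4)"
      unfolding c1 c2 by (simp add: algebra_simps)
    finally show ?thesis by (simp add: lin_model_Q[OF n] fun_eq_iff mult_ac)
  qed
  have DE2: "?D (t *c E 2) = (2 * a * t) *c E 2" for t
    using n by (auto simp: fun_eq_iff lin_model_R E_apply conv_def)
  have QE2: "?Q (t *c E 2) = (2 * a * t) *c E 2" for t
    using n by (auto simp: fun_eq_iff lin_model_Q E_apply)
  have DQ: "?D (?Q x) = (2 * a) *c ?Q x" and QQ: "?Q (?Q x) = (2 * a) *c ?Q x" for x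
    by (auto simp: lin_model_Q[OF n, of _ _ _ x] DE2 QE2 fun_eq_iff)
  have nuQ: "nu n x (?Q y) = 0" "nu n (?Q y) x = 0" for x y
    by (auto simp: lin_model_Q[OF n] nu_E2)
  have Qnu: "?Q (nu n x y) = nu n x (?D y) + nu n (?D y) x" for x y
  proof
    fix k show "?Q (nu n x y) k = (nu n x (?D y) + nu n (?D y) x) k"
    using n by (auto simp add: lin_model_Q E_apply nu_def lin_model_R) (simp add: algebra_simps)
  qed
  have s0: "nu n ?s x = 0" "nu n x ?s = 0" for x
    using n by (simp_all add: nu_add_left nu_add_right nu_E2 nu_En)
  have QDs: "?Q ?s - ?D ?s = 0"
  proof
    fix k
    have "conv c (E n) k = 0" if "k \<le> n"
      unfolding conv_def using that n by (intro sum.neutral) (auto simp: E_apply)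
    moreover have "s2 = 0 \<or> a - \<kappa> + (of_nat n - 3) * \<mu> = 0" using c3 by simp
    \<comment> \<open>For \<open>n = 4\<close> the vector e_n is e_4, whose image has the component
      a + \<kappa> - \<mu> along e_2; this equals 2 a once the diagonal entry a - \<kappa> + \<mu>
      vanishes.\<close>
    ultimately have "?D (s2 *c E n) k = (if n = 4 \<and> k = 2 then s2 * (2 * a) else 0)"
      using n by (auto simp: lin_scale lin_model_R E_apply) (simp add: algebra_simps)
    moreover have "?Q (s2 *c E n) k = (if n = 4 \<and> k = 2 then s2 * (2 * a) else 0)"
      using n by (auto simp: lin_model_Q E_apply)
    ultimately show "(?Q ?s - ?D ?s) k = 0 k"
      by (simp add: lin_add DE2 QE2)
  qed
  have der: "?D (nu n x y) = nu n (?D x) y + nu n x (?D y)" for x y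
    by (rule model_derivation[OF n \<kappa>])
  show ?thesis
    unfolding model_def
  proof (rule right_leibniz_algebra_extend_L4[OF n])
    show "model_R n a \<mu> \<kappa> c \<beta> \<eta> i \<in> coord_space n" if "1 \<le> i" "i \<le> n" for i
      by (rule model_R_in_coord_space[OF n that])
    show "model_Q a q r i - model_R n a \<mu> \<kappa> c \<beta> \<eta> i \<in> coord_space n" if "1 \<le> i" "i \<le> n" for i
      by (intro cvec.subspace_diff[OF subspace_coord_space] model_R_in_coord_space[OF n that] model_Q_in_coord_space n)
    show "?s \<in> coord_space n"
      using n by (auto simp: coord_space_def E_apply)
  qed (simp_all add: lin_diff der nu_minus_left nu_minus_right nuQ Qnu s0 QDs lin_minus QD DQ QQ)
qed

section \<open>Nilradical and indecomposability\<close>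

locale L4_extension =
  fixes n :: nat and R S :: "nat \<Rightarrow> vec" and s :: vec
  assumes n4: "n \<ge> 4"
    and R_in: "\<And>i. 1 \<le> i \<Longrightarrow> i \<le> n \<Longrightarrow> R i \<in> coord_space n"
    and S_in: "\<And>i. 1 \<le> i \<Longrightarrow> i \<le> n \<Longrightarrow> S i \<in> coord_space n"
    and s_in: "s \<in> coord_space n"
    and leibniz_ext: "right_leibniz_algebra vscale (coord_space (n + 1)) (table_bracket (n + 1) (extend_L4 n R S s))"
begin

abbreviation "br \<equiv> table_bracket (n + 1) (extend_L4 n R S s)"
abbreviation "K \<equiv> coord_space (n + 1)"
abbreviation "N \<equiv> coord_space n"
abbreviation "D \<equiv> lin n R"
abbreviation "L \<equiv> lin n S"

sublocale alg: right_leibniz_algebra vscale K br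
  by (rule leibniz_ext)

lemmas br_eq = table_bracket_extend_L4[OF n4, of R S s]

lemma D_in: "D x \<in> N" and L_in: "L x \<in> N"
  using lin_in_coord_space R_in S_in by blast+

lemma N_sub_K: "N \<subseteq> K"
  by (rule coord_space_mono) simp

lemma N_last: "x \<in> N \<Longrightarrow> x (n + 1) = 0"
  by (simp add: coord_space_def)

lemma br_in_N: "br x y \<in> N"
  unfolding br_eq
  by (intro cvec.subspace_add[OF subspace_coord_space] cvec.subspace_scale[OF subspace_coord_space]
      nu_in_coord_space n4 D_in L_in s_in)

lemma br_N: "x \<in> N \<Longrightarrow> y \<in> N \<Longrightarrow> br x y = nu n x y"
  by (simp add: br_eq N_last)

lemma N_eq: "x \<in> N \<longleftrightarrow> x \<in> K \<and> x (n + 1) = 0"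
proof -
  have "i \<notin> {1..n} \<longleftrightarrow> i \<notin> {1..n + 1} \<or> i = n + 1" for i by auto
  then show ?thesis unfolding coord_space_def by blast
qed

lemma ideal_N: "alg.two_sided_ideal N"
  unfolding alg.two_sided_ideal_def using br_in_N N_sub_K subspace_coord_space by blast

lemma nilpotent_N: "alg.nilpotent N"
\<comment> \<open>One product removes e_1 and e_3. The next one removes e_2 and e_4 together, hence
  the bound \<open>k + 3\<close> from \<open>k = 2\<close> on.\<close>
proof (rule alg.nilpotent_if_filtration[where m = n and
      F = "\<lambda>k. {x \<in> N. (k \<ge> 1 \<longrightarrow> x 1 = 0 \<and> x 3 = 0) \<and> (k \<ge> 2 \<longrightarrow> (\<forall>i<k+3. x i = 0))}"])
  show "cvec.subspace N" by (rule subspace_coord_space)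
  show "{x \<in> N. (n \<ge> 1 \<longrightarrow> x 1 = 0 \<and> x 3 = 0) \<and> (n \<ge> 2 \<longrightarrow> (\<forall>i<n+3. x i = 0))} = {0}"
  proof -
    have "x = 0" if x: "x \<in> N" "\<forall>i<n+3. x i = 0" for x
    proof
      fix i show "x i = 0 i" using x by (cases "i < n + 3") (auto simp: coord_space_def)
    qed
    then show ?thesis using n4 cvec.subspace_0[OF subspace_coord_space] by auto
  qed
next
  fix k show "cvec.subspace {x \<in> N. (k \<ge> 1 \<longrightarrow> x 1 = 0 \<and> x 3 = 0) \<and> (k \<ge> 2 \<longrightarrow> (\<forall>i<k+3. x i = 0))}"
    by (auto simp: cvec.subspace_def coord_space_def)
next
  fix k x y
  assume x: "x \<in> {x \<in> N. (k \<ge> 1 \<longrightarrow> x 1 = 0 \<and> x 3 = 0) \<and> (k \<ge> 2 \<longrightarrow> (\<forall>i<k+3. x i = 0))}" and y: "y \<in> N"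
  have *: "br x y = nu n x y" using x y by (simp add: br_N)
  have "nu n x y i = 0" if k: "k \<ge> 1" "i < Suc k + 3" for i
  proof -
    have x13: "x 1 = 0" "x 3 = 0" using x k by auto
    have "x (i - 1) = 0" if "5 \<le> i"
    proof -
      have "k \<ge> 2" "i - 1 < k + 3" using that k by auto
      then show ?thesis using x by blast
    qed
    then show ?thesis using x13 by (auto simp: nu_def)
  qed
  moreover have "nu n x y 1 = 0" "nu n x y 3 = 0" by (auto simp: nu_def)
  ultimately show "br x y \<in> {x \<in> N. (Suc k \<ge> 1 \<longrightarrow> x 1 = 0 \<and> x 3 = 0) \<and> (Suc k \<ge> 2 \<longrightarrow> (\<forall>i<Suc k+3. x i = 0))}"
    using nu_in_coord_space[OF n4] by (auto simp: *)
qed auto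

lemma solvable_K: "alg.solvable K"
\<comment> \<open>The chain is \<open>K\<close>, \<open>N\<close>, the derived algebra of
  \<open>N\<close>, zero; the derived algebra of \<open>N\<close> is abelian.\<close>
proof (rule alg.solvable_if_filtration[where m = 3 and
      F = "\<lambda>k. {x \<in> K. (k \<ge> 1 \<longrightarrow> x \<in> N) \<and> (k \<ge> 2 \<longrightarrow> x 1 = 0 \<and> x 3 = 0) \<and> (k \<ge> 3 \<longrightarrow> x = 0)}"])
  show "cvec.subspace K" by (rule subspace_coord_space)
  show "{x \<in> K. (3 \<ge> 1 \<longrightarrow> x \<in> N) \<and> (3 \<ge> 2 \<longrightarrow> x 1 = 0 \<and> x 3 = 0) \<and> (3 \<ge> (3::nat) \<longrightarrow> x = 0)} = {0}"
    by (auto simp: coord_space_def)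
next
  fix k show "cvec.subspace {x \<in> K. (k \<ge> 1 \<longrightarrow> x \<in> N) \<and> (k \<ge> 2 \<longrightarrow> x 1 = 0 \<and> x 3 = 0) \<and> (k \<ge> 3 \<longrightarrow> x = 0)}"
    by (auto simp: cvec.subspace_def coord_space_def)
next
  fix k :: nat and x y
  assume x: "x \<in> {x \<in> K. (k \<ge> 1 \<longrightarrow> x \<in> N) \<and> (k \<ge> 2 \<longrightarrow> x 1 = 0 \<and> x 3 = 0) \<and> (k \<ge> 3 \<longrightarrow> x = 0)}"
    and y: "y \<in> {x \<in> K. (k \<ge> 1 \<longrightarrow> x \<in> N) \<and> (k \<ge> 2 \<longrightarrow> x 1 = 0 \<and> x 3 = 0) \<and> (k \<ge> 3 \<longrightarrow> x = 0)}"
  have "br x y 1 = 0 \<and> br x y 3 = 0" if "k \<ge> 1"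
    using that x y by (simp add: br_N nu_def)
  moreover have "br x y = 0" if "k \<ge> 2"
    using that x y by (simp add: br_N nu_def fun_eq_iff)
  ultimately show "br x y \<in> {x \<in> K. (Suc k \<ge> 1 \<longrightarrow> x \<in> N) \<and> (Suc k \<ge> 2 \<longrightarrow> x 1 = 0 \<and> x 3 = 0) \<and> (Suc k \<ge> 3 \<longrightarrow> x = 0)}"
    using br_in_N[of x y] N_sub_K by (simp add: subset_iff)
qed auto

lemma E_in_N: "1 \<le> i \<Longrightarrow> i \<le> n \<Longrightarrow> E i \<in> N"
  and E_in_K: "1 \<le> i \<Longrightarrow> i \<le> n + 1 \<Longrightarrow> E i \<in> K"
  by (auto intro: E_in_coord_space)

lemma nu_E_E: "nu n (E 1) (E 1) = E 2" "nu n (E 3) (E 1) = E 4"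
  "4 \<le> k \<Longrightarrow> k < n \<Longrightarrow> nu n (E k) (E 1) = E (k + 1)"
  using n4 by (auto simp: nu_def E_apply fun_eq_iff)

lemma ideal_closed:
  assumes "alg.two_sided_ideal I"
  shows "x \<in> I \<Longrightarrow> y \<in> I \<Longrightarrow> x + y \<in> I" "x \<in> I \<Longrightarrow> c *c x \<in> I" "0 \<in> I"
    "x \<in> I \<Longrightarrow> x \<in> K" "x \<in> I \<Longrightarrow> y \<in> K \<Longrightarrow> br x y \<in> I" "x \<in> I \<Longrightarrow> y \<in> K \<Longrightarrow> br y x \<in> I"
  using assms unfolding alg.two_sided_ideal_def cvec.subspace_def by blast+

lemma br_ideals_zero:
  assumes "alg.two_sided_ideal I" "alg.two_sided_ideal J" "I \<inter> J = {0}" "x \<in> I" "y \<in> J"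
  shows "br x y = 0"
proof -
  have "br x y \<in> I" "br x y \<in> J"
    using assms ideal_closed(4)[OF assms(1)] ideal_closed(4)[OF assms(2)]
      ideal_closed(5)[OF assms(1)] ideal_closed(6)[OF assms(2)] by simp_all
  then show ?thesis using assms(3) by blast
qed

end

text \<open>\<open>D1\<close> and \<open>D3\<close> give the matrix of \<open>D\<close> on
  \<open>N\<close> modulo its derived algebra. Its eigenvalues are \<open>a\<close> (through
  \<open>l\<close>) and \<mu> - \<kappa> (on e_3 - e_1), so \<open>nondeg\<close> says that this
  matrix is not nilpotent.\<close>

locale L4_extension_nondegenerate = L4_extension +
  fixes a \<mu> \<kappa> :: complex
  assumes D1: "\<And>x. D x 1 = \<mu> * x 1 + \<kappa> * x 3" and D3: "\<And>x. D x 3 = (a - \<mu>) * x 1 + (a - \<kappa>) * x 3"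
    and L1: "\<And>x. L x 1 = - D x 1" and L3: "\<And>x. L x 3 = - D x 3"
    and s13: "s 1 = 0" "s 3 = 0"
    and nondeg: "a \<noteq> 0 \<or> \<mu> \<noteq> \<kappa>"
begin

lemma br1: "br x y 1 = y (n + 1) * D x 1 - x (n + 1) * D y 1"
  and br3: "br x y 3 = y (n + 1) * D x 3 - x (n + 1) * D y 3"
  unfolding br_eq by (simp_all add: L1 L3 s13 nu_def)

text \<open>An element \<open>y\<close> of \<open>M\<close> outside \<open>N\<close> acts on the
  quotient of \<open>N\<close> by a nonzero multiple of the matrix of \<open>D\<close>. Iterating
  from e_1 and reading off \<open>l\<close>, or from e_3 - e_1 when \<open>a = 0\<close>, produces
  powers of a nonzero eigenvalue, although the iterates lie in the lower central series of
  \<open>M\<close>.\<close>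

lemma nilpotent_ideal_le_N:
  assumes M: "alg.two_sided_ideal M" "alg.nilpotent M"
  shows "M \<subseteq> N"
proof
  fix y assume y: "y \<in> M"
  show "y \<in> N"
  proof (rule ccontr)
    assume "y \<notin> N"
    then have yT: "y (n + 1) \<noteq> 0" using N_eq ideal_closed(4)[OF M(1) y] by blast
    define f where "f p k = ((\<lambda>v. br v y) ^^ k) p" for p k
    have fN: "f p k \<in> N" if "p \<in> N" for p k
      using that br_in_N by (cases k) (auto simp: f_def)
    \<comment> \<open>The index is shifted by one: the starting vector is only in \<open>N\<close>,
      and the first bracket with \<open>y\<close> brings it into the ideal \<open>M\<close>.\<close>
    have in_lc: "f p (Suc k) \<in> alg.lower_central M k" if "p \<in> N" for p k
    proof (induction k)
      case 0
      have "f p (Suc 0) = br p y" by (simp add: f_def)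
      then show ?case using that ideal_closed(6)[OF M(1) y] N_sub_K unfolding alg.lower_central.simps by auto
    next
      case (Suc k)
      have "f p (Suc (Suc k)) = br (f p (Suc k)) y" by (simp add: f_def)
      then show ?case
        using alg.br_in_product[OF Suc y] unfolding alg.lower_central.simps by metis
    qed
    obtain m where m: "alg.lower_central M m = {0}" using M(2) unfolding alg.nilpotent_def by blast
    have f0: "f p (Suc m) = 0" if "p \<in> N" for p using in_lc[OF that, of m] m by simp
    have step: "f p (Suc k) 1 = y (n + 1) * D (f p k) 1" "f p (Suc k) 3 = y (n + 1) * D (f p k) 3"
      if "p \<in> N" for p k
      using N_last[OF fN[OF that]] by (simp_all add: f_def br1 br3)
    show False
    proof (cases "a = 0")
      case False
      have E1: "E 1 \<in> N" using n4 by (intro E_in_N) auto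
      have "f (E 1) k 1 + f (E 1) k 3 = (y (n + 1) * a) ^ k" for k
      proof (induction k)
        case (Suc k)
        have "f (E 1) (Suc k) 1 + f (E 1) (Suc k) 3 = y (n + 1) * a * (f (E 1) k 1 + f (E 1) k 3)"
          by (simp add: step[OF E1] D1 D3 algebra_simps)
        then show ?case by (simp add: Suc)
      qed (simp add: f_def E_apply)
      from this[of "Suc m"] show False using f0[OF E1] False yT by simp
    next
      case True
      define v where "v = E 3 - E 1"
      have v: "v \<in> N"
        unfolding v_def using n4 by (intro cvec.subspace_diff[OF subspace_coord_space] E_in_N) auto
      have "f v k 1 = - ((y (n + 1) * (\<mu> - \<kappa>)) ^ k) \<and> f v k 3 = (y (n + 1) * (\<mu> - \<kappa>)) ^ k" for k
      proof (induction k)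
        case (Suc k)
        then show ?case
          by (simp add: step[OF v] D1 D3 True) (simp add: algebra_simps)
      qed (simp add: f_def v_def E_apply)
      from this[of "Suc m"] show False using f0[OF v] nondeg True yT by simp
    qed
  qed
qed

lemma is_nilradical_N: "alg.is_nilradical N"
  unfolding alg.is_nilradical_def alg.maximal_nilpotent_ideal_def
  using nilpotent_ideal_le_N ideal_N nilpotent_N by blast

text \<open>If the \<open>I\<close>-components of e_1 and e_3 lie in the derived algebra of
  \<open>N\<close>, they do not contribute to products, so e_2 and e_4, and then all later e_k, are
  products inside \<open>J\<close>. Hence these components lie in \<open>I\<close> and
  \<open>J\<close> at once and vanish, and \<open>J\<close> absorbs e_1, e_3 and finally the last
  basis vector.\<close>

lemma ideal_eq_zero_if_projection_nilpotent:
  assumes I: "alg.two_sided_ideal I" and J: "alg.two_sided_ideal J" and IJ: "I \<inter> J = {0}"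
    and p: "p1 \<in> I" "q1 \<in> J" "E 1 = p1 + q1" "p3 \<in> I" "q3 \<in> J" "E 3 = p3 + q3"
      "pT \<in> I" "qT \<in> J" "E (n + 1) = pT + qT"
    and pN: "p1 \<in> N" "p3 \<in> N" and p0: "p1 1 = 0" "p1 3 = 0" "p3 1 = 0" "p3 3 = 0"
  shows "I = {0}"
proof -
  note cI = ideal_closed[OF I] and cJ = ideal_closed[OF J]
  have EN: "E 1 \<in> N" "E 3 \<in> N" and EK: "E 1 \<in> K" "E 3 \<in> K"
    using n4 by (auto intro!: E_in_N E_in_K)
  have br_split: "br (x + y) (x' + y') = br x x' + br y y'"
    if "x \<in> I" "y \<in> J" "x' \<in> I" "y' \<in> J" for x y x' y'
  proof -
    have K: "x \<in> K" "y \<in> K" "x' \<in> K" "y' \<in> K" using that cI(4) cJ(4) by blast+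
    have "J \<inter> I = {0}" using IJ by blast
    then have "br x y' = 0" "br y x' = 0"
      using that br_ideals_zero[OF I J IJ] br_ideals_zero[OF J I] by blast+
    then show ?thesis by (simp add: alg.br_add_left alg.br_add_right alg.add_in_V K)
  qed
  have pp: "br p1 p1 = 0" "br p3 p1 = 0"
    using pN p0 by (auto simp: br_N nu_def fun_eq_iff)
  have "E 2 = br (E 1) (E 1)" using EN by (simp add: br_N nu_E_E)
  also have "\<dots> = br q1 q1" unfolding p(3) using br_split[OF p(1,2,1,2)] pp by simp
  finally have E2: "E 2 \<in> J" using cJ(5)[OF p(2) cJ(4)[OF p(2)]] by simp
  have "E 4 = br (E 3) (E 1)" using EN by (simp add: br_N nu_E_E)
  also have "\<dots> = br q3 q1" unfolding p(3,6) using br_split[OF p(4,5,1,2)] pp by simp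
  finally have E4: "E 4 \<in> J" using cJ(5)[OF p(5) cJ(4)[OF p(2)]] by simp
  have Ek: "E k \<in> J" if "4 \<le> k" "k \<le> n" for k
    using that
  proof (induction k rule: dec_induct)
    case (step k)
    have "E (Suc k) = br (E k) (E 1)"
      using nu_E_E(3)[of k] br_N[OF E_in_N[of k] EN(1)] step unfolding Suc_eq_plus1 by simp
    then show ?case using step cJ(5)[OF _ EK(1)] by simp
  qed (rule E4)
  have N'J: "x \<in> J" if x: "x \<in> N" "x 1 = 0" "x 3 = 0" for x
  proof -
    have "x = (\<Sum>i=1..n. x i *c E i)" by (rule sum_coord_E[OF x(1), symmetric])
    also have "\<dots> \<in> J"
    proof (rule cvec.subspace_sum)
      show "cvec.subspace J" using J by (simp add: alg.two_sided_ideal_def)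
      fix i assume i: "i \<in> {1..n}"
      consider "i = 1" | "i = 2" | "i = 3" | "4 \<le> i" using i by fastforce
      then show "x i *c E i \<in> J"
        using x cJ(2,3) E2 Ek i by cases auto
    qed
    finally show ?thesis .
  qed
  have "p1 = 0" "p3 = 0" using N'J pN p0 p IJ by blast+
  then have E13: "E 1 \<in> J" "E 3 \<in> J" using p by auto
  \<comment> \<open>\<open>pT\<close> annihilates e_1 and e_3, now elements of \<open>J\<close>; a
    nonzero last coordinate would make the matrix of \<open>D\<close> vanish, against
    \<open>nondeg\<close>.\<close>
  have "pT (n + 1) = 0"
  proof -
    have "br pT (E 1) = 0" "br pT (E 3) = 0" using br_ideals_zero[OF I J IJ p(7)] E13 by auto
    then have "pT (n + 1) * D (E 1) 1 = 0" "pT (n + 1) * D (E 3) 1 = 0"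
      "pT (n + 1) * D (E 1) 3 = 0" "pT (n + 1) * D (E 3) 3 = 0"
      using br1[of pT "E 1"] br1[of pT "E 3"] br3[of pT "E 1"] br3[of pT "E 3"] n4
      by (auto simp: E_apply)
    then show ?thesis using nondeg by (auto simp: D1 D3 E_apply)
  qed
  then have pTN: "pT \<in> N" using N_eq cI(4)[OF p(7)] by blast
  \<comment> \<open>Stripping the components along e_1 and e_3 leaves an element of the derived
    algebra of \<open>N\<close>, already known to lie in \<open>J\<close>.\<close>
  define w where "w = pT - (pT 1 *c E 1 + pT 3 *c E 3)"
  have "w \<in> N" unfolding w_def using pTN EN
    by (intro cvec.subspace_diff cvec.subspace_add cvec.subspace_scale subspace_coord_space)
  moreover have "w 1 = 0" "w 3 = 0" by (simp_all add: w_def E_apply)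
  ultimately have "w \<in> J" by (rule N'J)
  then have "w + (pT 1 *c E 1 + pT 3 *c E 3) \<in> J" using E13 by (intro cJ(1,2))
  moreover have "w + (pT 1 *c E 1 + pT 3 *c E 3) = pT" unfolding w_def by (rule diff_add_cancel)
  ultimately have "pT \<in> J" by (simp only:)
  then have "E (n + 1) \<in> J" unfolding p(9) using p(8) by (intro cJ(1))
  have "K \<subseteq> J"
  proof
    fix x assume x: "x \<in> K"
    have "x = (\<Sum>i=1..n+1. x i *c E i)" by (rule sum_coord_E[OF x, symmetric])
    also have "\<dots> \<in> J"
    proof (rule cvec.subspace_sum)
      show "cvec.subspace J" using J by (simp add: alg.two_sided_ideal_def)
      fix i assume i: "i \<in> {1..n+1}"
      consider "i = 1" | "i = 2" | "i = 3" | "4 \<le> i \<and> i \<le> n" | "i = n + 1" using i by fastforce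
      then show "x i *c E i \<in> J"
        using cJ(2) E2 Ek E13 \<open>E (n + 1) \<in> J\<close> by cases auto
    qed
    finally show "x \<in> J" .
  qed
  then show ?thesis using cI(3,4) IJ by blast
qed

text \<open>
  The projection onto \<open>I\<close> along \<open>J\<close> commutes with all multiplications. Hence it preserves \<open>N\<close>, and since
  the fourth coordinate of the bracket is a nondegenerate alternating form on \<open>N\<close> modulo its derived
  algebra, it acts there as an idempotent scalar.
\<close>

lemma indecomposable_K: "alg.indecomposable"
  unfolding alg.indecomposable_def
proof (intro notI, elim exE conjE)
  fix I J assume I: "alg.two_sided_ideal I" and J: "alg.two_sided_ideal J" and I0: "I \<noteq> {0}" and J0: "J \<noteq> {0}"
    and IJ: "I \<inter> J = {0}" and sum: "{x + y |x y. x \<in> I \<and> y \<in> J} = K"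
  note cI = ideal_closed[OF I] and cJ = ideal_closed[OF J]
  have ex: "\<exists>x\<in>I. \<exists>y\<in>J. E k = x + y" if "1 \<le> k" "k \<le> n + 1" for k
    using E_in_K[OF that] sum by blast
  obtain p1 q1 where p1: "p1 \<in> I" "q1 \<in> J" "E 1 = p1 + q1" using ex[of 1] by auto
  obtain p3 q3 where p3: "p3 \<in> I" "q3 \<in> J" "E 3 = p3 + q3" using ex[of 3] n4 by auto
  obtain pT qT where pT: "pT \<in> I" "qT \<in> J" "E (n + 1) = pT + qT" using ex[of "n + 1"] by auto
  have z: "br x y = 0" "br y x = 0" if "x \<in> I" "y \<in> J" for x y
    using that br_ideals_zero[OF I J IJ] br_ideals_zero[OF J I] IJ by (auto simp: Int_commute)
  have l: "br p (x + y) = br p x" "br (x + y) p = br x p" if "p \<in> I" "x \<in> I" "y \<in> J" for p x y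
    using that z by (auto simp: alg.br_add_left alg.br_add_right cI cJ)
  \<comment> \<open>Both sides of each equation equal the bracket of the \<open>I\<close>-components
    alone, since \<open>I\<close> and \<open>J\<close> annihilate each other.\<close>
  have e11: "br p1 (E 1) = br (E 1) p1" and e33: "br p3 (E 3) = br (E 3) p3" and e13: "br p1 (E 3) = br (E 1) p3"
    unfolding p1(3) p3(3) using p1 p3 by (simp_all add: l)
  have ET: "E 1 (n + 1) = 0" "E 3 (n + 1) = 0" using n4 by (auto simp: E_apply)
  have DE: "D (E 1) 1 = \<mu>" "D (E 1) 3 = a - \<mu>" "D (E 3) 1 = \<kappa>" "D (E 3) 3 = a - \<kappa>"
    by (auto simp: D1 D3 E_apply)
  \<comment> \<open>Coordinates 1 and 3 of the three equations see only the last coordinates of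
    \<open>p1\<close>, \<open>p3\<close> and the matrix of \<open>D\<close>; \<open>nondeg\<close>
    then forces these last coordinates to vanish.\<close>
  have "p1 (n + 1) * \<mu> = 0" "p1 (n + 1) * (a - \<mu>) = 0"
    using fun_cong[OF e11, of 1] fun_cong[OF e11, of 3] unfolding br1 br3 by (auto simp: ET DE)
  moreover have "p3 (n + 1) * \<kappa> = 0" "p3 (n + 1) * (a - \<kappa>) = 0"
    using fun_cong[OF e33, of 1] fun_cong[OF e33, of 3] unfolding br1 br3 by (auto simp: ET DE)
  moreover have "- (p1 (n + 1) * \<kappa>) = p3 (n + 1) * \<mu>" "- (p1 (n + 1) * (a - \<kappa>)) = p3 (n + 1) * (a - \<mu>)"
    using fun_cong[OF e13, of 1] fun_cong[OF e13, of 3] unfolding br1 br3 by (simp_all add: ET DE)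
  ultimately have "p1 (n + 1) = 0" "p3 (n + 1) = 0"
    using nondeg by (auto simp: algebra_simps)
  then have pN: "p1 \<in> N" "p3 \<in> N" using N_eq cI(4) p1 p3 by auto
  have EN: "E 1 \<in> N" "E 3 \<in> N" using n4 by (auto intro!: E_in_N)
  have q: "q1 = E 1 - p1" "q3 = E 3 - p3" using p1 p3 by auto
  have qN: "q1 \<in> N" "q3 \<in> N"
    unfolding q using pN EN by (auto intro: cvec.subspace_diff subspace_coord_space)
  have a1: "p1 3 = 0"
    using fun_cong[OF e11, of 4] pN EN by (simp add: br_N nu_def E_apply)
  have a2: "p3 1 = 0"
    using fun_cong[OF e33, of 4] pN EN by (simp add: br_N nu_def E_apply)
  have a3: "p1 1 = p3 3"
    using fun_cong[OF e13, of 4] pN EN by (simp add: br_N nu_def E_apply)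
  \<comment> \<open>This makes the scalar idempotent: \<open>p1\<close> and \<open>q3\<close> lie in
    different summands, and the fourth coordinate of their bracket is minus the scalar times its
    complement to 1.\<close>
  have "br p1 q3 = 0" using z p1 p3 by blast
  then have "p1 1 * (1 - p1 1) = 0"
  proof -
    have "br p1 q3 4 = p1 3 * q3 1 - p1 1 * q3 3" using pN qN by (simp add: br_N nu_def)
    then show ?thesis using \<open>br p1 q3 = 0\<close> a1 a3 by (simp add: q E_apply)
  qed
  then consider "p1 1 = 0" | "p1 1 = 1" by auto
  then show False
  proof cases
    case 1
    then show ?thesis
      using ideal_eq_zero_if_projection_nilpotent[OF I J IJ p1 p3 pT pN] a1 a2 a3 I0 by simp
  next
    case 2
    have JI: "J \<inter> I = {0}" using IJ by blast
    have e: "E 1 = q1 + p1" "E 3 = q3 + p3" "E (n + 1) = qT + pT" using p1 p3 pT by (auto simp: add.commute)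
    have "q1 1 = 0" "q1 3 = 0" "q3 1 = 0" "q3 3 = 0"
      using 2 a1 a2 a3 by (simp_all add: q E_apply)
    then have "J = {0}"
      using ideal_eq_zero_if_projection_nilpotent[OF J I JI p1(2,1) e(1) p3(2,1) e(2) pT(2,1) e(3) qN] by blast
    then show ?thesis using J0 by simp
  qed
qed

lemma solvable_indecomposable:
  "solvable_indecomposable_with_nilradical_L4 n vscale K br"
proof -
  have "algebra_isomorphic vscale N br vscale N (table_bracket n (L4 n))"
    unfolding algebra_isomorphic_def table_bracket_L4[OF n4]
    by (intro exI[of _ id]) (auto simp: br_N)
  then show ?thesis
    unfolding solvable_indecomposable_with_nilradical_L4_def
    using leibniz_ext dim_coord_space solvable_K indecomposable_K is_nilradical_N by blast
qed

end

lemma L4_extension_model: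
  assumes n: "n \<ge> 4" and adm: "model_admissible n a \<mu> \<kappa> \<beta> \<eta> q r s2"
  shows "L4_extension n (model_R n a \<mu> \<kappa> c \<beta> \<eta>) (\<lambda>i. model_Q a q r i - model_R n a \<mu> \<kappa> c \<beta> \<eta> i)
    (s1 *c E 2 + s2 *c E n)"
proof (rule L4_extension.intro)
  show "right_leibniz_algebra vscale (coord_space (n + 1)) (table_bracket (n + 1)
     (extend_L4 n (model_R n a \<mu> \<kappa> c \<beta> \<eta>) (\<lambda>i. model_Q a q r i - model_R n a \<mu> \<kappa> c \<beta> \<eta> i) (s1 *c E 2 + s2 *c E n)))"
    using model_right_leibniz[OF n adm] by (simp add: model_def)
  show "s1 *c E 2 + s2 *c E n \<in> coord_space n"
    using n by (intro cvec.subspace_add[OF subspace_coord_space] cvec.subspace_scale[OF subspace_coord_space] E_in_coord_space) auto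
qed (use n in \<open>auto intro!: model_R_in_coord_space model_Q_in_coord_space cvec.subspace_diff[OF subspace_coord_space]\<close>)

lemma model_solvable_indecomposable:
  assumes n: "n \<ge> 4" and adm: "model_admissible n a \<mu> \<kappa> \<beta> \<eta> q r s2" and nd: "a \<noteq> 0 \<or> \<mu> \<noteq> \<kappa>"
  shows "solvable_indecomposable_with_nilradical_L4 n vscale (coord_space (n + 1))
     (table_bracket (n + 1) (model n a \<mu> \<kappa> c \<beta> \<eta> q r s1 s2))"
proof -
  interpret L4_extension_nondegenerate n "model_R n a \<mu> \<kappa> c \<beta> \<eta>"
    "\<lambda>i. model_Q a q r i - model_R n a \<mu> \<kappa> c \<beta> \<eta> i" "s1 *c E 2 + s2 *c E n" a \<mu> \<kappa>
    using n nd by (intro L4_extension_nondegenerate.intro L4_extension_model n adm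
      L4_extension_nondegenerate_axioms.intro)
      (auto simp: lin_diff lin_model_R lin_model_Q E_apply)
  show ?thesis using solvable_indecomposable by (simp add: model_def)
qed

section \<open>The listed algebras as models\<close>

lemma table_bracket_cong:
  assumes "\<And>i j. i \<in> {1..m} \<Longrightarrow> j \<in> {1..m} \<Longrightarrow> t i j = t' i j"
  shows "table_bracket m t = table_bracket m t'"
  unfolding table_bracket_def fun_eq_iff using assms by (auto intro!: sum.cong)

lemma table_bracket_eq_model:
  assumes "\<And>i. 1 \<le> i \<Longrightarrow> i \<le> n \<Longrightarrow> R i = model_R n a \<mu> \<kappa> c \<beta> \<eta> i"
    and "\<And>i. 1 \<le> i \<Longrightarrow> i \<le> n \<Longrightarrow> S i = model_Q a q r i - model_R n a \<mu> \<kappa> c \<beta> \<eta> i"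
    and "s = s1 *c E 2 + s2 *c E n"
  shows "table_bracket (n + 1) (extend_L4 n R S s) = table_bracket (n + 1) (model n a \<mu> \<kappa> c \<beta> \<eta> q r s1 s2)"
  unfolding model_def assms(3)
  by (rule table_bracket_cong) (auto simp: extend_L4_def assms(1,2))

lemma table_bracket_eq_model_4:
  assumes "\<And>i. i \<in> {1,2,3,4} \<Longrightarrow> R i = model_R 4 a \<mu> \<kappa> c \<beta> \<eta> i"
    and "\<And>i. i \<in> {1,2,3,4} \<Longrightarrow> S i = model_Q a q r i - model_R 4 a \<mu> \<kappa> c \<beta> \<eta> i"
    and "s = s1 *c E 2 + s2 *c E 4"
  shows "table_bracket (4 + 1) (extend_L4 4 R S s) = table_bracket (4 + 1) (model 4 a \<mu> \<kappa> c \<beta> \<eta> q r s1 s2)"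
proof (rule table_bracket_eq_model)
  fix i :: nat assume "1 \<le> i" "i \<le> 4"
  then have "i \<in> {1,2,3,4}" by auto
  then show "R i = model_R 4 a \<mu> \<kappa> c \<beta> \<eta> i" "S i = model_Q a q r i - model_R 4 a \<mu> \<kappa> c \<beta> \<eta> i"
    by (fact assms)+
qed (fact assms(3))

lemma sum_scale_E_apply: "(\<Sum>i=m..n. f i *c E i) k = (if m \<le> k \<and> k \<le> n then f k else 0)"
proof -
  have "(\<Sum>i=m..n. f i *c E i) k = (\<Sum>i=m..n. if i = k then f i else 0)"
    unfolding sum_fun_apply by (intro sum.cong refl) (simp add: E_apply)
  then show ?thesis by simp
qed

lemma g1_eq_model:
  assumes "n \<ge> 4"
  shows "table_bracket (n + 1) (g1 n a) = table_bracket (n + 1) (model n a 1 0 (\<lambda>_. 0) 0 0 0 0 0 0)"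
  unfolding g1_def
  by (rule table_bracket_eq_model; rule ext)
    (use assms in \<open>auto simp: model_R_apply model_Q_def E_apply algebra_simps\<close>)

text \<open>The value 3 - n of \<open>a\<close> is the one at which the diagonal entry a + n - 3 at
  e_n vanishes, so that e_n may occur in the square of the last basis vector.\<close>

lemma g2_eq_model:
  assumes "n \<ge> 4"
  shows "table_bracket (n + 1) (g2 n) = table_bracket (n + 1) (model n (3 - of_nat n) 1 0 (\<lambda>_. 0) 0 0 0 0 0 1)"
  unfolding g2_def
  by (rule table_bracket_eq_model; rule ext)
    (use assms in \<open>auto simp: model_R_apply model_Q_def E_apply algebra_simps\<close>)

text \<open>The model coefficient with index 2 is \<epsilon>, and \<open>b\<close> starts at index
  3; the terms cut off beyond e_n are those that the truncated convolution omits.\<close>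

lemma g3_eq_model:
  assumes "n \<ge> 4"
  shows "table_bracket (n + 1) (g3 n \<epsilon> b)
    = table_bracket (n + 1) (model n 1 0 0 (\<lambda>j. if j = 2 then \<epsilon> else b (j - 2)) 0 0 0 0 0 0)"
proof -
  let ?c = "\<lambda>j. if j = 2 then \<epsilon> else b (j - 2)"
  have *: "E i k + (if i + 2 \<le> n then \<epsilon> *c E (i + 2) else 0) k + (\<Sum>k=i+3..n. b (k - i - 2) *c E k) k
      = (if k = i then 1 else 0) + (if i + 2 \<le> k \<and> k \<le> n then ?c (k - i) else 0)" for i k
    unfolding sum_scale_E_apply by (simp add: E_apply) linarith
  have R: "model_R n 1 0 0 ?c 0 0 i = (if i = 4 then E 2 else 0) + E i
      + (if i + 2 \<le> n then \<epsilon> *c E (i + 2) else 0) + (\<Sum>k=i+3..n. b (k - i - 2) *c E k)"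
    if "3 \<le> i" for i
  proof
    fix k
    have "model_R n 1 0 0 ?c 0 0 i k = (if i = 4 then E 2 else 0) k
        + ((if k = i then 1 else 0) + (if i + 2 \<le> k \<and> k \<le> n then ?c (k - i) else 0))"
      using that unfolding model_R_apply[OF assms] by (simp add: E_apply)
    then show "model_R n 1 0 0 ?c 0 0 i k = ((if i = 4 then E 2 else 0) + E i
      + (if i + 2 \<le> n then \<epsilon> *c E (i + 2) else 0) + (\<Sum>k=i+3..n. b (k - i - 2) *c E k)) k"
      unfolding *[symmetric] by (simp only: plus_fun_apply add.assoc)
  qed
  have R12: "model_R n 1 0 0 ?c 0 0 1 = E 3" "model_R n 1 0 0 ?c 0 0 2 = 2 *c E 2"
    by (simp_all add: model_R_def fun_eq_iff)
  show ?thesis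
    unfolding g3_def
  proof (rule table_bracket_eq_model)
    fix i assume i: "1 \<le> i" "i \<le> n"
    consider "i = 1" | "i = 2" | "3 \<le> i" using i by fastforce
    then show "(if i = 1 then - E 3
          else if 3 \<le> i \<and> i \<le> n then
            (if i = 4 then E 2 else 0) - E i - (if i + 2 \<le> n then \<epsilon> *c E (i + 2) else 0)
            - (\<Sum>k=i+3..n. b (k - i - 2) *c E k)
          else 0) = model_Q 1 0 0 i - model_R n 1 0 0 ?c 0 0 i"
    proof cases
      case 3
      then have "model_Q 1 0 0 i = (if i = 4 then E 2 + E 2 else 0)"
        by (simp add: model_Q_def fun_eq_iff)
      then show ?thesis unfolding R[OF 3] using 3 i by (simp add: algebra_simps)
    qed (simp_all add: R12, simp_all add: model_Q_def)
  qed (use R R12 in auto)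
qed

lemma g4_eq_model:
  assumes "n \<ge> 4"
  shows "table_bracket (n + 1) (g4 n \<epsilon> d f) = table_bracket (n + 1) (model n 0 1 0 (\<lambda>_. 0) 0 d (d + f) (d + f) \<epsilon> 0)"
  unfolding g4_def
  by (rule table_bracket_eq_model; rule ext)
    (use assms in \<open>auto simp: model_R_apply model_Q_def E_apply algebra_simps\<close>)

text \<open>The eigenvalues of the model are b + 1 and a - 1, so the excluded pair a = 1, b = -1 is
  exactly the degenerate case.\<close>

lemma g5_eq_model:
  "table_bracket (4 + 1) (g5 a b) = table_bracket (4 + 1) (model 4 (b + 1) a 1 (\<lambda>_. 0) 0 0 0 0 0 0)"
  unfolding g5_def
  by (rule table_bracket_eq_model_4; rule ext)
    (auto simp: model_R_apply model_Q_def E_apply algebra_simps)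

lemma g6_eq_model:
  "table_bracket (4 + 1) (g6 a) = table_bracket (4 + 1) (model 4 (1 - a) a 1 (\<lambda>_. 0) 0 0 0 0 0 1)"
  unfolding g6_def
  by (rule table_bracket_eq_model_4; rule ext)
    (auto simp: model_R_apply model_Q_def E_apply algebra_simps)

lemma g7_eq_model:
  "table_bracket (4 + 1) (g7 a \<epsilon> d f) = table_bracket (4 + 1) (model 4 0 a 1 (\<lambda>_. 0) 0 f (d + f) (d + f) \<epsilon> 0)"
  unfolding g7_def
  by (rule table_bracket_eq_model_4; rule ext)
    (auto simp: model_R_apply model_Q_def E_apply algebra_simps)

lemma g8_eq_model:
  "table_bracket (4 + 1) (g8 c \<epsilon> d) = table_bracket (4 + 1) (model 4 0 0 1 (\<lambda>_. 0) c 0 (2 * c + d) (2 * c + d) \<epsilon> 0)"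
  unfolding g8_def
  by (rule table_bracket_eq_model_4; rule ext)
    (auto simp: model_R_apply model_Q_def E_apply algebra_simps)

lemma listed_solvable_indecomposable:
  assumes n: "n \<ge> 4" and t: "listed n t"
  shows "solvable_indecomposable_with_nilradical_L4 n vscale (coord_space (n + 1)) (table_bracket (n + 1) t)"
  using t
proof cases
  case (i a)
  show ?thesis unfolding i g1_eq_model[OF n]
    by (rule model_solvable_indecomposable[OF n]) (auto simp: model_admissible_def)
next
  case ii
  show ?thesis unfolding ii g2_eq_model[OF n]
    by (rule model_solvable_indecomposable[OF n]) (auto simp: model_admissible_def)
next
  case (iii \<epsilon> b)
  show ?thesis unfolding iii g3_eq_model[OF n]
    by (rule model_solvable_indecomposable[OF n]) (auto simp: model_admissible_def)
next
  case (iv \<epsilon> d f)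
  show ?thesis unfolding iv g4_eq_model[OF n]
    by (rule model_solvable_indecomposable[OF n]) (auto simp: model_admissible_def)
next
  case (v b a)
  have "b + 1 \<noteq> 0 \<or> a \<noteq> 1" using v(3) by (auto simp: eq_neg_iff_add_eq_0)
  then show ?thesis unfolding v g5_eq_model
    by (intro model_solvable_indecomposable) (auto simp: model_admissible_def)
next
  case (vi a)
  show ?thesis unfolding vi g6_eq_model
    by (rule model_solvable_indecomposable) (use vi in \<open>auto simp: model_admissible_def\<close>)
next
  case (vii \<epsilon> a d f)
  show ?thesis unfolding vii g7_eq_model
    by (rule model_solvable_indecomposable) (use vii in \<open>auto simp: model_admissible_def\<close>)
next
  case (viii c \<epsilon> d)
  show ?thesis unfolding viii g8_eq_model
    by (rule model_solvable_indecomposable) (use viii in \<open>auto simp: model_admissible_def\<close>)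
qed

section \<open>Coordinates for an arbitrary extension\<close>

lemma right_leibniz_algebra_transfer:
  assumes A: "right_leibniz_algebra s1 V1 br1" and B: "fd_complex_algebra s2 V2 br2"
    and iso: "algebra_isomorphic s1 V1 br1 s2 V2 br2"
  shows "right_leibniz_algebra s2 V2 br2"
proof -
  interpret A: right_leibniz_algebra s1 V1 br1 by (rule A)
  interpret B: fd_complex_algebra s2 V2 br2 by (rule B)
  obtain f where f: "bij_betw f V1 V2" "\<And>x y. x\<in>V1 \<Longrightarrow> y\<in>V1 \<Longrightarrow> f (x + y) = f x + f y"
      "\<And>x y. x\<in>V1 \<Longrightarrow> y\<in>V1 \<Longrightarrow> f (br1 x y) = br2 (f x) (f y)"
    using iso unfolding algebra_isomorphic_def by blast
  show ?thesis
  proof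
    fix x y z assume "x \<in> V2" "y \<in> V2" "z \<in> V2"
    then obtain x' y' z' where *: "x' \<in> V1" "y' \<in> V1" "z' \<in> V1" "x = f x'" "y = f y'" "z = f z'"
      using f(1) unfolding bij_betw_def by blast
    have "br2 (br2 x y) z = f (br1 (br1 x' y') z')"
      unfolding *(4-6) by (simp only: f(3) A.br_closed *(1-3))
    also have "\<dots> = f (br1 (br1 x' z') y' + br1 x' (br1 y' z'))"
      by (simp only: A.leibniz[OF *(1,2,3)])
    also have "\<dots> = br2 (br2 x z) y + br2 x (br2 y z)"
      unfolding *(4-6) by (simp only: f(2,3) A.br_closed *(1-3))
    finally show "br2 (br2 x y) z = br2 (br2 x z) y + br2 x (br2 y z)" .
  qed
qed

text \<open>The preimages under \<open>f\<close> of the lower central series of \<open>V2\<close>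
  form a filtration of \<open>V1\<close>, which avoids transporting spans.\<close>

lemma nilpotent_transfer:
  assumes A: "fd_complex_algebra s1 V1 br1" and B: "fd_complex_algebra s2 V2 br2"
    and iso: "algebra_isomorphic s1 V1 br1 s2 V2 br2"
    and nil: "fd_complex_algebra.nilpotent s2 br2 V2"
  shows "fd_complex_algebra.nilpotent s1 br1 V1"
proof -
  interpret A: fd_complex_algebra s1 V1 br1 by (rule A)
  interpret B: fd_complex_algebra s2 V2 br2 by (rule B)
  obtain f where f: "bij_betw f V1 V2" "\<And>x y. x\<in>V1 \<Longrightarrow> y\<in>V1 \<Longrightarrow> f (x + y) = f x + f y"
      "\<And>c x. x\<in>V1 \<Longrightarrow> f (s1 c x) = s2 c (f x)"
      "\<And>x y. x\<in>V1 \<Longrightarrow> y\<in>V1 \<Longrightarrow> f (br1 x y) = br2 (f x) (f y)"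
    using iso unfolding algebra_isomorphic_def by blast
  have f0: "f 0 = 0" using f(3)[of 0 0] A.zero_in_V by simp
  have fV: "f x \<in> V2" if "x \<in> V1" for x using f(1) that bij_betwE by blast
  obtain m where m: "B.lower_central V2 m = {0}" using nil unfolding B.nilpotent_def by blast
  have sub: "B.subspace (B.lower_central V2 k)" for k
    by (cases k) (auto simp: B.product_def B.subspace_V)
  show ?thesis
  proof (rule A.nilpotent_if_filtration[where F = "\<lambda>k. {x \<in> V1. f x \<in> B.lower_central V2 k}"])
    show "A.subspace V1" by (rule A.subspace_V)
    show "V1 \<subseteq> {x \<in> V1. f x \<in> B.lower_central V2 0}" using fV by auto
    show "A.subspace {x \<in> V1. f x \<in> B.lower_central V2 k}" for k
      using sub[of k] unfolding A.subspace_def B.subspace_def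
      by (auto simp: f f0 A.zero_in_V A.add_in_V A.scale_in_V)
    show "{x \<in> V1. f x \<in> B.lower_central V2 m} = {0}"
      using f(1) f0 A.zero_in_V unfolding m bij_betw_def inj_on_def by auto
    show "br1 x y \<in> {x \<in> V1. f x \<in> B.lower_central V2 (Suc k)}"
      if "x \<in> {x \<in> V1. f x \<in> B.lower_central V2 k}" "y \<in> V1" for k x y
      using that B.br_in_product[of "f x" "B.lower_central V2 k" "f y" V2] fV
      by (simp add: f(4) A.br_closed)
  qed
qed

text \<open>Any vector \<open>x\<close> outside the nilradical serves as last basis vector. Products
  of \<open>x\<close> with \<open>N\<close> stay in \<open>N\<close> because \<open>N\<close> is an
  ideal; the product of \<open>x\<close> with itself needs its own argument.\<close>

lemma L4_extension_exists:
  assumes n: "n \<ge> 4" and V: "solvable_indecomposable_with_nilradical_L4 n scale V br"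
  obtains R S s where "L4_extension n R S s"
    "algebra_isomorphic scale V br vscale (coord_space (n + 1)) (table_bracket (n + 1) (extend_L4 n R S s))"
    "\<not> fd_complex_algebra.nilpotent vscale (table_bracket (n + 1) (extend_L4 n R S s)) (coord_space (n + 1))"
proof -
  have "right_leibniz_algebra scale V br" using V by (simp add: solvable_indecomposable_with_nilradical_L4_def)
  then interpret V: right_leibniz_algebra scale V br .
  have dimV: "V.dim V = n + 1" using V by (simp add: solvable_indecomposable_with_nilradical_L4_def)
  obtain N where N: "V.is_nilradical N" "algebra_isomorphic scale N br vscale (coord_space n) (table_bracket n (L4 n))"
    using V by (auto simp: solvable_indecomposable_with_nilradical_L4_def)
  have idN: "V.two_sided_ideal N" and maxN: "\<And>M. V.two_sided_ideal M \<Longrightarrow> V.nilpotent M \<Longrightarrow> N \<subseteq> M \<Longrightarrow> M = N"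
    using N(1) unfolding V.is_nilradical_def V.maximal_nilpotent_ideal_def by blast+
  have subN: "V.subspace N" and NV: "N \<subseteq> V" and ideal: "\<And>x y. x \<in> N \<Longrightarrow> y \<in> V \<Longrightarrow> br x y \<in> N \<and> br y x \<in> N"
    using idN unfolding V.two_sided_ideal_def by auto
  have "algebra_isomorphic vscale (coord_space n) (table_bracket n (L4 n)) scale N br"
    by (rule algebra_isomorphic_sym[OF N(2)]) (use subN NV ideal in \<open>auto intro: V.subspace_add V.subspace_scale\<close>)
  then obtain g where g: "bij_betw g (coord_space n) N"
      "\<And>x y. x\<in>coord_space n \<Longrightarrow> y\<in>coord_space n \<Longrightarrow> g (x + y) = g x + g y"
      "\<And>c x. x\<in>coord_space n \<Longrightarrow> g (c *c x) = scale c (g x)"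
      "\<And>x y. x\<in>coord_space n \<Longrightarrow> y\<in>coord_space n \<Longrightarrow> g (table_bracket n (L4 n) x y) = br (g x) (g y)"
    unfolding algebra_isomorphic_def by blast
  have g0: "g 0 = 0" using g(3)[of 0 0] cvec.subspace_0[OF subspace_coord_space] by simp
  have gsum: "g (\<Sum>i\<in>A. f i) = (\<Sum>i\<in>A. g (f i))" if "finite A" "\<And>i. i \<in> A \<Longrightarrow> f i \<in> coord_space n" for A :: "nat set" and f
    using that
  proof (induction A)
    case (insert x F)
    have "g (\<Sum>i\<in>insert x F. f i) = g (f x + (\<Sum>i\<in>F. f i))"
      using insert by (simp only: sum.insert not_False_eq_True)
    also have "\<dots> = g (f x) + g (\<Sum>i\<in>F. f i)"
      using insert by (intro g(2) cvec.subspace_sum[OF subspace_coord_space]) auto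
    also have "\<dots> = (\<Sum>i\<in>insert x F. g (f i))"
      using insert by (simp del: sum_fun_apply)
    finally show ?case .
  qed (simp only: sum.empty g0)
  have gN: "g x \<in> N" if "x \<in> coord_space n" for x using g(1) that bij_betwE by blast
  have gE: "g x = (\<Sum>i=1..n. scale (x i) (g (E i)))" if "x \<in> coord_space n" for x
  proof -
    have Ei: "E i \<in> coord_space n" if "i \<in> {1..n}" for i using that by (intro E_in_coord_space) auto
    have "g x = g (\<Sum>i=1..n. x i *c E i)" by (simp only: sum_coord_E[OF that])
    also have "\<dots> = (\<Sum>i=1..n. g (x i *c E i))"
      by (intro gsum cvec.subspace_scale[OF subspace_coord_space] Ei) auto
    also have "\<dots> = (\<Sum>i=1..n. scale (x i) (g (E i)))"
      by (intro sum.cong refl g(3) Ei)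
    finally show ?thesis .
  qed
  have dimN: "V.dim N \<le> n"
  proof -
    have "N \<subseteq> V.span ((\<lambda>i. g (E i)) ` {1..n})"
    proof
      fix v assume "v \<in> N"
      then obtain x where x: "x \<in> coord_space n" "v = g x" using g(1) unfolding bij_betw_def by blast
      show "v \<in> V.span ((\<lambda>i. g (E i)) ` {1..n})"
        unfolding x(2) gE[OF x(1)] by (intro V.span_sum V.span_scale V.span_base) auto
    qed
    then have "V.dim N \<le> card ((\<lambda>i. g (E i)) ` {1..n})" by (intro V.dim_le_card) auto
    also have "\<dots> \<le> n" using card_image_le[of "{1..n}" "\<lambda>i. g (E i)"] by simp
    finally show ?thesis .
  qed
  then have "N \<noteq> V" using dimV by auto
  then obtain x where x: "x \<in> V" "x \<notin> N" using NV by blast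
  \<comment> \<open>The whole algebra is an ideal properly containing \<open>N\<close>, so
    maximality of \<open>N\<close> forbids that it be nilpotent.\<close>
  have not_nil: "\<not> V.nilpotent V"
  proof
    assume "V.nilpotent V"
    moreover have "V.two_sided_ideal V" unfolding V.two_sided_ideal_def using V.subspace_V V.br_closed by blast
    ultimately show False using maxN NV \<open>N \<noteq> V\<close> by blast
  qed
  define b where "b i = (if i = n + 1 then x else g (E i))" for i
  have bV: "b i \<in> V" if "i \<in> {1..n+1}" for i
    using that x NV gN[OF E_in_coord_space[of i n]] by (auto simp: b_def)
  have sum_b: "(\<Sum>i=1..n+1. scale (c i) (b i)) = (\<Sum>i=1..n. scale (c i) (g (E i))) + scale (c (n + 1)) x" for c
  proof -
    have "(\<Sum>i=1..n+1. scale (c i) (b i)) = (\<Sum>i=1..n. scale (c i) (b i)) + scale (c (n + 1)) (b (n + 1))"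
      unfolding Suc_eq_plus1[symmetric] by simp
    then show ?thesis by (simp add: b_def)
  qed
  have gsumN: "(\<Sum>i=1..n. scale (c i) (g (E i))) \<in> N" for c
    by (intro V.subspace_sum[OF subN] V.subspace_scale[OF subN] gN E_in_coord_space) auto
  have x_mult: "c = 0" if "scale c x \<in> N" for c
  proof (rule ccontr)
    assume "c \<noteq> 0"
    then have "x = scale (1 / c) (scale c x)" by simp
    also have "\<dots> \<in> N" using V.subspace_scale[OF subN that] .
    finally show False using x by simp
  qed
  have indep: "\<forall>i\<in>{1..n+1}. c i = 0" if c: "(\<Sum>i=1..n+1. scale (c i) (b i)) = 0" for c
  proof -
    have "scale (c (n + 1)) x = - (\<Sum>i=1..n. scale (c i) (g (E i)))"
      using c unfolding sum_b by (simp add: eq_neg_iff_add_eq_0 add.commute)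
    then have T: "c (n + 1) = 0" using x_mult V.subspace_neg[OF subN gsumN] by simp
    define c' where "c' i = (if i \<in> {1..n} then c i else 0)" for i
    have c': "c' \<in> coord_space n" by (auto simp: coord_space_def c'_def)
    have "g c' = (\<Sum>i=1..n. scale (c i) (g (E i)))"
      unfolding gE[OF c'] by (intro sum.cong) (auto simp: c'_def)
    also have "\<dots> = g 0" using c T unfolding sum_b g0 by simp
    finally have "c' = 0"
      using g(1) c' cvec.subspace_0[OF subspace_coord_space] unfolding bij_betw_def inj_on_def by blast
    then have "c' i = 0" for i by simp
    then have "c i = 0" if "i \<in> {1..n}" for i using that unfolding c'_def by metis
    then show ?thesis using T by (metis Suc_eq_plus1 atLeastAtMost_iff le_SucE)
  qed
  have bij: "bij_betw (\<lambda>c. \<Sum>i=1..n+1. scale (c i) (b i)) (coord_space (n + 1)) V"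
    by (rule V.bij_betw_coordinates[OF bV indep dimV])
  have decomp: "\<exists>c. \<exists>y\<in>N. v = y + scale c x" if v: "v \<in> V" for v
  proof -
    obtain c where "v = (\<Sum>i=1..n+1. scale (c i) (b i))" using bij v unfolding bij_betw_def by blast
    then show ?thesis unfolding sum_b using gsumN by blast
  qed
  \<comment> \<open>The Leibniz identity for three equal arguments gives [x, [x, x]] = 0. With
    [x, x] = y + c x this puts c * c times \<open>x\<close> into \<open>N\<close>, so c = 0.\<close>
  have xx: "br x x \<in> N"
  proof -
    obtain c y where cy: "y \<in> N" "br x x = y + scale c x" using decomp V.br_closed x by blast
    have yV: "y \<in> V" using cy NV by blast
    have "0 = br x (br x x)" using V.leibniz[OF x(1) x(1) x(1)] by simp
    also have "\<dots> = br x (y + scale c x)" by (simp only: cy(2))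
    also have "\<dots> = br x y + scale c (br x x)"
      by (simp only: V.br_add_right V.br_scale_right V.scale_in_V x yV)
    also have "\<dots> = (br x y + scale c y) + scale (c * c) x"
      by (simp only: cy(2) V.scale_right_distrib V.scale_scale add.assoc)
    finally have "scale (c * c) x = - (br x y + scale c y)"
      by (metis add.commute eq_neg_iff_add_eq_0)
    moreover have "- (br x y + scale c y) \<in> N"
      using ideal[OF cy(1) x(1)] cy(1) by (intro V.subspace_neg[OF subN] V.subspace_add[OF subN] V.subspace_scale[OF subN]) auto
    ultimately have "c * c = 0" by (metis x_mult)
    then show ?thesis using cy by simp
  qed
  have bN: "b i \<in> N" if "i \<in> {1..n}" for i
    using that gN[OF E_in_coord_space[of i n]] by (auto simp: b_def)
  have coords: "\<exists>r\<in>coord_space n. v = g r" if "v \<in> N" for v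
    using g(1) that unfolding bij_betw_def by blast
  have "\<exists>R. \<forall>i\<in>{1..n}. R i \<in> coord_space n \<and> br (b i) x = g (R i)"
    using coords ideal[OF bN x(1)] by (intro bchoice) blast
  then obtain R where R: "\<And>i. i \<in> {1..n} \<Longrightarrow> R i \<in> coord_space n" "\<And>i. i \<in> {1..n} \<Longrightarrow> br (b i) x = g (R i)" by blast
  have "\<exists>S. \<forall>i\<in>{1..n}. S i \<in> coord_space n \<and> br x (b i) = g (S i)"
    using coords ideal[OF bN x(1)] by (intro bchoice) blast
  then obtain S where S: "\<And>i. i \<in> {1..n} \<Longrightarrow> S i \<in> coord_space n" "\<And>i. i \<in> {1..n} \<Longrightarrow> br x (b i) = g (S i)" by blast
  obtain s where s: "s \<in> coord_space n" "br x x = g s" using coords[OF xx] by blast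
  let ?t = "extend_L4 n R S s"
  have tn: "?t i j \<in> coord_space n" if "i \<in> {1..n+1}" "j \<in> {1..n+1}" for i j
    using extend_L4_in_coord_space[OF n] R(1) S(1) s(1) that by simp
  then have t: "?t i j \<in> coord_space (n + 1)" if "i \<in> {1..n+1}" "j \<in> {1..n+1}" for i j
    using coord_space_mono[of n "n + 1"] that by auto
  have br_b: "br (b i) (b j) = (\<Sum>k=1..n+1. scale (?t i j k) (b k))" if ij: "i \<in> {1..n+1}" "j \<in> {1..n+1}" for i j
  proof -
    have "?t i j (n + 1) = 0" using tn[OF ij] by (simp add: coord_space_def)
    then have "(\<Sum>k=1..n+1. scale (?t i j k) (b k)) = g (?t i j)"
      unfolding sum_b gE[OF tn[OF ij]] by simp
    also have "\<dots> = br (b i) (b j)"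
    proof (cases "i = n + 1 \<or> j = n + 1")
      case True
      then show ?thesis using ij R(2) S(2) s(2) by (auto simp: extend_L4_def b_def)
    next
      case False
      then have ij': "i \<in> {1..n}" "j \<in> {1..n}" using ij by auto
      have "br (b i) (b j) = g (table_bracket n (L4 n) (E i) (E j))"
        using False ij' by (simp add: b_def g(4) E_in_coord_space)
      then show ?thesis using False table_bracket_E[OF ij'] by (simp add: extend_L4_def)
    qed
    finally show ?thesis by simp
  qed
  have iso: "algebra_isomorphic scale V br vscale (coord_space (n + 1)) (table_bracket (n + 1) ?t)"
    by (rule V.basis_isomorphism[OF bV indep dimV t br_b])
  have K: "fd_complex_algebra vscale (coord_space (n + 1)) (table_bracket (n + 1) ?t)"
    by (rule fd_complex_algebra_table[OF t])
  have "right_leibniz_algebra vscale (coord_space (n + 1)) (table_bracket (n + 1) ?t)"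
    by (rule right_leibniz_algebra_transfer[OF _ K iso]) unfold_locales
  then have "L4_extension n R S s"
    using n R(1) S(1) s(1) by (intro L4_extension.intro) auto
  moreover have "\<not> fd_complex_algebra.nilpotent vscale (table_bracket (n + 1) ?t) (coord_space (n + 1))"
    using nilpotent_transfer[OF _ K iso] not_nil V.fd_complex_algebra_axioms by blast
  ultimately show ?thesis using that iso by blast
qed

section \<open>Change of generators\<close>

text \<open>The images of the e_k under the prospective automorphism with e_1 to \<open>X\<close>
  and e_3 to \<open>Y\<close>: e_2 is the square of e_1, and e_k arises from e_3 by k - 3 right
  multiplications by e_1.\<close>

definition L4_basis :: "nat \<Rightarrow> vec \<Rightarrow> vec \<Rightarrow> nat \<Rightarrow> vec" where
  "L4_basis n X Y k = (if k = 1 then X else if k = 2 then nu n X X else ((\<lambda>v. nu n v X) ^^ (k - 3)) Y)"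

definition L4_comb :: "nat \<Rightarrow> vec \<Rightarrow> vec \<Rightarrow> vec \<Rightarrow> vec" where
  "L4_comb n X Y c = (\<Sum>k=1..n. c k *c L4_basis n X Y k)"

lemma L4_comb_apply: "L4_comb n X Y c i = (\<Sum>k=1..n. c k * L4_basis n X Y k i)"
  by (simp add: L4_comb_def)

lemma L4_comb_linear:
  "L4_comb n X Y (c + d) = L4_comb n X Y c + L4_comb n X Y d"
  "L4_comb n X Y (c - d) = L4_comb n X Y c - L4_comb n X Y d"
  "L4_comb n X Y (- c) = - L4_comb n X Y c"
  "L4_comb n X Y (a *c c) = a *c L4_comb n X Y c"
  "L4_comb n X Y 0 = 0"
  by (simp_all add: L4_comb_def fun_eq_iff algebra_simps sum.distrib sum_subtractf sum_negf sum_distrib_left)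

lemma L4_comb_E: "1 \<le> k \<Longrightarrow> k \<le> n \<Longrightarrow> L4_comb n X Y (E k) = L4_basis n X Y k"
proof
  fix i assume k: "1 \<le> k" "k \<le> n"
  have "L4_comb n X Y (E k) i = (\<Sum>j=1..n. if j = k then L4_basis n X Y j i else 0)"
    unfolding L4_comb_apply by (intro sum.cong refl) (simp add: E_apply)
  then show "L4_comb n X Y (E k) i = L4_basis n X Y k i" using k by simp
qed

text \<open>Equal values of \<open>l\<close> give \<open>X\<close> and \<open>Y\<close> the same
  square, \<open>det\<close> makes them independent modulo the derived algebra, and
  \<open>Y 1 = 0\<close> lets \<open>Y\<close> centralize the derived algebra when that algebra
  contains e_5.\<close>

locale L4_generators =
  fixes n :: nat and X Y :: vec and l :: complex
  assumes n_ge_4: "n \<ge> 4" and XN: "X \<in> coord_space n" and YN: "Y \<in> coord_space n"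
    and lX: "X 1 + X 3 = l" and lY: "Y 1 + Y 3 = l" and l0: "l \<noteq> 0"
    and det: "X 1 * Y 3 - X 3 * Y 1 \<noteq> 0" and Y1: "Y 1 = 0 \<or> n = 4"
begin

abbreviation "b \<equiv> L4_basis n X Y"
abbreviation "comb \<equiv> L4_comb n X Y"

lemma b_simps: "b 1 = X" "b 2 = (l * l) *c E 2" "b 3 = Y" "b 4 = nu n Y X"
  "3 \<le> k \<Longrightarrow> b (k + 1) = nu n (b k) X"
proof -
  have "nu n X X = (l * l) *c E 2"
    using n_ge_4 by (auto simp: nu_def fun_eq_iff E_apply lX[symmetric] algebra_simps)
  then show "b 2 = (l * l) *c E 2" by (simp add: L4_basis_def)
  show "b (k + 1) = nu n (b k) X" if "3 \<le> k"
  proof -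
    have "k + 1 - 3 = Suc (k - 3)" using that by simp
    then show ?thesis using that by (simp add: L4_basis_def)
  qed
qed (simp_all add: L4_basis_def)

lemma b_in_N: "1 \<le> k \<Longrightarrow> b k \<in> coord_space n"
proof -
  assume "1 \<le> k"
  then consider "k = 1" | "k = 2" | "k = 3" | "4 \<le> k" by fastforce
  then show ?thesis
  proof cases
    case 2
    then show ?thesis using n_ge_4 by (auto simp: b_simps coord_space_def E_apply)
  next
    case 4
    then show ?thesis using b_simps(5)[of "k - 1"] nu_in_coord_space[OF n_ge_4] by simp
  qed (auto simp: b_simps XN YN)
qed

lemma X1: "n \<noteq> 4 \<Longrightarrow> X 1 \<noteq> 0"
  using Y1 det by auto

text \<open>The leading coefficient of \<open>b 4\<close> is the determinant, and each further right
  multiplication by \<open>X\<close> shifts by one and multiplies it by \<open>X 1\<close>, which is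
  nonzero for \<open>n > 4\<close>. Coordinate 2 is exempt because \<open>b 4\<close> may have a
  component there.\<close>

lemma b_triangular:
  assumes "4 \<le> k" "k \<le> n"
  shows "b k 1 = 0 \<and> b k 3 = 0 \<and> (\<forall>i. i < k \<longrightarrow> i \<noteq> 2 \<longrightarrow> b k i = 0) \<and> b k k \<noteq> 0"
  using assms
proof (induction k rule: dec_induct)
  case base
  then show ?case using det by (auto simp: b_simps nu_def mult.commute)
next
  case (step k)
  then have IH: "b k 1 = 0" "b k 3 = 0" "\<And>i. i < k \<Longrightarrow> i \<noteq> 2 \<Longrightarrow> b k i = 0" "b k k \<noteq> 0" by auto
  have b: "b (Suc k) = nu n (b k) X" using b_simps(5)[of k] step unfolding Suc_eq_plus1 by simp
  have "n \<noteq> 4" using step by simp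
  have "b (Suc k) i = 0" if "i < Suc k" "i \<noteq> 2" for i
    unfolding b using IH(3)[of "i - 1"] that by (auto simp: nu_def IH)
  moreover have "b (Suc k) (Suc k) = b k k * X 1"
    unfolding b using step by (simp add: nu_def IH)
  ultimately show ?case using step X1[OF \<open>n \<noteq> 4\<close>] IH(4) by (auto simp: b nu_def)
qed

lemma comb_in_N: "comb c \<in> coord_space n"
  unfolding L4_comb_def
  by (intro cvec.subspace_sum[OF subspace_coord_space] cvec.subspace_scale[OF subspace_coord_space] b_in_N) auto

lemma sum_split4: "(\<Sum>k=1..n. f k) = f 1 + f 2 + f 3 + (\<Sum>k=4..n. f k)" for f :: "nat \<Rightarrow> complex"
proof -
  have "{1..n} = {1,2,3} \<union> {4..n}" using n_ge_4 by auto
  then have "(\<Sum>k=1..n. f k) = sum f {1,2,3} + (\<Sum>k=4..n. f k)"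
    by (simp add: sum.union_disjoint)
  then show ?thesis by (simp add: add.assoc)
qed

lemma comb_1: "comb c 1 = c 1 * X 1 + c 3 * Y 1" and comb_3: "comb c 3 = c 1 * X 3 + c 3 * Y 3"
proof -
  have "(\<Sum>k=4..n. c k * b k i) = 0" if "i = 1 \<or> i = 3" for i
    using b_triangular that by (intro sum.neutral) auto
  then show "comb c 1 = c 1 * X 1 + c 3 * Y 1" "comb c 3 = c 1 * X 3 + c 3 * Y 3"
    unfolding L4_comb_apply sum_split4 by (simp_all add: b_simps E_apply)
qed

text \<open>Triangular elimination: coordinates 1 and 3 by Cramer's rule, then 4 to \<open>n\<close>
  in ascending order, and coordinate 2 last, since \<open>b 4\<close> may also contribute to
  it.\<close>

lemma comb_eq_0:
  assumes "comb c = 0" "1 \<le> i" "i \<le> n"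
  shows "c i = 0"
proof -
  have z: "comb c j = 0" for j using assms by simp
  have e: "c 1 * X 1 + c 3 * Y 1 = 0" "c 1 * X 3 + c 3 * Y 3 = 0"
    using z comb_1 comb_3 by metis+
  have "c 1 * (X 1 * Y 3 - X 3 * Y 1) = (c 1 * X 1 + c 3 * Y 1) * Y 3 - (c 1 * X 3 + c 3 * Y 3) * Y 1"
    by (simp add: algebra_simps)
  then have c1: "c 1 = 0" using e det by simp
  have "c 3 * (X 1 * Y 3 - X 3 * Y 1) = (c 1 * X 3 + c 3 * Y 3) * X 1 - (c 1 * X 1 + c 3 * Y 1) * X 3"
    by (simp add: algebra_simps)
  then have c3: "c 3 = 0" using e det by simp
  have ck: "c k = 0" if "4 \<le> k" "k \<le> n" for k
    using that
  proof (induction k rule: less_induct)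
    case (less k)
    have "0 = (\<Sum>j=4..n. c j * b j k)"
      using z[of k] less c1 c3 unfolding L4_comb_apply sum_split4 by (simp add: b_simps E_apply)
    also have "\<dots> = (\<Sum>j\<in>{k}. c j * b j k)"
    proof (rule sum.mono_neutral_right)
      show "\<forall>j\<in>{4..n} - {k}. c j * b j k = 0"
      proof
        fix j assume j: "j \<in> {4..n} - {k}"
        show "c j * b j k = 0"
        proof (cases "j < k")
          case True
          then show ?thesis using less j by auto
        next
          case False
          then show ?thesis using b_triangular[of j] j less by auto
        qed
      qed
    qed (use less in auto)
    finally show ?case using b_triangular[OF less.prems] by simp
  qed
  have "(\<Sum>j=4..n. c j * b j 2) = 0" using ck by (intro sum.neutral) auto
  then have "c 2 * (l * l) = 0"
    using z[of 2] c1 c3 unfolding L4_comb_apply sum_split4 by (simp add: b_simps E_apply)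
  then have c2: "c 2 = 0" using l0 by simp
  consider "i = 1" | "i = 2" | "i = 3" | "4 \<le> i" using assms by fastforce
  then show ?thesis using c1 c2 c3 ck assms by cases auto
qed

lemma comb_inj:
  assumes "comb c = comb d" "c \<in> coord_space n" "d \<in> coord_space n"
  shows "c = d"
proof
  fix i
  have "comb (c - d) = 0" using assms by (simp add: L4_comb_linear)
  then have "(c - d) i = 0" if "1 \<le> i" "i \<le> n" using comb_eq_0 that by blast
  then show "c i = d i" using assms(2,3) by (cases "1 \<le> i \<and> i \<le> n") (auto simp: coord_space_def)
qed

text \<open>The new vectors satisfy the defining table: \<open>X\<close> and \<open>Y\<close> have
  the same square, \<open>Y\<close> annihilates the later \<open>b k\<close>, and right
  multiplication by \<open>X\<close> is the shift by construction.\<close>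

lemma nu_b:
  assumes ij: "1 \<le> i" "i \<le> n" "1 \<le> j" "j \<le> n"
  shows "nu n (b i) (b j) = comb (L4 n i j)"
proof -
  note E = L4_comb_E[of _ n X Y]
  have b2: "nu n (b 2) v = 0" "nu n v (b 2) = 0" for v by (simp_all add: b_simps nu_E2)
  have t: "b k 1 = 0" "b k 3 = 0" if "4 \<le> k" "k \<le> n" for k using b_triangular that by blast+
  have bn: "nu n (b k) v = 0" "nu n v (b k) = 0" if "4 \<le> k" "k \<le> n" "k = n \<or> v 1 = 0" for v k
  proof -
    have "b k (j - 1) * v 1 = 0" if "5 \<le> j" "j \<le> n" for j
      using b_triangular[of k] \<open>4 \<le> k\<close> \<open>k \<le> n\<close> \<open>k = n \<or> v 1 = 0\<close> that by auto
    then show "nu n (b k) v = 0" "nu n v (b k) = 0"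
      using t that by (auto simp: nu_def fun_eq_iff mult.commute)
  qed
  have bY: "nu n (b k) Y = 0" "nu n Y (b k) = 0" if "4 \<le> k" "k \<le> n" for k
  proof -
    have "k = n \<or> Y 1 = 0" using Y1 that by auto
    then show "nu n (b k) Y = 0" "nu n Y (b k) = 0" using bn that by blast+
  qed
  have Xb: "nu n X (b k) = - nu n (b k) X" if "4 \<le> k" "k \<le> n" for k
    using t that by (auto simp: nu_def fun_eq_iff)
  \<comment> \<open>The sum of [X, Y] and [Y, X] is twice the product of the values of
    \<open>l\<close>, that is 2 l * l, times e_2; this is the origin of the 2 in
    \<open>2 *c b 2\<close>.\<close>
  have XY: "nu n X Y = 2 *c b 2 - b 4"
  proof -
    have "(X 1 + X 3) * (Y 1 + Y 3) = l * l" by (simp add: lX lY)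
    then have "X 1 * Y 1 + 2 * (X 1 * Y 3) + X 3 * Y 3 = 2 * (l * l) - (Y 1 * X 1 + 2 * (Y 1 * X 3) + Y 3 * X 3)"
      by algebra
    then show ?thesis
      unfolding b_simps by (auto simp: nu_def fun_eq_iff E_apply)
  qed
  have YY: "nu n Y Y = b 2"
    using n_ge_4 unfolding b_simps by (auto simp: nu_def fun_eq_iff E_apply lY[symmetric] algebra_simps)
  have XX: "nu n X X = b 2" by (simp add: L4_basis_def)
  have YX: "nu n Y X = b 4" by (simp add: b_simps)
  have last: "\<not> n \<le> n - 1" "3 \<le> n - 1" using n_ge_4 by linarith+
  consider "i = 1" | "i = 2" | "i = 3" | "4 \<le> i" using ij by fastforce
  then show ?thesis
  proof cases
    case 1
    consider "j = 1" | "j = 2" | "j = 3" | "4 \<le> j" "j < n" | "4 \<le> j" "j = n" using ij by fastforce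
    then show ?thesis
    proof cases
      case 4
      then have "nu n X (b j) = - b (j + 1)" using Xb[of j] b_simps(5)[of j] by simp
      moreover have "j \<le> n - 1" using 4 by simp
      ultimately show ?thesis using 1 4 by (simp add: L4_def L4_comb_linear E b_simps(1))
    next
      case 5
      then show ?thesis using 1 last bn(2)[of n X] by (simp add: L4_def L4_comb_linear b_simps(1))
    qed (use 1 n_ge_4 in \<open>simp_all add: L4_def L4_comb_linear E XX XY b2 b_simps(1,3)\<close>)
  next
    case 2
    then show ?thesis by (simp add: L4_def L4_comb_linear b2)
  next
    case 3
    consider "j = 1" | "j = 2" | "j = 3" | "4 \<le> j" using ij by fastforce
    then show ?thesis
      by cases (use 3 last ij bY in \<open>simp_all add: L4_def L4_comb_linear E YX YY b2 b_simps(1,3)\<close>)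
  next
    case 4
    consider "j = 1" "i < n" | "j = 1" "i = n" | "j = 2" | "j = 3" | "4 \<le> j" using ij 4 by fastforce
    then show ?thesis
    proof cases
      case 1
      then have "i \<le> n - 1" by simp
      then show ?thesis using 1 4 b_simps(5)[of i] by (simp add: L4_def L4_comb_linear E b_simps(1))
    next
      case 2
      then show ?thesis using 4 last bn(1)[of n X] by (simp add: L4_def L4_comb_linear b_simps(1))
    next
      case 3
      then show ?thesis using 4 b2 by (simp add: L4_def L4_comb_linear)
    next
      case (4)
      then show ?thesis using \<open>4 \<le> i\<close> ij bY by (simp add: L4_def L4_comb_linear b_simps(3))
    next
      case 5
      then show ?thesis using \<open>4 \<le> i\<close> ij bn(1)[of i "b j"] t by (simp add: L4_def L4_comb_linear)
    qed
  qed
qed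

end

context L4_extension
begin

text \<open>New generators of \<open>N\<close> together with a new last vector again give an
  extension in table form, so normalization steps can be composed. The new data are described
  through \<open>L4_comb\<close>, which leaves their coordinates to be solved for by each
  application.\<close>

lemma change_of_basis:
  assumes "L4_generators n X Y l" and x: "x \<in> K" "x (n + 1) \<noteq> 0"
  obtains R' S' s' where "L4_extension n R' S' s'"
    "algebra_isomorphic vscale K br vscale K (table_bracket (n + 1) (extend_L4 n R' S' s'))"
    "\<And>i. 1 \<le> i \<Longrightarrow> i \<le> n \<Longrightarrow> L4_comb n X Y (R' i) = br (L4_basis n X Y i) x"
    "\<And>i. 1 \<le> i \<Longrightarrow> i \<le> n \<Longrightarrow> L4_comb n X Y (S' i) = br x (L4_basis n X Y i)"
    "L4_comb n X Y s' = br x x"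
proof -
  interpret G: L4_generators n X Y l by fact
  define b where "b i = (if i = n + 1 then x else G.b i)" for i
  have bK: "b i \<in> K" if "i \<in> {1..n+1}" for i
    using that x G.b_in_N[of i] N_sub_K by (auto simp: b_def)
  have sum_b: "(\<Sum>i=1..n+1. c i *c b i) = G.comb c + c (n + 1) *c x" for c
  proof -
    have "(\<Sum>i=1..n+1. c i *c b i) = (\<Sum>i=1..n. c i *c b i) + c (n + 1) *c b (n + 1)"
      unfolding Suc_eq_plus1[symmetric] by (simp del: sum_fun_apply)
    also have "(\<Sum>i=1..n. c i *c b i) = G.comb c"
      unfolding L4_comb_def by (intro sum.cong) (auto simp: b_def)
    also have "b (n + 1) = x" by (simp add: b_def)
    finally show ?thesis .
  qed
  have indep: "\<forall>i\<in>{1..n+1}. c i = 0" if c: "(\<Sum>i=1..n+1. c i *c b i) = 0" for c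
  proof -
    have "(G.comb c + c (n + 1) *c x) (n + 1) = 0" using c unfolding sum_b by simp
    then have T: "c (n + 1) = 0" using x N_last[OF G.comb_in_N] by simp
    then have "G.comb c = 0" using c unfolding sum_b by simp
    then show ?thesis using G.comb_eq_0 T by (metis Suc_eq_plus1 atLeastAtMost_iff le_SucE)
  qed
  have bij: "bij_betw (\<lambda>c. \<Sum>i=1..n+1. c i *c b i) K K"
    by (rule alg.bij_betw_coordinates[OF bK indep dim_coord_space])
  have coords: "\<exists>r\<in>N. v = G.comb r" if v: "v \<in> N" for v
  proof -
    obtain c where c: "c \<in> K" "v = (\<Sum>i=1..n+1. c i *c b i)"
      using bij v N_sub_K unfolding bij_betw_def by blast
    have "(G.comb c + c (n + 1) *c x) (n + 1) = 0" using N_last[OF v] c(2) unfolding sum_b by simp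
    then have T: "c (n + 1) = 0" using x N_last[OF G.comb_in_N] by simp
    then have "v = G.comb c" using c(2) unfolding sum_b by simp
    then show ?thesis using c(1) T N_eq by blast
  qed
  have "\<exists>R'. \<forall>i\<in>{1..n}. R' i \<in> N \<and> br (b i) x = G.comb (R' i)"
    using coords[OF br_in_N] by (intro bchoice) blast
  then obtain R' where R': "\<And>i. i \<in> {1..n} \<Longrightarrow> R' i \<in> N" "\<And>i. i \<in> {1..n} \<Longrightarrow> br (b i) x = G.comb (R' i)" by blast
  have "\<exists>S'. \<forall>i\<in>{1..n}. S' i \<in> N \<and> br x (b i) = G.comb (S' i)"
    using coords[OF br_in_N] by (intro bchoice) blast
  then obtain S' where S': "\<And>i. i \<in> {1..n} \<Longrightarrow> S' i \<in> N" "\<And>i. i \<in> {1..n} \<Longrightarrow> br x (b i) = G.comb (S' i)" by blast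
  obtain s' where s': "s' \<in> N" "br x x = G.comb s'" using coords[OF br_in_N] by blast
  let ?t = "extend_L4 n R' S' s'"
  have tn: "?t i j \<in> N" if "i \<in> {1..n+1}" "j \<in> {1..n+1}" for i j
    using extend_L4_in_coord_space[OF n4] R'(1) S'(1) s'(1) that by simp
  then have t: "?t i j \<in> K" if "i \<in> {1..n+1}" "j \<in> {1..n+1}" for i j
    using N_sub_K that by auto
  have br_b: "br (b i) (b j) = (\<Sum>k=1..n+1. ?t i j k *c b k)" if ij: "i \<in> {1..n+1}" "j \<in> {1..n+1}" for i j
  proof -
    have "(\<Sum>k=1..n+1. ?t i j k *c b k) = G.comb (?t i j)"
      unfolding sum_b N_last[OF tn[OF ij]] by simp
    also have "\<dots> = br (b i) (b j)"
    proof (cases "i = n + 1 \<or> j = n + 1")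
      case True
      then show ?thesis using ij R'(2) S'(2) s'(2) by (auto simp: extend_L4_def b_def)
    next
      case False
      then have ij': "i \<in> {1..n}" "j \<in> {1..n}" using ij by auto
      then have "br (b i) (b j) = nu n (G.b i) (G.b j)"
        using False by (simp add: b_def br_N G.b_in_N)
      then show ?thesis using False ij' G.nu_b[of i j] by (simp add: extend_L4_def)
    qed
    finally show ?thesis by simp
  qed
  have iso: "algebra_isomorphic vscale K br vscale K (table_bracket (n + 1) ?t)"
    by (rule alg.basis_isomorphism[OF bK indep dim_coord_space t br_b])
  have "right_leibniz_algebra vscale K (table_bracket (n + 1) ?t)"
    by (rule right_leibniz_algebra_transfer[OF leibniz_ext fd_complex_algebra_table[OF t] iso])
  then have "L4_extension n R' S' s'"
    using n4 R'(1) S'(1) s'(1) by (intro L4_extension.intro) auto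
  then show ?thesis
    by (rule that[OF _ iso]) (use R'(2) S'(2) s'(2) in \<open>auto simp: b_def\<close>)
qed

end

section \<open>Structure forced by the Leibniz identity\<close>

lemma lin_cong: "(\<And>i. 1 \<le> i \<Longrightarrow> i \<le> n \<Longrightarrow> R i = R' i) \<Longrightarrow> lin n R x = lin n R' x"
  unfolding lin_def by (intro sum.cong) auto

context L4_extension
begin

lemma br_last_right: "v \<in> N \<Longrightarrow> br v (E (n + 1)) = D v"
  and br_last_left: "v \<in> N \<Longrightarrow> br (E (n + 1)) v = L v"
  and br_last_last: "br (E (n + 1)) (E (n + 1)) = s"
proof -
  have nu0: "nu n v (E (n + 1)) = 0" "nu n (E (n + 1)) v = 0" for v
    using n4 by (auto simp: nu_def E_apply fun_eq_iff)
  have lin0: "lin n T (E (n + 1)) = 0" for T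
    unfolding lin_def by (intro sum.neutral) (auto simp: E_apply)
  show "v \<in> N \<Longrightarrow> br v (E (n + 1)) = D v" "v \<in> N \<Longrightarrow> br (E (n + 1)) v = L v"
    "br (E (n + 1)) (E (n + 1)) = s"
    unfolding br_eq nu0 lin0 by (simp_all add: N_last E_apply fun_eq_iff)
qed

lemmas br_last = br_last_right br_last_left br_last_last

lemma E_last_in_K: "E (n + 1) \<in> K"
  by (rule E_in_coord_space) auto

text \<open>This and the next six facts are the Leibniz identity with the last basis vector placed
  in each of the seven nonempty sets of argument positions.\<close>

lemma derivation: "x \<in> N \<Longrightarrow> y \<in> N \<Longrightarrow> D (nu n x y) = nu n (D x) y + nu n x (D y)"
  using alg.leibniz[of x y "E (n + 1)"] N_sub_K E_last_in_K
  by (simp add: br_N br_last D_in nu_in_coord_space n4 subset_iff)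

lemma L_nu: "y \<in> N \<Longrightarrow> z \<in> N \<Longrightarrow> L (nu n y z) = nu n (L y) z - nu n (L z) y"
  using alg.leibniz[of "E (n + 1)" y z] N_sub_K E_last_in_K
  by (simp add: br_N br_last L_in nu_in_coord_space n4 subset_iff)

lemma D_L: "y \<in> N \<Longrightarrow> D (L y) = nu n s y + L (D y)"
  using alg.leibniz[of "E (n + 1)" y "E (n + 1)"] N_sub_K E_last_in_K
  by (simp add: br_N br_last L_in D_in s_in subset_iff)

lemma L_Q: "y \<in> N \<Longrightarrow> L (D y + L y) = 0"
  using alg.leibniz[of "E (n + 1)" "E (n + 1)" y] N_sub_K E_last_in_K
  by (simp add: br_N br_last L_in D_in s_in subset_iff D_L lin_add)

lemma nu_Q: "y \<in> N \<Longrightarrow> v \<in> N \<Longrightarrow> nu n y (D v + L v) = 0"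
  using alg.leibniz[of y "E (n + 1)" v] N_sub_K E_last_in_K
  by (simp add: br_N br_last L_in D_in nu_in_coord_space n4 subset_iff derivation nu_add_right add.assoc)

lemma nu_s: "y \<in> N \<Longrightarrow> nu n y s = 0"
  using alg.leibniz[of y "E (n + 1)" "E (n + 1)"] N_sub_K E_last_in_K
  by (simp add: br_N br_last s_in D_in subset_iff)

lemma L_s: "L s = 0"
  using alg.leibniz[of "E (n + 1)" "E (n + 1)" "E (n + 1)"] E_last_in_K
  by (simp add: br_last s_in)

text \<open>Testing against e_1 reads off \<open>t 3\<close> in coordinate 4, then
  \<open>t 1\<close> in coordinate 2, and \<open>t i\<close> in coordinate i + 1 for the remaining i
  below \<open>n\<close>.\<close>

lemma right_annihilator:
  assumes t: "t \<in> N" "\<And>y. y \<in> N \<Longrightarrow> nu n y t = 0"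
  shows "t = t 2 *c E 2 + t n *c E n"
proof
  fix i
  have z: "nu n (E 1) t k = 0" for k using t(2)[OF E_in_N[of 1]] n4 by simp
  have t3: "t 3 = 0" using z[of 4] by (simp add: nu_def E_apply)
  have t1: "t 1 = 0" using z[of 2] t3 by (simp add: nu_def E_apply)
  have tk: "t i = 0" if "4 \<le> i" "i < n" using z[of "i + 1"] that by (simp add: nu_def E_apply)
  have "t i = 0" if "i = 0 \<or> i > n" using t(1) that by (auto simp: coord_space_def)
  moreover have "i = 0 \<or> i > n \<or> i = 1 \<or> i = 2 \<or> i = 3 \<or> (4 \<le> i \<and> i < n) \<or> i = n" by linarith
  ultimately show "t i = (t 2 *c E 2 + t n *c E n) i"
    using t3 t1 tk n4 by (auto simp: E_apply)
qed

lemma nu_span_zero: "nu n v (p *c E 2 + q *c E n) = 0" "nu n (p *c E 2 + q *c E n) v = 0"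
  by (simp_all add: nu_add_left nu_add_right nu_E2 nu_En n4)

text \<open>D v + L v is a combination of e_2 and e_n, which annihilate \<open>N\<close> from both
  sides; hence \<open>L v\<close> may be replaced by - \<open>D v\<close> inside \<open>nu\<close>,
  and adding the derivation rules for \<open>D\<close> and \<open>L\<close> leaves the stated
  terms.\<close>

lemma Q_nu:
  assumes "y \<in> N" "z \<in> N"
  shows "D (nu n y z) + L (nu n y z) = nu n y (D z) + nu n (D z) y"
proof -
  have QN: "D v + L v \<in> N" for v
    by (intro cvec.subspace_add[OF subspace_coord_space] D_in L_in)
  have "nu n (D v + L v) w = 0" if "v \<in> N" for v w
    using right_annihilator[OF QN nu_Q[OF _ that]] nu_span_zero(2) by metis
  then have "nu n (L v) w = - nu n (D v) w" if "v \<in> N" for v w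
    using that by (simp add: nu_add_left eq_neg_iff_add_eq_0 add.commute)
  then show ?thesis using assms by (simp add: derivation L_nu)
qed

text \<open>Derivations agreeing on e_1 and e_3 agree everywhere. The values of D + L on products
  are forced by \<open>Q_nu\<close>; on e_1 and e_3 they are combinations of e_2 and e_n, and the
  main work is to exclude the components \<open>q'\<close> and \<open>r'\<close> along e_n.\<close>

lemma determined_by_generators:
  assumes \<kappa>: "\<kappa> = 0 \<or> n = 4"
    and R1: "R 1 = model_R n a \<mu> \<kappa> c \<beta> \<eta> 1" and R3: "R 3 = model_R n a \<mu> \<kappa> c \<beta> \<eta> 3"
    and nondeg: "a \<noteq> 0 \<or> \<mu> \<noteq> \<kappa>"
  defines "q \<equiv> R 1 2 + S 1 2" and "r \<equiv> R 3 2 + S 3 2"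
  shows "\<And>i. 1 \<le> i \<Longrightarrow> i \<le> n \<Longrightarrow> R i = model_R n a \<mu> \<kappa> c \<beta> \<eta> i"
    and "\<And>i. 1 \<le> i \<Longrightarrow> i \<le> n \<Longrightarrow> S i = model_Q a q r i - model_R n a \<mu> \<kappa> c \<beta> \<eta> i"
    and "s = s 2 *c E 2 + s n *c E n"
    and "model_admissible n a \<mu> \<kappa> \<beta> \<eta> q r (s n)"
proof -
  let ?M = "model_R n a \<mu> \<kappa> c \<beta> \<eta>"
  note EN = E_in_N
  have E13: "E 1 \<in> N" "E 3 \<in> N" using n4 by (auto intro!: EN)
  have linE: "lin n T (E i) = T i" if "1 \<le> i" "i \<le> n" for T i by (rule lin_E[OF that])
  have Mder: "lin n ?M (nu n x y) = nu n (lin n ?M x) y + nu n x (lin n ?M y)" for x y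
    by (rule model_derivation[OF n4 \<kappa>])
  have deriv_step: "R j = ?M j" if "E j = nu n (E i) (E 1)" "1 \<le> i" "i \<le> n" "1 \<le> j" "j \<le> n" "R i = ?M i" for i j
  proof -
    have "R j = D (nu n (E i) (E 1))" unfolding that(1)[symmetric] using linE that(4,5) by simp
    also have "\<dots> = nu n (R i) (E 1) + nu n (E i) (R 1)"
      using derivation[OF EN[of i] E13(1)] that n4 by (simp add: linE)
    also have "\<dots> = nu n (lin n ?M (E i)) (E 1) + nu n (E i) (lin n ?M (E 1))"
      using that n4 R1 by (simp add: linE)
    also have "\<dots> = lin n ?M (E j)" unfolding Mder[symmetric] that(1) ..
    finally show ?thesis using linE that(4,5) by simp
  qed
  have R2: "R 2 = ?M 2" using deriv_step[of 2 1] nu_E_E(1) R1 n4 by simp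
  have R4: "R 4 = ?M 4" using deriv_step[of 4 3] nu_E_E(2) R3 n4 by simp
  have Rk: "R k = ?M k" if "4 \<le> k" "k \<le> n" for k
    using that
  proof (induction k rule: dec_induct)
    case (step k)
    then show ?case using deriv_step[of "Suc k" k] nu_E_E(3)[of k]
      unfolding Suc_eq_plus1 by simp
  qed (rule R4)
  show R: "R i = ?M i" if i: "1 \<le> i" "i \<le> n" for i
  proof -
    consider "i = 1" | "i = 2" | "i = 3" | "4 \<le> i" using i by fastforce
    then show ?thesis using R1 R2 R3 Rk i by cases auto
  qed
  have D: "D x = lin n ?M x" for x by (rule lin_cong[OF R])
  define Q where "Q i = R i + S i" for i
  have linQ: "lin n Q x = D x + L x" for x
    by (simp add: lin_def Q_def fun_eq_iff algebra_simps sum.distrib)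
  have QN: "lin n Q v \<in> N" for v
    unfolding linQ by (intro cvec.subspace_add[OF subspace_coord_space] D_in L_in)
  have Qform: "Q i = Q i 2 *c E 2 + Q i n *c E n" if "1 \<le> i" "i \<le> n" for i
  proof -
    have "lin n Q (E i) = lin n Q (E i) 2 *c E 2 + lin n Q (E i) n *c E n"
      using nu_Q[OF _ EN[OF that]] by (intro right_annihilator[OF QN]) (simp only: linQ)
    then show ?thesis unfolding linE[OF that] .
  qed
  have R1': "R 1 1 = \<mu>" "R 1 3 = a - \<mu>" by (simp_all add: R1 model_R_apply[OF n4])
  have Qnu: "lin n Q (nu n (E i) (E 1)) = nu n (E i) (R 1) + nu n (R 1) (E i)" if "1 \<le> i" "i \<le> n" for i
    using Q_nu[OF EN[OF that] E13(1)] n4 by (simp add: linQ linE)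
  have Q2: "Q 2 = (2 * a) *c E 2"
  proof -
    have "Q 2 = nu n (E 1) (R 1) + nu n (R 1) (E 1)"
      using Qnu[of 1] n4 by (simp add: nu_E_E linE)
    also have "\<dots> = (2 * a) *c E 2"
      using R1' n4 by (auto simp: nu_def E_apply fun_eq_iff)
    finally show ?thesis .
  qed
  have Q4: "Q 4 = (2 * a) *c E 2"
  proof -
    have "Q 4 = nu n (E 3) (R 1) + nu n (R 1) (E 3)"
      using Qnu[of 3] n4 by (simp add: nu_E_E linE)
    also have "\<dots> = (2 * a) *c E 2"
      using R1' n4 by (auto simp: nu_def E_apply fun_eq_iff)
    finally show ?thesis .
  qed
  have Qk: "Q k = 0" if "5 \<le> k" "k \<le> n" for k
  proof -
    have "Q k = nu n (E (k - 1)) (R 1) + nu n (R 1) (E (k - 1))"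
      using Qnu[of "k - 1"] nu_E_E(3)[of "k - 1"] that by (simp add: linE)
    also have "\<dots> = 0"
      using that by (auto simp: nu_def E_apply fun_eq_iff)
    finally show ?thesis .
  qed
  define q' where "q' = Q 1 n"
  define r' where "r' = Q 3 n"
  have Q1: "Q 1 = q *c E 2 + q' *c E n" and Q3: "Q 3 = r *c E 2 + r' *c E n"
  proof -
    have qr: "q = Q 1 2" "r = Q 3 2" by (simp_all add: q_def r_def Q_def)
    show "Q 1 = q *c E 2 + q' *c E n" "Q 3 = r *c E 2 + r' *c E n"
      unfolding qr q'_def r'_def using n4 by (intro Qform; simp)+
  qed
  have linQ_eq: "lin n Q x = lin n (model_Q a q r) x + (q' * x 1 + r' * x 3) *c E n" for x
  proof
    fix k
    have Qi: "Q i k = model_Q a q r i k + (if i = 1 then q' * E n k else 0) + (if i = 3 then r' * E n k else 0)"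
      if i: "1 \<le> i" "i \<le> n" for i
    proof -
      consider "i = 1" | "i = 2" | "i = 3" | "i = 4" | "5 \<le> i" using i by fastforce
      then show ?thesis using i
        by cases (simp_all add: Q1 Q2 Q3 Q4 Qk model_Q_def)
    qed
    have "lin n Q x k = (\<Sum>i=1..n. x i * model_Q a q r i k + (if i = 1 then x i * (q' * E n k) else 0)
        + (if i = 3 then x i * (r' * E n k) else 0))"
      unfolding lin_def sum_fun_apply by (intro sum.cong refl) (simp add: Qi distrib_left)
    also have "\<dots> = lin n (model_Q a q r) x k + x 1 * (q' * E n k) + x 3 * (r' * E n k)"
      unfolding sum.distrib using n4 by (simp add: lin_def)
    finally show "lin n Q x k = (lin n (model_Q a q r) x + (q' * x 1 + r' * x 3) *c E n) k"
      by (simp add: algebra_simps)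
  qed
  have s_form: "s = s 2 *c E 2 + s n *c E n"
    by (rule right_annihilator[OF s_in nu_s])
  then show "s = s 2 *c E 2 + s n *c E n" .
  have nus: "nu n s y = 0" for y using s_form nu_span_zero(2) by metis
  have QD: "lin n Q (D v) = D (lin n Q v)" and QQ: "lin n Q (lin n Q v) = D (lin n Q v)" if "v \<in> N" for v
    using D_L[OF that] L_Q[OF that] nus by (simp_all add: linQ lin_add)
  \<comment> \<open>The diagonal entry of \<open>D\<close> at e_n.\<close>
  define \<theta> where "\<theta> = a - \<kappa> + (of_nat n - 3) * \<mu>"
  have Q_n: "lin n Q x n = q' * x 1 + r' * x 3" for x
    using n4 by (simp add: linQ_eq lin_model_Q E_apply)
  have Q_2: "lin n Q x 2 = q * x 1 + 2 * a * x 2 + r * x 3 + 2 * a * x 4" for x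
    using n4 by (simp add: linQ_eq lin_model_Q E_apply)
  have conv0: "conv c (p *c E 2 + p' *c E n) n = 0" for p p'
    unfolding conv_def using n4 by (intro sum.neutral) (auto simp: E_apply)
  have D_n: "D (p *c E 2 + p' *c E n) n = \<theta> * p'" for p p'
    using n4 unfolding D lin_model_R[OF n4] conv0 by (simp add: E_apply \<theta>_def)
  have QE: "lin n Q (E 1) = Q 1" "lin n Q (E 3) = Q 3" using linE n4 by auto
  have DE: "D (E 1) = R 1" "D (E 3) = R 3" using linE n4 by auto
  have R3': "R 3 1 = \<kappa>" "R 3 3 = a - \<kappa>" by (simp_all add: R3 model_R_apply[OF n4])
  have e1: "q' * \<mu> + r' * (a - \<mu>) = \<theta> * q'" "\<theta> * q' = 0"
  proof -
    show "q' * \<mu> + r' * (a - \<mu>) = \<theta> * q'"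
      using fun_cong[OF QD[OF E13(1)], of n] unfolding QE DE Q_n Q1 D_n R1' .
    have "q' * Q 1 1 + r' * Q 1 3 = \<theta> * q'"
      using fun_cong[OF QQ[OF E13(1)], of n] unfolding QE Q_n unfolding Q1 D_n .
    then show "\<theta> * q' = 0" using n4 by (simp add: Q1 E_apply)
  qed
  have e3: "q' * \<kappa> + r' * (a - \<kappa>) = \<theta> * r'" "\<theta> * r' = 0"
  proof -
    show "q' * \<kappa> + r' * (a - \<kappa>) = \<theta> * r'"
      using fun_cong[OF QD[OF E13(2)], of n] unfolding QE DE Q_n Q3 D_n R3' .
    have "q' * Q 3 1 + r' * Q 3 3 = \<theta> * r'"
      using fun_cong[OF QQ[OF E13(2)], of n] unfolding QE Q_n unfolding Q3 D_n .
    then show "\<theta> * r' = 0" using n4 by (simp add: Q3 E_apply)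
  qed
  \<comment> \<open>The row (q', r') is a left eigenvector for \<theta> of the matrix of
    \<open>D\<close> on e_1, e_3, and is killed by \<theta>. If \<theta> = 0, the eigenvalues
    \<open>a\<close> and \<mu> - \<kappa> of this matrix are nonzero multiples of each other, so
    \<open>nondeg\<close> makes the matrix invertible.\<close>
  have z: "q' = 0 \<and> r' = 0"
  proof (cases "\<theta> = 0")
    case False
    then show ?thesis using e1 e3 by simp
  next
    case True
    have f1: "q' * \<mu> + r' * (a - \<mu>) = 0" and f3: "q' * \<kappa> + r' * (a - \<kappa>) = 0"
      using e1 e3 by simp_all
    have g: "(q' - r') * (\<mu> - \<kappa>) = 0" using f1 f3 by algebra
    show ?thesis
    proof (cases "n = 4")
      case True
      have \<theta>': "a - \<kappa> + \<mu> = 0" using \<open>\<theta> = 0\<close> True by (simp add: \<theta>_def)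
      then have "\<mu> \<noteq> \<kappa>" using nondeg by auto
      then have "q' = r'" using g by simp
      then have "r' * a = 0" using f1 by (simp add: algebra_simps)
      moreover have "a = \<kappa> - \<mu>" using \<theta>' by algebra
      ultimately show ?thesis using \<open>\<mu> \<noteq> \<kappa>\<close> \<open>q' = r'\<close> by simp
    next
      case False
      then have \<kappa>0: "\<kappa> = 0" using \<kappa> by simp
      have \<theta>': "a = - ((of_nat n - 3) * \<mu>)" using \<open>\<theta> = 0\<close> \<kappa>0 by (simp add: \<theta>_def eq_neg_iff_add_eq_0)
      have "\<mu> \<noteq> 0"
      proof
        assume "\<mu> = 0"
        then have "a = 0" using \<theta>' by simp
        then show False using nondeg \<open>\<mu> = 0\<close> \<kappa>0 by simp
      qed
      have "of_nat n \<noteq> (of_nat 3 :: complex)" using n4 unfolding of_nat_eq_iff by simp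
      then have n3: "(of_nat n :: complex) - 3 \<noteq> 0" by simp
      have "a \<noteq> 0" unfolding \<theta>' using n3 \<open>\<mu> \<noteq> 0\<close> by simp
      then have "r' = 0" using f3 \<kappa>0 by simp
      then show ?thesis using f1 \<open>\<mu> \<noteq> 0\<close> by simp
    qed
  qed
  then have linQ_eq': "lin n Q x = lin n (model_Q a q r) x" for x using linQ_eq by simp
  show "S i = model_Q a q r i - ?M i" if "1 \<le> i" "i \<le> n" for i
  proof -
    have "Q i = model_Q a q r i" using linQ_eq'[of "E i"] linE[OF that] by simp
    then show ?thesis using R[OF that] by (simp add: Q_def algebra_simps)
  qed
  have D_2: "D (p *c E 2) 2 = 2 * a * p" for p
    using n4 unfolding D lin_model_R[OF n4] by (simp add: E_apply)
  have Q13: "Q 1 = q *c E 2" "Q 3 = r *c E 2" using Q1 Q3 z by simp_all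
  have R12: "R 1 2 = \<beta>" "R 1 4 = 0" "R 3 2 = \<eta>" "R 3 4 = 0"
    by (simp_all add: R1 R3 model_R_apply[OF n4])
  have "q * \<mu> + 2 * a * \<beta> + r * (a - \<mu>) = 2 * a * q"
    using fun_cong[OF QD[OF E13(1)], of 2] unfolding QE DE Q_2 Q13 D_2 R1' R12 by simp
  moreover have "q * \<kappa> + 2 * a * \<eta> + r * (a - \<kappa>) = 2 * a * r"
    using fun_cong[OF QD[OF E13(2)], of 2] unfolding QE DE Q_2 Q13 D_2 R3' R12 by simp
  moreover have "s n * \<theta> = 0"
  proof -
    have "lin n Q s n = 0" by (simp add: Q_n z)
    then have "D s n = 0" using L_s by (simp add: linQ)
    moreover have "D s n = \<theta> * s n"
      by (subst s_form) (rule D_n)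
    ultimately show ?thesis by auto
  qed
  ultimately show "model_admissible n a \<mu> \<kappa> \<beta> \<eta> q r (s n)"
    unfolding model_admissible_def using \<kappa> unfolding \<theta>_def by (simp only: ac_simps)
qed

lemma table_eq_model:
  assumes "\<kappa> = 0 \<or> n = 4"
    and "R 1 = model_R n a \<mu> \<kappa> c \<beta> \<eta> 1" and "R 3 = model_R n a \<mu> \<kappa> c \<beta> \<eta> 3"
    and "a \<noteq> 0 \<or> \<mu> \<noteq> \<kappa>"
  shows "br = table_bracket (n + 1) (model n a \<mu> \<kappa> c \<beta> \<eta> (R 1 2 + S 1 2) (R 3 2 + S 3 2) (s 2) (s n))"
  by (rule table_bracket_eq_model) (rule determined_by_generators[OF assms]; assumption)+

end

section \<open>Normalizing the action of the last basis vector\<close>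

lemma lin_zero: "lin n R 0 = 0"
  using lin_scale[of n R 0 0] by simp

context L4_extension
begin

lemma D_E: "1 \<le> i \<Longrightarrow> i \<le> n \<Longrightarrow> D (E i) = R i"
  by (rule lin_E)

lemma E13_in_N: "E 1 \<in> N" "E 3 \<in> N"
  using n4 by (auto intro!: E_in_N)

text \<open>Apply \<open>D\<close> to the equality of the squares of e_1 and e_3 and compare
  coefficients of e_2: they are twice the values of \<open>l\<close> on \<open>R 1\<close> and
  \<open>R 3\<close>.\<close>

lemma R_relation: "R 1 1 + R 1 3 = R 3 1 + R 3 3"
proof -
  have "nu n (E 3) (E 3) = nu n (E 1) (E 1)"
    by (auto simp: nu_def E_apply fun_eq_iff)
  then have "nu n (R 3) (E 3) + nu n (E 3) (R 3) = nu n (R 1) (E 1) + nu n (E 1) (R 1)"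
    using derivation[OF E13_in_N(1) E13_in_N(1)] derivation[OF E13_in_N(2) E13_in_N(2)] n4 by (simp add: D_E)
  from fun_cong[OF this, of 2, symmetric] have "2 * (R 1 1 + R 1 3) = 2 * (R 3 1 + R 3 3)"
    by (simp add: nu_def E_apply add.commute)
  then show ?thesis unfolding mult_cancel_left by simp
qed

text \<open>For \<open>n > 4\<close>, applying \<open>D\<close> to [e_4, e_3] = 0 and reading
  coordinate 5 isolates the coefficient.\<close>

lemma R31: "R 3 1 = 0 \<or> n = 4"
proof (rule disjCI)
  assume "n \<noteq> 4"
  then have n5: "5 \<le> n" using n4 by simp
  have "nu n (E 4) (E 3) = 0" by (auto simp: nu_def E_apply fun_eq_iff)
  then have "0 = nu n (R 4) (E 3) + nu n (E 4) (R 3)"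
    using derivation[OF E_in_N[of 4] E13_in_N(2)] n4 by (simp add: D_E lin_zero)
  from fun_cong[OF this, of 5] show "R 3 1 = 0" using n5 by (simp add: nu_def E_apply)
qed

lemma R4: "R 4 1 = 0" "R 4 3 = 0" "R 4 2 = R 3 1 + R 1 3" "R 4 4 = R 3 3 + R 1 1"
proof -
  have "R 4 = nu n (R 3) (E 1) + nu n (E 3) (R 1)"
    using derivation[OF E13_in_N(2,1)] n4 by (simp add: nu_E_E D_E)
  then show "R 4 1 = 0" "R 4 3 = 0" "R 4 2 = R 3 1 + R 1 3" "R 4 4 = R 3 3 + R 1 1"
    by (simp_all add: nu_def E_apply)
qed

text \<open>Each step from e_k to its bracket with e_1 adds one diagonal entry \<open>R 1 1\<close>,
  so the diagonal is an arithmetic progression.\<close>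

lemma R_triangular:
  assumes "4 \<le> k" "k \<le> n"
  shows "R k 1 = 0 \<and> R k 3 = 0 \<and> (5 \<le> k \<longrightarrow> R k 2 = 0) \<and> (\<forall>i. 4 \<le> i \<longrightarrow> i < k \<longrightarrow> R k i = 0)
    \<and> R k k = R 3 3 + (of_nat k - 3) * R 1 1"
  using assms
proof (induction k rule: dec_induct)
  case base
  then show ?case using R4 by simp
next
  case (step k)
  then have IH: "R k 1 = 0" "R k 3 = 0" "\<And>i. 4 \<le> i \<Longrightarrow> i < k \<Longrightarrow> R k i = 0" "R k k = R 3 3 + (of_nat k - 3) * R 1 1"
    by auto
  have "R (Suc k) = nu n (R k) (E 1) + nu n (E k) (R 1)"
    using derivation[OF E_in_N[of k] E13_in_N(1)] nu_E_E(3)[of k] step n4 unfolding Suc_eq_plus1 by (simp add: D_E)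
  then have R: "R (Suc k) i = nu n (R k) (E 1) i + nu n (E k) (R 1) i" for i by simp
  have "R (Suc k) i = 0" if "4 \<le> i" "i < Suc k" for i
  proof (cases "i = 4")
    case True
    then show ?thesis unfolding R using step IH by (simp add: nu_def E_apply)
  next
    case False
    have "i - 1 < k" "4 \<le> i - 1" "i - 1 \<noteq> k" using False that step by auto
    then show ?thesis unfolding R using step IH(1,2) IH(3)[of "i - 1"] that by (simp add: nu_def E_apply)
  qed
  moreover have "R (Suc k) (Suc k) = R k k + R 1 1"
    unfolding R using step by (simp add: nu_def E_apply)
  ultimately show ?case
    using step by (simp add: R IH) (simp add: nu_def E_apply IH algebra_simps)
qed

lemma R2_eq: "R 2 = (2 * (R 1 1 + R 1 3)) *c E 2"
proof -
  have "R 2 = nu n (R 1) (E 1) + nu n (E 1) (R 1)"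
    using derivation[OF E13_in_N(1,1)] n4 by (simp add: nu_E_E D_E)
  then show ?thesis by (auto simp: nu_def E_apply fun_eq_iff)
qed

lemma D_apply_1: "D v 1 = R 1 1 * v 1 + R 3 1 * v 3" and D_apply_3: "D v 3 = R 1 3 * v 1 + R 3 3 * v 3"
  and D_apply_2: "D v 2 = R 1 2 * v 1 + R 2 2 * v 2 + R 3 2 * v 3 + R 4 2 * v 4"
proof -
  have D: "D v i = v 1 * R 1 i + v 2 * R 2 i + v 3 * R 3 i + v 4 * R 4 i + (\<Sum>k=5..n. v k * R k i)" for i
  proof -
    have "{1..n} = {1,2,3,4} \<union> {5..n}" using n4 by auto
    then have "(\<Sum>k=1..n. v k * R k i) = (\<Sum>k\<in>{1,2,3,4}. v k * R k i) + (\<Sum>k=5..n. v k * R k i)"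
      by (simp add: sum.union_disjoint)
    then show ?thesis by (simp add: lin_def add.assoc)
  qed
  have z: "(\<Sum>k=5..n. v k * R k i) = 0" if "i = 1 \<or> i = 2 \<or> i = 3" for i
    using R_triangular that by (intro sum.neutral) auto
  have R2: "R 2 1 = 0" "R 2 3 = 0" by (simp_all add: R2_eq E_apply)
  show "D v 1 = R 1 1 * v 1 + R 3 1 * v 3" "D v 3 = R 1 3 * v 1 + R 3 3 * v 3"
    "D v 2 = R 1 2 * v 1 + R 2 2 * v 2 + R 3 2 * v 3 + R 4 2 * v 4"
    unfolding D using z R2 R4 by (simp_all add: mult.commute)
qed

lemma D_apply_ge_4:
  assumes v: "v 1 = 0" "v 3 = 0" and i: "4 \<le> i" "i \<le> n" and low: "\<And>k. 4 \<le> k \<Longrightarrow> k < i \<Longrightarrow> v k = 0"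
  shows "D v i = v i * R i i"
proof -
  have "(\<Sum>k=1..n. v k * R k i) = (\<Sum>k\<in>{i}. v k * R k i)"
  proof (rule sum.mono_neutral_right)
    show "\<forall>k\<in>{1..n} - {i}. v k * R k i = 0"
    proof
      fix k assume k: "k \<in> {1..n} - {i}"
      consider "k = 1 \<or> k = 3" | "k = 2" | "4 \<le> k" "k < i" | "i < k" using k i by fastforce
      then show "v k * R k i = 0"
      proof cases
        case 2
        then show ?thesis using i by (simp add: R2_eq E_apply)
      next
        case 4
        then show ?thesis using R_triangular[of k] k i by auto
      qed (use v low in auto)
    qed
  qed (use i in auto)
  then show ?thesis by (simp add: lin_def)
qed

text \<open>When both eigenvalues on e_1, e_3 vanish, \<open>D\<close> is strictly triangular for a
  suitable chain, so adding the last vector does not destroy nilpotency.\<close>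

lemma nilpotent_if_degenerate:
  assumes a: "R 1 1 + R 1 3 = 0" and \<mu>: "R 1 1 = R 3 1"
  shows "alg.nilpotent K"
\<comment> \<open>The stages are \<open>N\<close>, the kernel of \<open>l\<close> in it, the derived
  algebra of \<open>N\<close>, and from stage 4 on, where e_2 and e_4 disappear together, the spans
  of the remaining e_i.\<close>
proof (rule alg.nilpotent_if_filtration[where m = n and
    F = "\<lambda>k. {v \<in> K. (k \<ge> 1 \<longrightarrow> v \<in> N) \<and> (k \<ge> 2 \<longrightarrow> v 1 + v 3 = 0) \<and> (k \<ge> 3 \<longrightarrow> v 1 = 0 \<and> v 3 = 0)
       \<and> (k \<ge> 4 \<longrightarrow> v 2 = 0 \<and> (\<forall>i<k+1. v i = 0))}"])
  show "cvec.subspace K" by (rule subspace_coord_space)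
  show "{v \<in> K. (n \<ge> 1 \<longrightarrow> v \<in> N) \<and> (n \<ge> 2 \<longrightarrow> v 1 + v 3 = 0) \<and> (n \<ge> 3 \<longrightarrow> v 1 = 0 \<and> v 3 = 0)
       \<and> (n \<ge> 4 \<longrightarrow> v 2 = 0 \<and> (\<forall>i<n+1. v i = 0))} = {0}"
  proof -
    have "v = 0" if v: "v \<in> N" "\<forall>i<n+1. v i = 0" for v
    proof
      fix i show "v i = 0 i" using v by (cases "i < n + 1") (auto simp: coord_space_def)
    qed
    then show ?thesis using n4 cvec.subspace_0[OF subspace_coord_space] by auto
  qed
next
  fix k :: nat
  show "cvec.subspace {v \<in> K. (k \<ge> 1 \<longrightarrow> v \<in> N) \<and> (k \<ge> 2 \<longrightarrow> v 1 + v 3 = 0) \<and> (k \<ge> 3 \<longrightarrow> v 1 = 0 \<and> v 3 = 0)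
       \<and> (k \<ge> 4 \<longrightarrow> v 2 = 0 \<and> (\<forall>i<k+1. v i = 0))}"
    using subspace_coord_space[of "n + 1"] subspace_coord_space[of n]
    by (auto simp: cvec.subspace_def algebra_simps)
      (simp_all add: add.assoc[symmetric] distrib_left[symmetric])
next
  fix k :: nat and v y
  let ?F = "\<lambda>k. {v \<in> K. (k \<ge> 1 \<longrightarrow> v \<in> N) \<and> (k \<ge> 2 \<longrightarrow> v 1 + v 3 = 0) \<and> (k \<ge> 3 \<longrightarrow> v 1 = 0 \<and> v 3 = 0)
       \<and> (k \<ge> 4 \<longrightarrow> v 2 = 0 \<and> (\<forall>i<k+1. v i = 0))}"
  assume v: "v \<in> ?F k" and y: "y \<in> K"
  have R13: "R 1 3 = - R 1 1" "R 3 3 = - R 1 1"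
    using a R_relation \<mu> by (simp_all add: eq_neg_iff_add_eq_0 add.commute)
  have br: "br v y i = nu n v y i + y (n + 1) * D v i" if "1 \<le> k" for i
    using v that by (simp add: br_eq N_last)
  have b1: "br v y 1 + br v y 3 = 0" if "1 \<le> k"
    unfolding br[OF that] by (simp add: nu_def D_apply_1 D_apply_3 R13 \<mu> algebra_simps)
  have b2: "br v y 1 = 0" "br v y 3 = 0" if "2 \<le> k"
  proof -
    have k: "1 \<le> k" and "v 3 = - v 1" using that v by (auto simp: eq_neg_iff_add_eq_0 add.commute)
    then show "br v y 1 = 0" "br v y 3 = 0"
      unfolding br[OF k] by (simp_all add: nu_def D_apply_1 D_apply_3 R13 \<mu> algebra_simps)
  qed
  have b4: "br v y 2 = 0" "\<And>i. i < Suc k + 1 \<Longrightarrow> br v y i = 0" if k: "3 \<le> k"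
  proof -
    have k1: "1 \<le> k" and v13: "v 1 = 0" "v 3 = 0" using k v by auto
    have low: "v i = 0" if "4 \<le> i" "i < k + 1" for i
      using that v by auto
    show 2: "br v y 2 = 0"
      unfolding br[OF k1] using v13 a by (simp add: nu_def D_apply_2 R2_eq R4 R13 \<mu>)
    show "br v y i = 0" if i: "i < Suc k + 1" for i
    proof (cases "4 \<le> i \<and> i \<le> n")
      case True
      \<comment> \<open>Either \<kappa>, here equal to \<open>R 1 1\<close>, is zero, or
        \<open>n = 4\<close> and then i = 4.\<close>
      have "(of_nat i - 4) * R 1 1 = 0"
        using R31 \<mu> True by auto
      moreover have "R i i = (of_nat i - 4) * R 1 1"
        using R_triangular[of i] True by (simp add: R13(2) algebra_simps)
      ultimately have "R i i = 0" by simp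
      then have "D v i = 0"
        using D_apply_ge_4[OF v13, of i] low i True by simp
      moreover have "nu n v y i = 0"
        using v13 low[of "i - 1"] i True by (auto simp: nu_def)
      ultimately show ?thesis unfolding br[OF k1] by simp
    next
      case False
      have "br v y i = 0" if "i > n \<or> i = 0" using br_in_N[of v y] that by (auto simp: coord_space_def)
      moreover have "i = 0 \<or> i = 1 \<or> i = 2 \<or> i = 3 \<or> i > n" using False by linarith
      ultimately show ?thesis using b2 2 k by auto
    qed
  qed
  show "br v y \<in> ?F (Suc k)"
    using b1 b2 b4 br_in_N N_sub_K by auto
qed auto

end

text \<open>Failure of nilpotency is kept instead of a condition on coefficients because it passes
  through isomorphisms; the condition on coefficients is recovered after each change of
  basis.\<close>

locale L4_extension_nonnil = L4_extension +
  assumes nonnil: "\<not> alg.nilpotent K"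
begin

lemma nondegenerate: "R 1 1 + R 1 3 \<noteq> 0 \<or> R 1 1 \<noteq> R 3 1"
  using nilpotent_if_degenerate nonnil by blast

lemma L4_extension_nonnil_transfer:
  assumes "L4_extension n R' S' s'"
    and iso: "algebra_isomorphic vscale K br vscale K (table_bracket (n + 1) (extend_L4 n R' S' s'))"
  shows "L4_extension_nonnil n R' S' s'"
proof -
  interpret B: L4_extension n R' S' s' by fact
  show ?thesis
    using nilpotent_transfer[OF alg.fd_complex_algebra_axioms B.alg.fd_complex_algebra_axioms iso] nonnil
    by unfold_locales blast
qed

section \<open>Normal forms of the action on the generators\<close>

lemma L4_generators_E: "L4_generators n (E 1) (E 3) 1"
  using n4 E13_in_N by unfold_locales (auto simp: E_apply)

lemma L4_basis_E:
  assumes "1 \<le> k" "k \<le> n" shows "L4_basis n (E 1) (E 3) k = E k"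
proof -
  interpret G: L4_generators n "E 1" "E 3" 1 by (rule L4_generators_E)
  have "L4_basis n (E 1) (E 3) k = E k" if "4 \<le> k" "k \<le> n" for k
    using that
  proof (induction k rule: dec_induct)
    case base
    then show ?case by (simp add: G.b_simps nu_E_E)
  next
    case (step k)
    then show ?case using G.b_simps(5)[of k] nu_E_E(3)[of k] unfolding Suc_eq_plus1 by simp
  qed
  moreover have "k = 1 \<or> k = 2 \<or> k = 3 \<or> 4 \<le> k" using assms by linarith
  moreover have "1 *c E 2 = E 2" by (rule cvec.scale_one)
  ultimately show ?thesis using assms G.b_simps(1-3) by auto
qed

lemma L4_comb_E13: "v \<in> N \<Longrightarrow> L4_comb n (E 1) (E 3) v = v"
proof -
  assume v: "v \<in> N"
  have "L4_comb n (E 1) (E 3) v = (\<Sum>k=1..n. v k *c E k)"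
    unfolding L4_comb_def by (intro sum.cong refl) (simp add: L4_basis_E)
  then show ?thesis using sum_coord_E[OF v] by simp
qed

lemma change_of_last:
  assumes x: "x \<in> K" "x (n + 1) \<noteq> 0"
  obtains R' S' s' where "L4_extension_nonnil n R' S' s'"
    "algebra_isomorphic vscale K br vscale K (table_bracket (n + 1) (extend_L4 n R' S' s'))"
    "\<And>i. 1 \<le> i \<Longrightarrow> i \<le> n \<Longrightarrow> R' i = br (E i) x"
proof -
  obtain R' S' s' where B: "L4_extension n R' S' s'"
    "algebra_isomorphic vscale K br vscale K (table_bracket (n + 1) (extend_L4 n R' S' s'))"
    "\<And>i. 1 \<le> i \<Longrightarrow> i \<le> n \<Longrightarrow> L4_comb n (E 1) (E 3) (R' i) = br (L4_basis n (E 1) (E 3) i) x"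
    using change_of_basis[OF L4_generators_E x] by metis
  interpret B: L4_extension n R' S' s' by (rule B(1))
  have "R' i = br (E i) x" if "1 \<le> i" "i \<le> n" for i
    using B(3)[OF that] B.R_in[OF that] L4_basis_E[OF that] by (simp add: L4_comb_E13)
  then show ?thesis
    using that[OF L4_extension_nonnil_transfer[OF B(1,2)] B(2)] by blast
qed

text \<open>The hypothesis \<open>ne\<close> says that the two eigenvalues differ. The value of
  \<open>t\<close> makes \<open>Y\<close> an eigenvector for \<open>a\<close> modulo the derived
  algebra with \<open>l\<close> equal to 1, and \<open>X\<close> is Y + e_1 - e_3, so that
  \<open>l\<close> agrees and the determinant is 1.\<close>

lemma eliminate_\<kappa>:
  assumes n: "n = 4" and ne: "R 1 1 + R 1 3 \<noteq> R 1 1 - R 3 1"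
  obtains R' S' s' where "L4_extension_nonnil n R' S' s'"
    "algebra_isomorphic vscale K br vscale K (table_bracket (n + 1) (extend_L4 n R' S' s'))"
    "R' 3 1 = 0"
proof -
  define a \<mu> \<kappa> where "a = R 1 1 + R 1 3" and "\<mu> = R 1 1" and "\<kappa> = R 3 1"
  have R13: "R 1 1 = \<mu>" "R 1 3 = a - \<mu>" "R 3 1 = \<kappa>" "R 3 3 = a - \<kappa>"
    by (simp_all add: a_def \<mu>_def \<kappa>_def) (simp add: R_relation)
  define t where "t = (a - \<mu>) / (a - (\<mu> - \<kappa>))"
  have t: "t * (a - (\<mu> - \<kappa>)) = a - \<mu>"
    using ne unfolding t_def R13 by simp
  define X where "X = (2 - t) *c E 1 + (t - 1) *c E 3"
  define Y where "Y = (1 - t) *c E 1 + t *c E 3"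
  have XY: "X 1 = 2 - t" "X 3 = t - 1" "Y 1 = 1 - t" "Y 3 = t"
    by (simp_all add: X_def Y_def E_apply)
  have XYN: "X \<in> N" "Y \<in> N"
    unfolding X_def Y_def using E13_in_N
    by (auto intro!: cvec.subspace_add[OF subspace_coord_space] cvec.subspace_scale[OF subspace_coord_space])
  have G: "L4_generators n X Y 1"
    using n XYN by unfold_locales (auto simp: XY algebra_simps)
  interpret G: L4_generators n X Y 1 by (rule G)
  obtain R' S' s' where B: "L4_extension n R' S' s'"
    "algebra_isomorphic vscale K br vscale K (table_bracket (n + 1) (extend_L4 n R' S' s'))"
    "\<And>i. 1 \<le> i \<Longrightarrow> i \<le> n \<Longrightarrow> L4_comb n X Y (R' i) = br (L4_basis n X Y i) (E (n + 1))"
    using change_of_basis[OF G E_last_in_K] E_apply[of "n + 1" "n + 1"] by (metis zero_neq_one)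
  have "G.comb (R' 3) = D Y"
    using B(3)[of 3] n4 by (simp add: G.b_simps br_last XYN)
  then have e: "R' 3 1 * (2 - t) + R' 3 3 * (1 - t) = (1 - t) * \<mu> + t * \<kappa>"
     "R' 3 1 * (t - 1) + R' 3 3 * t = (1 - t) * (a - \<mu>) + t * (a - \<kappa>)"
    using G.comb_1[of "R' 3"] G.comb_3[of "R' 3"] by (simp_all add: XY D_apply_1 D_apply_3 R13 mult.commute)
  have "R' 3 1 = 0" using e t by algebra
  then show ?thesis using that[OF L4_extension_nonnil_transfer[OF B(1,2)] B(2)] by blast
qed

text \<open>The coordinates from 4 on are corrected one at a time. Coordinate 2 is left alone, as
  its pivot would be 2 a - a, which may vanish; this is where \<eta> comes from.\<close>

lemma D_eigenvector:
  assumes \<kappa>: "R 3 1 = 0" and \<mu>: "R 1 1 \<noteq> 0"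
  shows "\<exists>Y\<in>N. \<exists>\<eta>. Y 1 = 0 \<and> Y 3 = 1 \<and> D Y = (R 1 1 + R 1 3) *c Y + \<eta> *c E 2"
proof -
  define a where "a = R 1 1 + R 1 3"
  have R33: "R 3 3 = a" using R_relation \<kappa> by (simp add: a_def)
  have "\<exists>Y\<in>N. Y 1 = 0 \<and> Y 3 = 1 \<and> (\<forall>i. 4 \<le> i \<longrightarrow> i < m \<longrightarrow> D Y i = a * Y i)" if "4 \<le> m" "m \<le> n + 1" for m
    using that
  proof (induction m rule: dec_induct)
    case base
    then show ?case using E13_in_N(2) by (intro bexI[of _ "E 3"]) (auto simp: E_apply)
  next
    case (step m)
    then obtain Y where Y: "Y \<in> N" "Y 1 = 0" "Y 3 = 1" "\<And>i. 4 \<le> i \<Longrightarrow> i < m \<Longrightarrow> D Y i = a * Y i" by auto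
    have m: "4 \<le> m" "m \<le> n" using step by auto
    have "of_nat m \<noteq> (of_nat 3 :: complex)" using m unfolding of_nat_eq_iff by simp
    then have m3: "(of_nat m - 3) * R 1 1 \<noteq> 0" using \<mu> by simp
    \<comment> \<open>The pivot is the difference between the diagonal entry a + (m - 3) *
      \<open>R 1 1\<close> at e_m and the eigenvalue \<open>a\<close>.\<close>
    define c where "c = - (D Y m - a * Y m) / ((of_nat m - 3) * R 1 1)"
    have c: "c * ((of_nat m - 3) * R 1 1) = - (D Y m - a * Y m)"
      unfolding c_def using m3 by simp
    define Y' where "Y' = Y + c *c E m"
    have Y'N: "Y' \<in> N" unfolding Y'_def using Y E_in_N m
      by (intro cvec.subspace_add[OF subspace_coord_space] cvec.subspace_scale[OF subspace_coord_space]) auto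
    have DY': "D Y' i = D Y i + c * R m i" for i
      using m by (simp add: Y'_def lin_add lin_scale D_E)
    have "D Y' i = a * Y' i" if i: "4 \<le> i" "i < Suc m" for i
    proof (cases "i = m")
      case True
      have "R m m = a + (of_nat m - 3) * R 1 1" using R_triangular[OF m] R33 by simp
      then have "D Y' m = D Y m + c * a + c * ((of_nat m - 3) * R 1 1)" by (simp only: DY' distrib_left add.assoc)
      then show ?thesis unfolding True c by (simp add: Y'_def E_apply algebra_simps)
    next
      case False
      then show ?thesis using Y(4)[of i] i R_triangular[OF m] by (simp add: DY') (simp add: Y'_def E_apply)
    qed
    moreover have "Y' 1 = 0" "Y' 3 = 1" using Y m by (simp_all add: Y'_def E_apply)
    ultimately show ?case using Y'N by blast
  qed
  from this[of "n + 1"] obtain Y where Y: "Y \<in> N" "Y 1 = 0" "Y 3 = 1" "\<And>i. 4 \<le> i \<Longrightarrow> i < n + 1 \<Longrightarrow> D Y i = a * Y i"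
    using n4 by auto
  have "D Y = a *c Y + (D Y 2 - a * Y 2) *c E 2"
  proof
    fix i
    have out: "D Y i = 0 \<and> Y i = 0" if "i = 0 \<or> i > n" using D_in[of Y] Y(1) that by (auto simp: coord_space_def)
    consider "i = 0 \<or> i > n" | "i = 1" | "i = 2" | "i = 3" | "4 \<le> i \<and> i \<le> n" by linarith
    then show "D Y i = (a *c Y + (D Y 2 - a * Y 2) *c E 2) i"
      by cases (use out n4 in \<open>auto simp: D_apply_1 D_apply_3 Y \<kappa> R33 E_apply\<close>)
  qed
  then show ?thesis using Y unfolding a_def by blast
qed

text \<open>The last vector is divided by \<open>R 1 1\<close>, and e_3 is replaced by the
  eigenvector just constructed.\<close>

lemma normalize_\<mu>:
  assumes \<kappa>: "R 3 1 = 0" and \<mu>: "R 1 1 \<noteq> 0"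
  obtains R' S' s' a \<eta> where "L4_extension_nonnil n R' S' s'"
    "algebra_isomorphic vscale K br vscale K (table_bracket (n + 1) (extend_L4 n R' S' s'))"
    "R' 1 1 = 1" "R' 1 3 = a - 1" "R' 3 = a *c E 3 + \<eta> *c E 2"
proof -
  obtain Y \<eta> where Y: "Y \<in> N" "Y 1 = 0" "Y 3 = 1" "D Y = (R 1 1 + R 1 3) *c Y + \<eta> *c E 2"
    using D_eigenvector[OF assms] by blast
  define a where "a = (R 1 1 + R 1 3) / R 1 1"
  define \<eta>' where "\<eta>' = \<eta> / R 1 1"
  define x where "x = (1 / R 1 1) *c E (n + 1)"
  have x: "x \<in> K" "x (n + 1) \<noteq> 0"
    using \<mu> E_last_in_K by (auto simp: x_def E_apply intro!: cvec.subspace_scale[OF subspace_coord_space] simp del: vscale_apply)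
      (simp add: E_apply)
  have brx: "br v x = (1 / R 1 1) *c D v" if "v \<in> N" for v
    unfolding x_def using that N_sub_K E_last_in_K br_last_right[OF that] alg.br_scale_right by (metis subsetD)
  have G: "L4_generators n (E 1) Y 1"
    using n4 Y E13_in_N by unfold_locales (auto simp: E_apply)
  interpret G: L4_generators n "E 1" Y 1 by (rule G)
  obtain R' S' s' where B: "L4_extension n R' S' s'"
    "algebra_isomorphic vscale K br vscale K (table_bracket (n + 1) (extend_L4 n R' S' s'))"
    "\<And>i. 1 \<le> i \<Longrightarrow> i \<le> n \<Longrightarrow> L4_comb n (E 1) Y (R' i) = br (L4_basis n (E 1) Y i) x"
    using change_of_basis[OF G x] by metis
  interpret B: L4_extension n R' S' s' by (rule B(1))
  have R1: "G.comb (R' 1) = (1 / R 1 1) *c R 1"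
    using B(3)[of 1] n4 E13_in_N by (simp add: G.b_simps brx D_E del: vscale_apply)
  have "R' 1 1 = 1"
    using G.comb_1[of "R' 1"] Y \<mu> unfolding R1 by (simp add: E_apply)
  moreover have "R' 1 3 = a - 1"
    using G.comb_3[of "R' 1"] Y \<mu> unfolding R1 by (simp add: E_apply a_def field_simps)
  moreover have "R' 3 = a *c E 3 + \<eta>' *c E 2"
  proof (rule G.comb_inj)
    have "G.comb (R' 3) = (1 / R 1 1) *c D Y"
      using B(3)[of 3] n4 by (simp add: G.b_simps brx Y(1) del: vscale_apply)
    also have "\<dots> = a *c Y + \<eta>' *c E 2"
      unfolding Y(4) by (simp add: fun_eq_iff a_def \<eta>'_def field_simps)
    also have "\<dots> = G.comb (a *c E 3 + \<eta>' *c E 2)"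
      using n4 by (simp add: L4_comb_linear L4_comb_E G.b_simps del: vscale_apply)
    finally show "G.comb (R' 3) = G.comb (a *c E 3 + \<eta>' *c E 2)" .
    show "R' 3 \<in> N" using B.R_in n4 by simp
    show "a *c E 3 + \<eta>' *c E 2 \<in> N"
      using n4 by (intro cvec.subspace_add[OF subspace_coord_space] cvec.subspace_scale[OF subspace_coord_space] E_in_N) auto
  qed
  ultimately show ?thesis using that[OF L4_extension_nonnil_transfer[OF B(1,2)] B(2)] by blast
qed

lemma normalize_a:
  assumes \<kappa>: "R 3 1 = 0" and \<mu>: "R 1 1 = 0"
  obtains R' S' s' where "L4_extension_nonnil n R' S' s'"
    "algebra_isomorphic vscale K br vscale K (table_bracket (n + 1) (extend_L4 n R' S' s'))"
    "R' 1 1 = 0" "R' 1 3 = 1" "R' 3 1 = 0" "R' 3 3 = 1"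
proof -
  define a where "a = R 1 3"
  have a: "a \<noteq> 0" using nondegenerate assms by (simp add: a_def)
  have R: "R 1 3 = a" "R 3 3 = a" using R_relation assms by (simp_all add: a_def)
  define x where "x = (1 / a) *c E (n + 1)"
  have x: "x \<in> K" "x (n + 1) \<noteq> 0"
    using a E_last_in_K by (auto simp: x_def E_apply intro!: cvec.subspace_scale[OF subspace_coord_space] simp del: vscale_apply)
      (simp add: E_apply)
  have brx: "br v x = (1 / a) *c D v" if "v \<in> N" for v
    unfolding x_def using that N_sub_K E_last_in_K br_last_right[OF that] alg.br_scale_right by (metis subsetD)
  obtain R' S' s' where B: "L4_extension_nonnil n R' S' s'"
    "algebra_isomorphic vscale K br vscale K (table_bracket (n + 1) (extend_L4 n R' S' s'))"
    "\<And>i. 1 \<le> i \<Longrightarrow> i \<le> n \<Longrightarrow> R' i = br (E i) x"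
    using change_of_last[OF x] by metis
  have "R' 1 = (1 / a) *c R 1" "R' 3 = (1 / a) *c R 3"
    using B(3)[of 1] B(3)[of 3] n4 E13_in_N by (simp_all add: brx D_E del: vscale_apply)
  then show ?thesis using that[OF B(1,2)] assms a by (simp add: R)
qed

text \<open>With equal eigenvalues and \<kappa> nonzero the action on the quotient is a Jordan
  block, whose eigenvalue is nonzero and is scaled to 1; \<open>g\<close> is the size of the
  off-diagonal entry relative to it.\<close>

lemma normalize_Jordan:
  assumes n: "n = 4" and \<kappa>: "R 3 1 \<noteq> 0" and eq: "R 1 1 + R 1 3 = R 1 1 - R 3 1"
  obtains R' S' s' where "L4_extension_nonnil n R' S' s'"
    "algebra_isomorphic vscale K br vscale K (table_bracket (n + 1) (extend_L4 n R' S' s'))"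
    "R' 1 1 = 2" "R' 1 3 = - 1" "R' 3 1 = 1" "R' 3 3 = 0"
proof -
  define a g where "a = R 1 1 + R 1 3" and "g = R 1 3 / a"
  have a: "a \<noteq> 0" using nondegenerate eq unfolding a_def by auto
  have ga: "g * a = R 1 3" using a by (simp add: g_def)
  have R13: "R 1 3 = g * a" by (simp add: ga)
  have R31: "R 3 1 = - (g * a)" unfolding ga using eq by algebra
  have R11: "R 1 1 = a - g * a" unfolding ga unfolding a_def by simp
  have "R 3 3 = R 1 1 + R 1 3 - R 3 1" by (simp add: R_relation)
  then have R33: "R 3 3 = a + g * a" unfolding R31 by (simp add: a_def)
  note R = R13 R31 R11 R33
  have g: "g \<noteq> 0" using \<kappa> R by auto
  define x where "x = (1 / a) *c E (n + 1)"
  have x: "x \<in> K" "x (n + 1) \<noteq> 0"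
    using a E_last_in_K by (auto simp: x_def E_apply intro!: cvec.subspace_scale[OF subspace_coord_space] simp del: vscale_apply)
      (simp add: E_apply)
  have brx: "br v x = (1 / a) *c D v" if "v \<in> N" for v
    unfolding x_def using that N_sub_K E_last_in_K br_last_right[OF that] alg.br_scale_right by (metis subsetD)
  \<comment> \<open>This is e_1 - g (e_3 - e_1). Modulo the derived algebra and after division by
    \<open>a\<close>, \<open>D\<close> sends \<open>Y\<close> to e_1 and e_1 to 2 e_1 - Y, which are
    the required entries.\<close>
  define Y where "Y = (1 + g) *c E 1 - g *c E 3"
  have Y: "Y 1 = 1 + g" "Y 3 = - g" by (simp_all add: Y_def E_apply)
  have YN: "Y \<in> N" unfolding Y_def using E13_in_N
    by (intro cvec.subspace_diff[OF subspace_coord_space] cvec.subspace_scale[OF subspace_coord_space]) auto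
  have G: "L4_generators n (E 1) Y 1"
    using n g YN E13_in_N by unfold_locales (auto simp: E_apply Y)
  interpret G: L4_generators n "E 1" Y 1 by (rule G)
  obtain R' S' s' where B: "L4_extension n R' S' s'"
    "algebra_isomorphic vscale K br vscale K (table_bracket (n + 1) (extend_L4 n R' S' s'))"
    "\<And>i. 1 \<le> i \<Longrightarrow> i \<le> n \<Longrightarrow> L4_comb n (E 1) Y (R' i) = br (L4_basis n (E 1) Y i) x"
    using change_of_basis[OF G x] by metis
  have R1: "G.comb (R' 1) = (1 / a) *c D (E 1)" and R3: "G.comb (R' 3) = (1 / a) *c D Y"
    using B(3)[of 1] B(3)[of 3] n4 E13_in_N YN by (simp_all add: G.b_simps brx del: vscale_apply)
  have "- (R' 1 3 * g) = g"
    using G.comb_3[of "R' 1"] a unfolding R1 by (simp add: E_apply Y D_apply_3 R)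
  then have 13: "R' 1 3 = - 1" using g by (metis minus_minus mult_cancel_right1 mult_minus_left)
  moreover have "R' 1 1 = 2"
    using G.comb_1[of "R' 1"] a unfolding R1 by (simp add: E_apply Y D_apply_1 R 13 diff_divide_distrib)
  moreover have "- (R' 3 3 * g) = (1 / a) * (g * a * (1 + g) + (a + g * a) * (- g))"
    using G.comb_3[of "R' 3"] unfolding R3 by (simp add: E_apply Y D_apply_3 R)
  then have 33: "R' 3 3 = 0" using g a by (simp add: algebra_simps)
  moreover have "R' 3 1 = (1 / a) * ((a - g * a) * (1 + g) + (- (g * a)) * (- g))"
    using G.comb_1[of "R' 3"] 33 unfolding R3 by (simp add: E_apply Y D_apply_1 R)
  then have "R' 3 1 = 1" using a by (simp add: field_simps)
  ultimately show ?thesis using that[OF L4_extension_nonnil_transfer[OF B(1,2)] B(2)] by blast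
qed

lemma isomorphic_to_model:
  assumes a: "R 1 1 + R 1 3 = a" and \<mu>: "R 1 1 = \<mu>" and \<kappa>: "R 3 1 = \<kappa>"
    and c: "\<And>k. 5 \<le> k \<Longrightarrow> k \<le> n \<Longrightarrow> c (k - 3) = R 3 k"
  obtains \<beta> \<eta> q r s1 s2 where "model_admissible n a \<mu> \<kappa> \<beta> \<eta> q r s2"
    "algebra_isomorphic vscale K br vscale K (table_bracket (n + 1) (model n a \<mu> \<kappa> c \<beta> \<eta> q r s1 s2))"
proof -
  \<comment> \<open>Right multiplication by \<open>n0\<close> cancels the coordinates of
    \<open>R 1\<close> from index 4 on and coordinate 4 of \<open>R 3\<close>. The later coordinates
    of \<open>R 3\<close> are untouched and become \<open>c\<close>; changes along e_2 are absorbed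
    by \<beta> and \<eta>.\<close>
  define n0 where "n0 i = (if i = 1 then - R 3 4 else if 3 \<le> i \<and> i < n then R 1 (i + 1) else 0)" for i
  have n0: "n0 \<in> N" using n4 by (auto simp: coord_space_def n0_def)
  define x where "x = E (n + 1) + n0"
  have x: "x \<in> K" "x (n + 1) \<noteq> 0"
    using n0 N_sub_K E_last_in_K N_last[OF n0] cvec.subspace_add[OF subspace_coord_space]
    by (auto simp: x_def E_apply)
  have brx: "br v x = D v + nu n v n0" if "v \<in> N" for v
    unfolding x_def using that N_sub_K E_last_in_K n0
    by (simp add: alg.br_add_right subset_iff br_last br_N)
  obtain R' S' s' where B: "L4_extension_nonnil n R' S' s'"
    "algebra_isomorphic vscale K br vscale K (table_bracket (n + 1) (extend_L4 n R' S' s'))"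
    "\<And>i. 1 \<le> i \<Longrightarrow> i \<le> n \<Longrightarrow> R' i = br (E i) x"
    using change_of_last[OF x] by metis
  interpret B: L4_extension_nonnil n R' S' s' by (rule B(1))
  have R': "R' 1 = R 1 + nu n (E 1) n0" "R' 3 = R 3 + nu n (E 3) n0"
    using B(3)[of 1] B(3)[of 3] n4 E13_in_N by (simp_all add: brx D_E)
  have R13: "R 1 3 = a - \<mu>" "R 3 3 = a - \<kappa>"
    unfolding a[symmetric] \<mu>[symmetric] \<kappa>[symmetric] by simp (simp add: R_relation)
  have out: "R i k = 0" if "i = 1 \<or> i = 3" "k = 0 \<or> k > n" for i k
    using R_in[of i] that n4 by (auto simp: coord_space_def)
  have m1: "R' 1 = model_R n a \<mu> \<kappa> c (R' 1 2) (R' 3 2) 1"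
  proof
    fix k
    consider "k = 0 \<or> k > n" | "k = 1" | "k = 2" | "k = 3" | "k = 4" | "5 \<le> k" "k \<le> n" by linarith
    then show "R' 1 k = model_R n a \<mu> \<kappa> c (R' 1 2) (R' 3 2) 1 k"
      unfolding model_R_apply[OF n4] R'
      using n4 by cases (auto simp: nu_def E_apply n0_def R13 \<mu> out)
  qed
  have m3: "R' 3 = model_R n a \<mu> \<kappa> c (R' 1 2) (R' 3 2) 3"
  proof
    fix k
    consider "k = 0 \<or> k > n" | "k = 1" | "k = 2" | "k = 3" | "k = 4" | "5 \<le> k" "k \<le> n" by linarith
    then show "R' 3 k = model_R n a \<mu> \<kappa> c (R' 1 2) (R' 3 2) 3 k"
      unfolding model_R_apply[OF n4] R'
      using n4 by cases (auto simp: nu_def E_apply n0_def R13 \<kappa> out c)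
  qed
  have \<kappa>0: "\<kappa> = 0 \<or> n = 4" using R31 \<kappa> by simp
  have nd: "a \<noteq> 0 \<or> \<mu> \<noteq> \<kappa>" using nondegenerate a \<mu> \<kappa> by simp
  show ?thesis
    using that[OF B.determined_by_generators(4)[OF \<kappa>0 m1 m3 nd]] B(2)
    unfolding B.table_eq_model[OF \<kappa>0 m1 m3 nd] by blast
qed

end

section \<open>Rescaling and the classification\<close>

text \<open>The change is e_1 to t e_1 + p e_2, e_3 to t e_3 + w e_2, and addition of m e_2 to the
  last vector. The terms 2 a p and 2 a w come from the action on e_2; the subtracted terms come from
  rewriting e_1 and e_3 in the new generators.\<close>

lemma model_rescale:
  fixes a \<mu> \<kappa> \<beta> \<eta> q r s1 s2 t p w m :: complex and c :: "nat \<Rightarrow> complex"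
  assumes n: "n \<ge> 4" and adm: "model_admissible n a \<mu> \<kappa> \<beta> \<eta> q r s2" and nd: "a \<noteq> 0 \<or> \<mu> \<noteq> \<kappa>"
    and t: "t \<noteq> 0"
  shows "algebra_isomorphic
    vscale (coord_space (n + 1)) (table_bracket (n + 1) (model n a \<mu> \<kappa> c \<beta> \<eta> q r s1 s2))
    vscale (coord_space (n + 1)) (table_bracket (n + 1) (model n a \<mu> \<kappa> (\<lambda>j. c j / t ^ j)
      ((t * \<beta> + 2 * a * p - \<mu> * p - (a - \<mu>) * w) / t ^ 2) ((t * \<eta> + 2 * a * w - \<kappa> * p - (a - \<kappa>) * w) / t ^ 2)
      ((t * q + 2 * a * p) / t ^ 2) ((t * r + 2 * a * w) / t ^ 2) ((s1 + 2 * a * m) / t ^ 2) (s2 / t ^ (n - 2))))"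
proof -
  let ?R = "model_R n a \<mu> \<kappa> c \<beta> \<eta>"
  define \<beta>' \<eta>' q' r' s1' s2' c' where
    "\<beta>' = (t * \<beta> + 2 * a * p - \<mu> * p - (a - \<mu>) * w) / t ^ 2"
    and "\<eta>' = (t * \<eta> + 2 * a * w - \<kappa> * p - (a - \<kappa>) * w) / t ^ 2"
    and "q' = (t * q + 2 * a * p) / t ^ 2" and "r' = (t * r + 2 * a * w) / t ^ 2"
    and "s1' = (s1 + 2 * a * m) / t ^ 2" and "s2' = s2 / t ^ (n - 2)" and "c' = (\<lambda>j. c j / t ^ j)"
  have defs: "t ^ 2 * \<beta>' = t * \<beta> + 2 * a * p - \<mu> * p - (a - \<mu>) * w"
    "t ^ 2 * \<eta>' = t * \<eta> + 2 * a * w - \<kappa> * p - (a - \<kappa>) * w"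
    "t ^ 2 * q' = t * q + 2 * a * p" "t ^ 2 * r' = t * r + 2 * a * w"
    "t ^ 2 * s1' = s1 + 2 * a * m" "t ^ (n - 2) * s2' = s2"
    using t by (simp_all add: \<beta>'_def \<eta>'_def q'_def r'_def s1'_def s2'_def)
  have \<kappa>0: "\<kappa> = 0 \<or> n = 4" using adm by (simp add: model_admissible_def)
  interpret L4_extension n ?R "\<lambda>i. model_Q a q r i - ?R i" "s1 *c E 2 + s2 *c E n"
    by (rule L4_extension_model[OF n adm])
  have br_model: "br = table_bracket (n + 1) (model n a \<mu> \<kappa> c \<beta> \<eta> q r s1 s2)"
    by (simp add: model_def)
  define X where "X = t *c E 1 + p *c E 2"
  define Y where "Y = t *c E 3 + w *c E 2"
  define x where "x = E (n + 1) + m *c E 2"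
  have E2N: "E 2 \<in> N" using n by (intro E_in_N) auto
  have XYN: "X \<in> N" "Y \<in> N"
    unfolding X_def Y_def using E13_in_N E2N
    by (auto intro!: cvec.subspace_add[OF subspace_coord_space] cvec.subspace_scale[OF subspace_coord_space])
  have XY: "X 1 = t" "X 3 = 0" "Y 1 = 0" "Y 3 = t" by (simp_all add: X_def Y_def E_apply)
  have xK: "x \<in> K" unfolding x_def using E_last_in_K E2N N_sub_K
    by (intro cvec.subspace_add[OF subspace_coord_space] cvec.subspace_scale[OF subspace_coord_space]) auto
  have xT: "x (n + 1) \<noteq> 0" using n by (simp add: x_def E_apply)
  have G: "L4_generators n X Y t"
    using n XYN t by unfold_locales (simp_all add: XY)
  interpret G: L4_generators n X Y t by (rule G)
  \<comment> \<open>The degree of e_k is k - 2, and the shifts along e_2 are invisible to the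
    bracket of \<open>N\<close>.\<close>
  have basis: "G.b k = t ^ (k - 2) *c E k" if "4 \<le> k" "k \<le> n" for k
    using that
  proof (induction k rule: dec_induct)
    case base
    show ?case
      unfolding G.b_simps by (auto simp: nu_def fun_eq_iff XY E_apply power2_eq_square X_def Y_def)
  next
    case (step k)
    then have "G.b (Suc k) = nu n (t ^ (k - 2) *c E k) X"
      using G.b_simps(5)[of k] unfolding Suc_eq_plus1 by (simp del: vscale_apply)
    also have "\<dots> = (t * t ^ (k - 2)) *c E (Suc k)"
      using step by (auto simp: nu_def fun_eq_iff XY E_apply)
    also have "t * t ^ (k - 2) = t ^ (Suc k - 2)"
    proof -
      have "Suc k - 2 = Suc (k - 2)" using step by linarith
      then show ?thesis by (simp only: power_Suc)
    qed
    finally show ?case .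
  qed
  have comb: "G.comb v i = (if i = 2 then v 1 * p + v 2 * t ^ 2 + v 3 * w
      else if i = 1 \<or> i = 3 then t * v i else if 4 \<le> i \<and> i \<le> n then t ^ (i - 2) * v i else 0)" for v i
  proof -
    have "(\<Sum>k=4..n. v k * G.b k i) = (\<Sum>k=4..n. if k = i then t ^ (i - 2) * v i else 0)"
      by (intro sum.cong refl) (simp add: basis E_apply)
    also have "\<dots> = (if 4 \<le> i \<and> i \<le> n then t ^ (i - 2) * v i else 0)" by simp
    finally show ?thesis
      unfolding L4_comb_apply G.sum_split4 G.b_simps
      by (simp add: X_def Y_def E_apply power2_eq_square)
  qed
  obtain R' S' s' where B: "L4_extension n R' S' s'"
    "algebra_isomorphic vscale K br vscale K (table_bracket (n + 1) (extend_L4 n R' S' s'))"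
    "\<And>i. 1 \<le> i \<Longrightarrow> i \<le> n \<Longrightarrow> G.comb (R' i) = br (G.b i) x"
    "\<And>i. 1 \<le> i \<Longrightarrow> i \<le> n \<Longrightarrow> G.comb (S' i) = br x (G.b i)"
    "G.comb s' = br x x"
    by (rule change_of_basis[OF G xK xT]) (rule that; blast)
  interpret B: L4_extension n R' S' s' by (rule B(1))
  have KE: "E (n + 1) \<in> K" "m *c E 2 \<in> K" and mN: "m *c E 2 \<in> N"
    using E_last_in_K E2N N_sub_K cvec.subspace_scale[OF subspace_coord_space] by auto
  have brx: "br v x = D v" "br x v = L v" if "v \<in> N" for v
    unfolding x_def using that N_sub_K KE mN
    by (simp_all add: alg.br_add_right alg.br_add_left subset_iff br_last br_N nu_E2 del: vscale_apply)
  have D13: "D (t *c E i + u *c E 2) = t *c ?R i + u *c ?R 2" if "i = 1 \<or> i = 3" for i u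
    using that n by (auto simp: lin_add lin_scale D_E simp del: vscale_apply)
  have LQ: "D v + L v = lin n (model_Q a q r) v" for v by (simp add: lin_diff)
  have m1: "R' 1 = model_R n a \<mu> \<kappa> c' \<beta>' \<eta>' 1"
  proof (rule G.comb_inj)
    have "G.comb (R' 1) = D X" using B(3)[of 1] n by (simp add: G.b_simps brx XYN)
    also have "\<dots> = t *c ?R 1 + p *c ?R 2" unfolding X_def by (rule D13) simp
    also have "\<dots> = G.comb (model_R n a \<mu> \<kappa> c' \<beta>' \<eta>' 1)"
      by (rule ext) (use n defs in \<open>simp add: comb model_R_apply algebra_simps\<close>)
    finally show "G.comb (R' 1) = G.comb (model_R n a \<mu> \<kappa> c' \<beta>' \<eta>' 1)" .
  qed (use n B.R_in model_R_in_coord_space in auto)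
  have m3: "R' 3 = model_R n a \<mu> \<kappa> c' \<beta>' \<eta>' 3"
  proof (rule G.comb_inj)
    have "G.comb (R' 3) = D Y" using B(3)[of 3] n by (simp add: G.b_simps brx XYN)
    also have "\<dots> = t *c ?R 3 + w *c ?R 2" unfolding Y_def by (rule D13) simp
    also have "\<dots> = G.comb (model_R n a \<mu> \<kappa> c' \<beta>' \<eta>' 3)"
    proof
      fix i
      have "t * c (i - 3) = t ^ (i - 2) * c' (i - 3)" if "5 \<le> i"
      proof -
        have "i - 2 = Suc (i - 3)" using that by simp
        then show ?thesis using t by (simp add: c'_def)
      qed
      then show "(t *c ?R 3 + w *c ?R 2) i = G.comb (model_R n a \<mu> \<kappa> c' \<beta>' \<eta>' 3) i"
        using n defs by (simp add: comb model_R_apply algebra_simps)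
    qed
    finally show "G.comb (R' 3) = G.comb (model_R n a \<mu> \<kappa> c' \<beta>' \<eta>' 3)" .
  qed (use n B.R_in model_R_in_coord_space in auto)
  have combE2: "G.comb (u *c E 2) = (t ^ 2 * u) *c E 2" for u
    by (rule ext) (simp add: comb E_apply)
  have "R' 1 + S' 1 = q' *c E 2"
  proof (rule G.comb_inj)
    have "G.comb (R' 1 + S' 1) = lin n (model_Q a q r) X"
      using B(3)[of 1] B(4)[of 1] n LQ[of X] by (simp add: L4_comb_linear G.b_simps brx XYN)
    also have "\<dots> = G.comb (q' *c E 2)"
      unfolding combE2 lin_model_Q[OF n] by (simp add: X_def E_apply defs mult.commute[of q])
    finally show "G.comb (R' 1 + S' 1) = G.comb (q' *c E 2)" .
  qed (use n B.R_in B.S_in E2N in \<open>auto intro!: cvec.subspace_add[OF subspace_coord_space] cvec.subspace_scale[OF subspace_coord_space] simp del: vscale_apply\<close>)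
  then have q': "R' 1 2 + S' 1 2 = q'" by (metis E_apply mult.right_neutral plus_fun_apply vscale_apply)
  have "R' 3 + S' 3 = r' *c E 2"
  proof (rule G.comb_inj)
    have "G.comb (R' 3 + S' 3) = lin n (model_Q a q r) Y"
      using B(3)[of 3] B(4)[of 3] n LQ[of Y] by (simp add: L4_comb_linear G.b_simps brx XYN)
    also have "\<dots> = G.comb (r' *c E 2)"
      unfolding combE2 lin_model_Q[OF n] by (simp add: Y_def E_apply defs mult.commute[of r])
    finally show "G.comb (R' 3 + S' 3) = G.comb (r' *c E 2)" .
  qed (use n B.R_in B.S_in E2N in \<open>auto intro!: cvec.subspace_add[OF subspace_coord_space] cvec.subspace_scale[OF subspace_coord_space] simp del: vscale_apply\<close>)
  then have r': "R' 3 2 + S' 3 2 = r'" by (metis E_apply mult.right_neutral plus_fun_apply vscale_apply)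
  have s': "s' = s1' *c E 2 + s2' *c E n"
  proof (rule G.comb_inj)
    \<comment> \<open>Left multiplication kills e_2 while right multiplication is 2 a there, so a
      shift of the last vector changes its square by 2 a m e_2 only.\<close>
    have DE2: "D (E 2) = (2 * a) *c E 2" using n D_E[of 2] by (simp add: model_R_def)
    have LE2: "L (E 2) = 0"
      using LQ[of "E 2"] DE2 n by (simp add: lin_model_Q E_apply)
    have "br x x = br x (E (n + 1)) + br x (m *c E 2)"
      by (subst (2) x_def) (rule alg.br_add_right[OF xK KE])
    also have "br x (m *c E 2) = 0"
      unfolding brx(2)[OF mN] lin_scale LE2 by simp
    also have "br x (E (n + 1)) = (s1 *c E 2 + s2 *c E n) + D (m *c E 2)"
      unfolding x_def using alg.br_add_left[OF KE KE(1)] by (simp only: br_last mN)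
    also have "D (m *c E 2) = (2 * a * m) *c E 2"
      unfolding lin_scale DE2 by (simp add: fun_eq_iff)
    finally have "G.comb s' = (s1 *c E 2 + s2 *c E n) + (2 * a * m) *c E 2 + 0"
      unfolding B(5) .
    also have "\<dots> = G.comb (s1' *c E 2 + s2' *c E n)"
      by (rule ext) (use n defs(5,6) in \<open>auto simp: comb E_apply algebra_simps\<close>)
    finally show "G.comb s' = G.comb (s1' *c E 2 + s2' *c E n)" .
    show "s' \<in> N" by (rule B.s_in)
    show "s1' *c E 2 + s2' *c E n \<in> N"
      using E2N E_in_N[of n] n by (intro cvec.subspace_add[OF subspace_coord_space] cvec.subspace_scale[OF subspace_coord_space]) auto
  qed
  have s'2: "s' 2 = s1'" "s' n = s2'" using n unfolding s' by (simp_all add: E_apply)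
  show ?thesis
    using B(2) unfolding br_model B.table_eq_model[OF \<kappa>0 m1 m3 nd] q' r' s'2
    unfolding \<beta>'_def \<eta>'_def q'_def r'_def s1'_def s2'_def c'_def .
qed

text \<open>Coefficients outside this range never enter the table. This bridges truncated
  subtraction: the listed form uses j - 2, which repeats a value for j below 2.\<close>

lemma model_cong:
  assumes "\<And>j. 2 \<le> j \<Longrightarrow> j + 3 \<le> n \<Longrightarrow> c j = c' j"
  shows "table_bracket (n + 1) (model n a \<mu> \<kappa> c \<beta> \<eta> q r s1 s2)
    = table_bracket (n + 1) (model n a \<mu> \<kappa> c' \<beta> \<eta> q r s1 s2)"
proof -
  have "model_R n a \<mu> \<kappa> c \<beta> \<eta> i = model_R n a \<mu> \<kappa> c' \<beta> \<eta> i" if "1 \<le> i" for i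
  proof -
    have "(\<Sum>k=5..n. c (k - 3) *c E k) = (\<Sum>k=5..n. c' (k - 3) *c E k)"
    proof (intro sum.cong refl)
      fix k assume k: "k \<in> {5..n}"
      have "c (k - 3) = c' (k - 3)" by (rule assms) (use k in auto)
      then show "c (k - 3) *c E k = c' (k - 3) *c E k" by (simp only:)
    qed
    moreover have "(\<Sum>k=i+2..n. c (k - i) *c E k) = (\<Sum>k=i+2..n. c' (k - i) *c E k)" if "3 < i"
    proof (intro sum.cong refl)
      fix k assume k: "k \<in> {i + 2..n}"
      have "c (k - i) = c' (k - i)" by (rule assms) (use k that in auto)
      then show "c (k - i) *c E k = c' (k - i) *c E k" by (simp only:)
    qed
    ultimately show ?thesis
      using that unfolding model_R_def by (cases "3 < i") (auto simp del: vscale_apply sum_fun_apply)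
  qed
  then show ?thesis
    by (intro table_bracket_cong) (auto simp: model_def extend_L4_def simp del: vscale_apply sum_fun_apply)
qed

lemma complex_root_exists:
  assumes "0 < k"
  shows "\<exists>z :: complex. z ^ k = w"
proof -
  have "rcis (root k (cmod w)) (Arg w / k) ^ k = w"
    using assms by (simp add: DeMoivre2 rcis_cmod_Arg)
  then show ?thesis ..
qed

definition normal_model :: "nat \<Rightarrow> table \<Rightarrow> bool" where
  "normal_model n t \<longleftrightarrow>
     (\<exists>a \<beta> \<eta> q r s1 s2. t = model n a 1 0 (\<lambda>_. 0) \<beta> \<eta> q r s1 s2 \<and> model_admissible n a 1 0 \<beta> \<eta> q r s2) \<or>
     (\<exists>c \<beta> \<eta> q r s1 s2. t = model n 1 0 0 c \<beta> \<eta> q r s1 s2 \<and> model_admissible n 1 0 0 \<beta> \<eta> q r s2) \<or>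
     (n = 4 \<and> (\<exists>\<beta> \<eta> q r s1 s2. t = model n 1 2 1 (\<lambda>_. 0) \<beta> \<eta> q r s1 s2 \<and> model_admissible n 1 2 1 \<beta> \<eta> q r s2))"

lemma (in L4_extension_nonnil) isomorphic_to_normal_model_\<kappa>_zero:
  assumes \<kappa>: "R 3 1 = 0"
  shows "\<exists>t. normal_model n t \<and> algebra_isomorphic vscale K br vscale K (table_bracket (n + 1) t)"
proof (cases "R 1 1 = 0")
  case False
  obtain R' S' s' a \<eta> where B: "L4_extension_nonnil n R' S' s'"
    "algebra_isomorphic vscale K br vscale K (table_bracket (n + 1) (extend_L4 n R' S' s'))"
    "R' 1 1 = 1" "R' 1 3 = a - 1" "R' 3 = a *c E 3 + \<eta> *c E 2"
    by (rule normalize_\<mu>[OF \<kappa> False])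
  interpret B: L4_extension_nonnil n R' S' s' by (rule B(1))
  have c: "R' 1 1 + R' 1 3 = a" "R' 3 1 = 0" "\<And>k. 5 \<le> k \<Longrightarrow> k \<le> n \<Longrightarrow> 0 = R' 3 k"
    using B(3-5) by (auto simp: E_apply)
  obtain \<beta> \<eta> q r s1 s2 where "model_admissible n a 1 0 \<beta> \<eta> q r s2"
    "algebra_isomorphic vscale K B.br vscale K (table_bracket (n + 1) (model n a 1 0 (\<lambda>_. 0) \<beta> \<eta> q r s1 s2))"
    by (rule B.isomorphic_to_model[OF c(1) B(3) c(2), of "\<lambda>_. 0"]) (use c(3) in auto)
  then show ?thesis using algebra_isomorphic_trans[OF B(2)] unfolding normal_model_def by metis
next
  case True
  obtain R' S' s' where B: "L4_extension_nonnil n R' S' s'"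
    "algebra_isomorphic vscale K br vscale K (table_bracket (n + 1) (extend_L4 n R' S' s'))"
    "R' 1 1 = 0" "R' 1 3 = 1" "R' 3 1 = 0" "R' 3 3 = 1"
    by (rule normalize_a[OF \<kappa> True])
  interpret B: L4_extension_nonnil n R' S' s' by (rule B(1))
  have c: "R' 1 1 + R' 1 3 = 1" using B(3,4) by simp
  obtain \<beta> \<eta> q r s1 s2 where "model_admissible n 1 0 0 \<beta> \<eta> q r s2"
    "algebra_isomorphic vscale K B.br vscale K (table_bracket (n + 1) (model n 1 0 0 (\<lambda>j. R' 3 (j + 3)) \<beta> \<eta> q r s1 s2))"
    by (rule B.isomorphic_to_model[OF c B(3) B(5), of "\<lambda>j. R' 3 (j + 3)"]) auto
  then show ?thesis using algebra_isomorphic_trans[OF B(2)] unfolding normal_model_def by metis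
qed

lemma (in L4_extension_nonnil) isomorphic_to_normal_model:
  "\<exists>t. normal_model n t \<and> algebra_isomorphic vscale K br vscale K (table_bracket (n + 1) t)"
proof (cases "R 3 1 = 0")
  case True
  then show ?thesis by (rule isomorphic_to_normal_model_\<kappa>_zero)
next
  case False
  then have n: "n = 4" using R31 by blast
  show ?thesis
  proof (cases "R 1 1 + R 1 3 = R 1 1 - R 3 1")
    case ne: False
    obtain R' S' s' where B: "L4_extension_nonnil n R' S' s'"
      "algebra_isomorphic vscale K br vscale K (table_bracket (n + 1) (extend_L4 n R' S' s'))"
      "R' 3 1 = 0"
      by (rule eliminate_\<kappa>[OF n ne])
    show ?thesis
      using L4_extension_nonnil.isomorphic_to_normal_model_\<kappa>_zero[OF B(1,3)] algebra_isomorphic_trans[OF B(2)] by blast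
  next
    case True
    obtain R' S' s' where B: "L4_extension_nonnil n R' S' s'"
      "algebra_isomorphic vscale K br vscale K (table_bracket (n + 1) (extend_L4 n R' S' s'))"
      "R' 1 1 = 2" "R' 1 3 = - 1" "R' 3 1 = 1" "R' 3 3 = 0"
      by (rule normalize_Jordan[OF n False True])
    interpret B: L4_extension_nonnil n R' S' s' by (rule B(1))
    have c: "R' 1 1 + R' 1 3 = 1" using B(3,4) by simp
    obtain \<beta> \<eta> q r s1 s2 where "model_admissible n 1 2 1 \<beta> \<eta> q r s2"
      "algebra_isomorphic vscale K B.br vscale K (table_bracket (n + 1) (model n 1 2 1 (\<lambda>_. 0) \<beta> \<eta> q r s1 s2))"
      by (rule B.isomorphic_to_model[OF c B(3) B(5), of "\<lambda>_. 0"]) (use n in auto)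
    then show ?thesis using algebra_isomorphic_trans[OF B(2)] n unfolding normal_model_def by metis
  qed
qed

lemma normal_model_isomorphic_to_listed:
  assumes n: "n \<ge> 4" and t: "normal_model n t"
  shows "\<exists>t'. listed n t' \<and> algebra_isomorphic vscale (coord_space (n + 1)) (table_bracket (n + 1) t)
    vscale (coord_space (n + 1)) (table_bracket (n + 1) t')"
proof -
  have n3: "(of_nat n :: complex) - 3 \<noteq> 0"
  proof -
    have "of_nat n \<noteq> (of_nat 3 :: complex)" using n unfolding of_nat_eq_iff by simp
    then show ?thesis by simp
  qed
  consider
    (A) a \<beta> \<eta> q r s1 s2 where "t = model n a 1 0 (\<lambda>_. 0) \<beta> \<eta> q r s1 s2" "model_admissible n a 1 0 \<beta> \<eta> q r s2" "a \<noteq> 0"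
    | (A0) \<beta> \<eta> q r s1 s2 where "t = model n 0 1 0 (\<lambda>_. 0) \<beta> \<eta> q r s1 s2" "model_admissible n 0 1 0 \<beta> \<eta> q r s2"
    | (B) c \<beta> \<eta> q r s1 s2 where "t = model n 1 0 0 c \<beta> \<eta> q r s1 s2" "model_admissible n 1 0 0 \<beta> \<eta> q r s2"
    | (C) \<beta> \<eta> q r s1 s2 where "n = 4" "t = model n 1 2 1 (\<lambda>_. 0) \<beta> \<eta> q r s1 s2" "model_admissible n 1 2 1 \<beta> \<eta> q r s2"
    using t unfolding normal_model_def by metis
  then show ?thesis
  proof cases
    case A
    have adm: "q + (a - 1) * r + 2 * a * \<beta> = 2 * a * q" "a * r + 2 * a * \<eta> = 2 * a * r" "s2 * (a + of_nat n - 3) = 0"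
      using A(2) by (auto simp: model_admissible_def algebra_simps)
    \<comment> \<open>Rescaling divides \<open>s2\<close> by a power with exponent n - 2, the degree
      of e_n.\<close>
    obtain z where z: "z \<noteq> 0" "s2 / z ^ (n - 2) = (if s2 = 0 then 0 else 1)"
    proof (cases "s2 = 0")
      case False
      obtain z where "z ^ (n - 2) = s2" using complex_root_exists[of "n - 2" s2] n by auto
      then show ?thesis using that[of z] False n by (auto simp: power_0_left split: if_splits)
    qed (use that[of 1] in simp)
    have r: "r = 2 * \<eta>" using adm(2) A(3) by (metis add_diff_cancel_left' mult.assoc mult.commute mult_cancel_left mult_2 add.commute)
    \<comment> \<open>The shifts along e_2 are solved from the vanishing of the new q, r and s1 with
      divisor 2 a; the relation r = 2 \<eta> turns the second into - z \<eta> / a and clears \<eta>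
      as well.\<close>
    have w: "z * r + 2 * a * (- z * \<eta> / a) = 0" "z * \<eta> + 2 * a * (- z * \<eta> / a) - 0 * p - (a - 0) * (- z * \<eta> / a) = 0"
      "z * q + 2 * a * (- z * q / (2 * a)) = 0" "s1 + 2 * a * (- s1 / (2 * a)) = 0" for p
      using A(3) by (simp_all add: r)
    \<comment> \<open>Once the shifts are chosen, the first admissibility equation forces the new
      \<beta> to vanish.\<close>
    have "2 * a * (z * \<beta> + 2 * a * (- z * q / (2 * a)) - 1 * (- z * q / (2 * a)) - (a - 1) * (- z * \<eta> / a))
      = z * (q + (a - 1) * r + 2 * a * \<beta> - 2 * a * q)"
      using A(3) unfolding r by (simp add: field_simps)
    then have b: "z * \<beta> + 2 * a * (- z * q / (2 * a)) - 1 * (- z * q / (2 * a)) - (a - 1) * (- z * \<eta> / a) = 0"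
      using adm(1) A(3) by simp
    have iso: "algebra_isomorphic vscale (coord_space (n + 1)) (table_bracket (n + 1) t)
      vscale (coord_space (n + 1)) (table_bracket (n + 1) (model n a 1 0 (\<lambda>_. 0) 0 0 0 0 0 (if s2 = 0 then 0 else 1)))"
      using model_rescale[OF n A(2) _ z(1), of "\<lambda>_. 0" s1 "- z * q / (2 * a)" "- z * \<eta> / a" "- s1 / (2 * a)"]
      unfolding w b z(2) A(1) by simp
    show ?thesis
    proof (cases "s2 = 0")
      case True
      then show ?thesis using iso g1_eq_model[OF n, of a] listed.i[of n a] by auto
    next
      case False
      then have "a + of_nat n - 3 = 0" using adm(3) by simp
      then have "a = 3 - of_nat n" by (simp add: eq_diff_eq)
      then show ?thesis using iso False g2_eq_model[OF n] listed.ii[of n] by auto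
    qed
  next
    case A0
    have adm: "q = r" "s2 = 0"
      using A0(2) n3 by (auto simp: model_admissible_def)
    obtain z where z: "z \<noteq> 0" "s1 / z ^ 2 = (if s1 = 0 then 0 else 1)"
    proof (cases "s1 = 0")
      case False
      obtain z where "z ^ 2 = s1" using complex_root_exists[of 2 s1] by auto
      then show ?thesis using that[of z] False by auto
    qed (use that[of 1] in simp)
    \<comment> \<open>For a = 0 shifts along e_2 do not affect \<eta>, q, r and s1; only \<beta> can
      be cleared, by p = z \<beta>. Hence these parameters remain, with q = r by
      admissibility.\<close>
    define \<epsilon> d f where "\<epsilon> = (if s1 = 0 then 0 else 1 :: complex)" and "d = z * \<eta> / z ^ 2" and "f = z * r / z ^ 2 - d"
    have iso: "algebra_isomorphic vscale (coord_space (n + 1)) (table_bracket (n + 1) t)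
      vscale (coord_space (n + 1)) (table_bracket (n + 1) (model n 0 1 0 (\<lambda>_. 0) 0 d (d + f) (d + f) \<epsilon> 0))"
      using model_rescale[OF n A0(2) _ z(1), of "\<lambda>_. 0" s1 "z * \<beta>" 0 0] z(2)
      unfolding A0(1) adm d_def f_def \<epsilon>_def by simp
    show ?thesis
    \<comment> \<open>If all three vanish, the model is the first family at a = 0.\<close>
    proof (cases "\<epsilon> = 0 \<and> d = 0 \<and> f = 0")
      case True
      then show ?thesis using iso listed.i[of n 0] by (auto simp: g1_eq_model[OF n])
    next
      case False
      then have "listed n (g4 n \<epsilon> d f)" by (intro listed.iv) (auto simp: \<epsilon>_def)
      then show ?thesis using iso by (auto simp: g4_eq_model[OF n])
    qed
  next
    case B
    have adm: "r = 2 * \<eta>" "q = \<beta> + \<eta>" "s2 = 0"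
    proof -
      have *: "r + 2 * \<beta> = 2 * q" "r + 2 * \<eta> = 2 * r" "s2 = 0" using B(2) by (auto simp: model_admissible_def)
      show "r = 2 * \<eta>" using *(2) by simp
      then have "2 * q = 2 * (\<beta> + \<eta>)" using *(1) by (simp add: add.commute)
      then show "q = \<beta> + \<eta>" unfolding mult_cancel_left by simp
      show "s2 = 0" by (rule *)
    qed
    \<comment> \<open>The coefficient \<open>c 2\<close> has degree 2, so a square root normalizes
      it to 1.\<close>
    obtain z where z: "z \<noteq> 0" "c 2 / z ^ 2 = (if c 2 = 0 then 0 else 1)"
    proof (cases "c 2 = 0")
      case False
      obtain z where z: "z ^ 2 = c 2" using complex_root_exists[of 2 "c 2"] by auto
      then have "z \<noteq> 0" using False by auto
      then show ?thesis using that[of z] False z by simp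
    qed (use that[of 1] in simp)
    define c' where "c' j = c j / z ^ j" for j
    define \<epsilon> where "\<epsilon> = (if c 2 = 0 then 0 else 1 :: complex)"
    have \<epsilon>01: "\<epsilon> \<in> {0, 1}" by (simp add: \<epsilon>_def)
    have iso: "algebra_isomorphic vscale (coord_space (n + 1)) (table_bracket (n + 1) t)
      vscale (coord_space (n + 1)) (table_bracket (n + 1) (model n 1 0 0 c' 0 0 0 0 0 0))"
    proof -
      have e: "z * \<beta> + 2 * 1 * (- z * q / 2) - 0 * (- z * q / 2) - (1 - 0) * (- z * \<eta>) = 0"
        "z * \<eta> + 2 * 1 * (- z * \<eta>) - 0 * (- z * q / 2) - (1 - 0) * (- z * \<eta>) = 0"
        "z * q + 2 * 1 * (- z * q / 2) = 0" "z * r + 2 * 1 * (- z * \<eta>) = 0" "s1 + 2 * 1 * (- s1 / 2) = 0"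
        by (simp_all add: adm field_simps)
      have c'_eq: "(\<lambda>j. c j / z ^ j) = c'" by (simp add: c'_def fun_eq_iff)
      show ?thesis
        using model_rescale[OF n B(2) _ z(1), of c s1 "- z * q / 2" "- z * \<eta>" "- s1 / 2"]
        unfolding e B(1) adm(3) c'_eq by simp
    qed
    also have "table_bracket (n + 1) (model n 1 0 0 c' 0 0 0 0 0 0) = table_bracket (n + 1) (g3 n \<epsilon> (\<lambda>j. c' (j + 2)))"
      unfolding g3_eq_model[OF n]
    proof (rule model_cong)
      fix j :: nat assume "2 \<le> j"
      then have "c' (j - 2 + 2) = c' j" by (simp only: le_add_diff_inverse2)
      then show "c' j = (if j = 2 then \<epsilon> else c' (j - 2 + 2))"
        using z(2) unfolding \<epsilon>_def[symmetric] by (auto simp: c'_def)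
    qed
    finally show ?thesis using listed.iii[OF \<epsilon>01] by blast
  next
    case C
    have adm: "r = 2 * \<beta>" "q + 2 * \<eta> = 2 * r" "s2 = 0" using C(1,3) by (auto simp: model_admissible_def)
    have "algebra_isomorphic vscale (coord_space (n + 1)) (table_bracket (n + 1) t)
      vscale (coord_space (n + 1)) (table_bracket (n + 1) (model n 1 2 1 (\<lambda>_. 0) 0 0 0 0 0 0))"
    proof -
      \<comment> \<open>Here \<open>t = 1\<close>: clearing q, r and s1 by shifts along e_2 already
        makes \<beta> and \<eta> vanish, by admissibility.\<close>
      have q: "q = 4 * \<beta> - 2 * \<eta>" using adm by (simp add: eq_diff_eq)
      have e: "1 * \<beta> + 2 * 1 * (- q / 2) - 2 * (- q / 2) - (1 - 2) * (- r / 2) = 0"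
        "1 * \<eta> + 2 * 1 * (- r / 2) - 1 * (- q / 2) - (1 - 1) * (- r / 2) = 0"
        "1 * q + 2 * 1 * (- q / 2) = 0" "1 * r + 2 * 1 * (- r / 2) = 0" "s1 + 2 * 1 * (- s1 / 2) = 0"
        unfolding q adm(1) by (simp_all add: field_simps)
      show ?thesis
        using model_rescale[OF n C(3) _ one_neq_zero, of "\<lambda>_. 0" s1 "- q / 2" "- r / 2" "- s1 / 2"]
        unfolding e C(2) adm(3) by simp
    qed
    moreover have "table_bracket (n + 1) (model n 1 2 1 (\<lambda>_. 0) 0 0 0 0 0 0) = table_bracket (n + 1) (g5 2 0)"
      using g5_eq_model[of 2 0] C(1) by simp
    moreover have "listed n (g5 2 0)" using C(1) by (intro listed.v) auto
    ultimately show ?thesis by metis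
  qed
qed

theorem theorem5p1p3:
  fixes n :: nat
    and scale :: "complex \<Rightarrow> 'a::ab_group_add \<Rightarrow> 'a"
    and V :: "'a set"
    and br :: "'a \<Rightarrow> 'a \<Rightarrow> 'a"
  assumes "n \<ge> 4"
  shows "(\<forall>t. listed n t \<longrightarrow>
            solvable_indecomposable_with_nilradical_L4 n
              vscale (coord_space (n + 1)) (table_bracket (n + 1) t)) \<and>
         (solvable_indecomposable_with_nilradical_L4 n scale V br \<longrightarrow>
            (\<exists>t. listed n t \<and>
                 algebra_isomorphic scale V br
                   vscale (coord_space (n + 1)) (table_bracket (n + 1) t)))"
proof (intro conjI allI impI)
  show "solvable_indecomposable_with_nilradical_L4 n vscale (coord_space (n + 1)) (table_bracket (n + 1) t)"
    if "listed n t" for t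
    by (rule listed_solvable_indecomposable[OF assms that])
next
  assume V: "solvable_indecomposable_with_nilradical_L4 n scale V br"
  obtain R S s where ext: "L4_extension n R S s"
    and iso: "algebra_isomorphic scale V br vscale (coord_space (n + 1)) (table_bracket (n + 1) (extend_L4 n R S s))"
    and nonnil: "\<not> fd_complex_algebra.nilpotent vscale (table_bracket (n + 1) (extend_L4 n R S s)) (coord_space (n + 1))"
    by (rule L4_extension_exists[OF assms V])
  interpret L4_extension_nonnil n R S s
    using ext nonnil by (intro L4_extension_nonnil.intro L4_extension_nonnil_axioms.intro)
  obtain t where t: "normal_model n t" "algebra_isomorphic vscale K (table_bracket (n + 1) (extend_L4 n R S s)) vscale K (table_bracket (n + 1) t)"
    using isomorphic_to_normal_model by blast
  obtain t' where "listed n t'" "algebra_isomorphic vscale K (table_bracket (n + 1) t) vscale K (table_bracket (n + 1) t')"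
    using normal_model_isomorphic_to_listed[OF assms t(1)] by blast
  then show "\<exists>t. listed n t \<and> algebra_isomorphic scale V br vscale (coord_space (n + 1)) (table_bracket (n + 1) t)"
    using algebra_isomorphic_trans[OF iso algebra_isomorphic_trans[OF t(2)]] by blast
qed

end
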